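(* Let $\omega(s)$ be the meromorphic continuation to $\mathbb{C}$ of $\sum_{j,k=1}^\infty \big(jk(j+k)\big)^{-s}$ (convergent for $\mathrm{Re}(s)>2/3$). The meromorphic function $\Gamma(s)\omega(s)$ has a simple pole at $s=\tfrac23$ with residue $\tfrac13\Gamma\!\left(\tfrac13\right)^2$; a simple pole at $s=0$ with residue $\tfrac13$; and for each $k=0,1,2,\ldots$ a simple pole at $s=\tfrac12-k$ with residue $\frac{1}{4^kk!}\sqrt\pi\,\zeta\!\left(\frac{1-6k}{2}\right)$. It has no other singularities.
   Context: $\Gamma$ is the Euler gamma function and $\zeta$ the Riemann zeta function. *)

theory Defs
  imports "HOL-Complex_Analysis.Complex_Analysis"
begin

text \<open>
  A function that is merely \<open>meromorphic_on\<close> may take arbitrary values on a discrete set.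
  Requiring \<open>nicely_meromorphic_on\<close> (analytic away from the poles, value 0 at the poles)
  makes the continuation unique as a total function, so that \<open>THE\<close> below is justified
  whenever a continuation exists.
\<close>

definition is_meromorphic_continuation ::
  "complex set \<Rightarrow> (complex \<Rightarrow> complex) \<Rightarrow> (complex \<Rightarrow> complex) \<Rightarrow> bool" where
  "is_meromorphic_continuation S f F \<longleftrightarrow>
     F nicely_meromorphic_on UNIV \<and> (\<forall>s\<in>S. F s = f s)"

definition meromorphic_continuation ::
  "complex set \<Rightarrow> (complex \<Rightarrow> complex) \<Rightarrow> complex \<Rightarrow> complex" where
  "meromorphic_continuation S f = (THE F. is_meromorphic_continuation S f F)"

lemma is_meromorphic_continuation_unique:
  assumes S: "open S" "S \<noteq> {}"
    and F: "is_meromorphic_continuation S f F" and G: "is_meromorphic_continuation S f G"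
  shows "F = G"
proof
  fix z :: complex
  from S obtain a where a: "a \<in> S" by auto
  have nF: "F nicely_meromorphic_on UNIV" and nG: "G nicely_meromorphic_on UNIV"
    and eq: "\<And>s. s \<in> S \<Longrightarrow> F s = G s"
    using F G by (auto simp: is_meromorphic_continuation_def)
  have mF: "F meromorphic_on UNIV" and mG: "G meromorphic_on UNIV"
    using nF nG by (auto simp: nicely_meromorphic_on_def)
  define D where "D = (\<lambda>s. F s - G s)"
  have mD: "D meromorphic_on UNIV"
    unfolding D_def by (intro meromorphic_intros mF mG)
  have nD: "remove_sings D nicely_meromorphic_on UNIV"
    by (rule remove_sings_nicely_meromorphic[OF mD])
  have "remove_sings D s = 0" if "s \<in> S" for s
  proof (rule remove_sings_eqI)
    have "eventually (\<lambda>w. w \<in> S) (at s)"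
      using S that by (intro eventually_at_in_open') auto
    hence "eventually (\<lambda>w. D w = 0) (at s)"
      by eventually_elim (simp add: D_def eq)
    thus "D \<midarrow>s\<rightarrow> 0"
      by (rule tendsto_eventually)
  qed
  moreover have "eventually (\<lambda>w. w \<in> S) (at a)"
    using S a by (intro eventually_at_in_open') auto
  ultimately have "eventually (\<lambda>w. remove_sings D w = 0) (at a)"
    by (auto elim: eventually_mono)
  hence "frequently (\<lambda>w. remove_sings D w = 0) (at a)"
    by (intro eventually_frequently) auto
  hence zero: "remove_sings D w = 0" for w
    using frequently_eq_meromorphic_imp_constant[OF _ nD, of 0 a w] by auto
  have "eventually (\<lambda>w. remove_sings D w = D w) (at z)"
    using mD by (intro eventually_remove_sings_eq_at meromorphic_on_isolated_singularity)
      (auto intro: meromorphic_on_subset)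
  hence ev: "eventually (\<lambda>w. F w = G w) (at z)"
    by eventually_elim (use zero in \<open>auto simp: D_def\<close>)
  have pole: "is_pole F z \<longleftrightarrow> is_pole G z"
    using ev by (intro is_pole_cong) auto
  show "F z = G z"
  proof (cases "is_pole F z")
    case True
    hence "\<not> F \<midarrow>z\<rightarrow> F z" "\<not> G \<midarrow>z\<rightarrow> G z"
      using pole not_tendsto_and_filterlim_at_infinity[OF at_neq_bot]
      unfolding is_pole_def by blast+
    thus ?thesis
      using nF nG unfolding nicely_meromorphic_on_def by (metis UNIV_I)
  next
    case False
    hence "F \<midarrow>z\<rightarrow> F z" "G \<midarrow>z\<rightarrow> G z"
      using nF nG pole by (auto simp: nicely_meromorphic_on_def)
    moreover have "F \<midarrow>z\<rightarrow> G z \<longleftrightarrow> G \<midarrow>z\<rightarrow> G z"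
      using ev by (intro tendsto_cong)
    ultimately show ?thesis
      using LIM_unique by blast
  qed
qed

definition zeta :: "complex \<Rightarrow> complex" where
  "zeta = meromorphic_continuation {s. Re s > 1}
            (\<lambda>s. \<Sum>\<^sub>\<infinity>n\<in>{1::nat..}. of_nat n powr (- s))"

definition omega_term :: "complex \<Rightarrow> nat \<times> nat \<Rightarrow> complex" where
  "omega_term s = (\<lambda>(j, k). of_nat (j * k * (j + k)) powr (- s))"

definition omega_series :: "complex \<Rightarrow> complex" where
  "omega_series s = (\<Sum>\<^sub>\<infinity>p\<in>{1..} \<times> {1..}. omega_term s p)"

definition omega :: "complex \<Rightarrow> complex" where
  "omega = meromorphic_continuation {s. Re s > 2/3} omega_series"

text \<open>
  \<open>Gamma\<close> is 0 at its poles, where \<open>omega\<close> may vanish, so the pointwise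
  product can have the wrong value at a removable singularity. The product in the field of
  meromorphic functions is obtained by \<open>remove_sings\<close>.
\<close>

definition Gamma_omega :: "complex \<Rightarrow> complex" where
  "Gamma_omega = remove_sings (\<lambda>s. Gamma s * omega s)"

definition has_simple_pole :: "(complex \<Rightarrow> complex) \<Rightarrow> complex \<Rightarrow> bool" where
  "has_simple_pole f z \<longleftrightarrow> isolated_singularity_at f z \<and> is_pole f z \<and> zorder f z = -1"

end

theory Submission
  imports Defs "HOL-Real_Asymp.Real_Asymp"
begin

text \<open>
  Writing \<open>\<Gamma>(s) (j + k)\<^sup>-\<^sup>s\<close> as a Mellin integral gives
  \<open>\<Gamma>(s) \<omega>(s) = \<integral>\<^sub>0\<^sup>\<infinity> t\<^sup>s\<^sup>-\<^sup>1 Li\<^sub>s(e\<^sup>-\<^sup>t)\<^sup>2 dt\<close> for real \<open>2/3 < s < 1\<close>. The part over \<open>t > 1\<close> is entire.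
  On \<open>0 < t < 1\<close> one inserts \<open>Li\<^sub>s(e\<^sup>-\<^sup>t) = \<Gamma>(1 - s) t\<^sup>s\<^sup>-\<^sup>1 + \<Sum>\<^sub>n \<zeta>(s - n) (-t)\<^sup>n / n!\<close> and integrates
  termwise; the poles for \<open>Re s < 1\<close> can then be read off. The apparent poles at \<open>s = -1, -2, \<dots>\<close> cancel
  by a quadratic identity for Bernoulli numbers, which follows from the addition theorem of the
  hyperbolic cotangent. The expansion of the polylogarithm, like the continuation of \<open>\<zeta>\<close>, is
  obtained from the duplication formula: \<open>Li\<^sub>s(e\<^sup>-\<^sup>t) - 2\<^sup>1\<^sup>-\<^sup>s Li\<^sub>s(e\<^sup>-\<^sup>2\<^sup>t)\<close> is an alternating series, which
  Euler's transformation continues to all \<open>s\<close> and to a neighbourhood of \<open>t = 0\<close>. Finally the poles at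
  \<open>1/2 - k\<close> are genuine since \<open>\<zeta>\<close> does not vanish at the relevant half-integers: for \<open>k = 0\<close> by
  positivity of the alternating series, for \<open>k > 0\<close> by the functional equation.
\<close>

text \<open>Real \<open>s\<close> between 2/3 and 1 is forced from both sides: the double series
  needs \<open>s > 2/3\<close>, the expansion of the polylogarithm is controlled for
  \<open>s < 1\<close>. For real \<open>s\<close> all integrands are nonnegative, so sum and
  integral may be exchanged; the identity theorem then reaches the strip.

  A duplication formula determines a function only up to solutions of the homogeneous equation.
  These are excluded by the behaviour at t = 0 for the expansion, and by boundedness on a half-plane
  for the functional equation.

  Dividing the n-th Taylor coefficient by \<open>1 - 2 powr (1 - s + n)\<close> doubles the
  guaranteed radius of convergence from 1 to 2. Hence the expansion and its square converge
  absolutely up to t = 1, as termwise integration over the unit interval requires.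

  At \<open>s = - M\<close> two families of poles meet, and the residue is a single Bernoulli
  coefficient plus a convolution. For odd \<open>M\<close> parity suffices. For even
  \<open>M\<close> the convolution carries factorial weights, so the addition theorem is used with a
  free parameter \<open>x\<close>, whose powers are then replaced by suitable weights.\<close>

section \<open>Holomorphy of locally dominated series\<close>

lemma holomorphic_infsum:
  fixes f :: "'i \<Rightarrow> complex \<Rightarrow> complex"
  assumes "open S" and hol: "\<And>i. i \<in> I \<Longrightarrow> f i holomorphic_on S"
    and bound: "\<And>z. z \<in> S \<Longrightarrow>
      \<exists>M. M summable_on I \<and> (\<forall>\<^sub>F w in nhds z. \<forall>i\<in>I. norm (f i w) \<le> M i)"
  shows "(\<lambda>z. \<Sum>\<^sub>\<infinity>i\<in>I. f i z) holomorphic_on S"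
proof -
  let ?g = "\<lambda>z. \<Sum>\<^sub>\<infinity>i\<in>I. f i z"
  have "?g analytic_on {z}" if z: "z \<in> S" for z
  proof -
    obtain M where M: "M summable_on I" "\<forall>\<^sub>F w in nhds z. \<forall>i\<in>I. norm (f i w) \<le> M i"
      using bound[OF z] by blast
    have "\<forall>\<^sub>F w in nhds z. w \<in> S \<and> (\<forall>i\<in>I. norm (f i w) \<le> M i)"
      using eventually_nhds_in_open[OF \<open>open S\<close> z] M(2) by eventually_elim auto
    then obtain e where e: "e > 0" "\<And>w. dist w z \<le> e \<Longrightarrow> w \<in> S \<and> (\<forall>i\<in>I. norm (f i w) \<le> M i)"
      by (auto simp: eventually_nhds_metric_le)
    have sub: "cball z e \<subseteq> S"
      using e(2) by (auto simp: dist_commute)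
    have "uniform_limit (cball z e) (\<lambda>X w. \<Sum>i\<in>X. f i w) ?g (finite_subsets_at_top I)"
      using e(2) M(1) by (intro Weierstrass_m_test_general) (auto simp: dist_commute)
    moreover have "\<forall>\<^sub>F X in finite_subsets_at_top I.
        continuous_on (cball z e) (\<lambda>w. \<Sum>i\<in>X. f i w) \<and> (\<lambda>w. \<Sum>i\<in>X. f i w) holomorphic_on ball z e"
    proof (rule eventually_finite_subsets_at_top_weakI)
      fix X assume "finite X" "X \<subseteq> I"
      hence "(\<lambda>w. \<Sum>i\<in>X. f i w) holomorphic_on S"
        by (intro holomorphic_on_sum hol) auto
      thus "continuous_on (cball z e) (\<lambda>w. \<Sum>i\<in>X. f i w) \<and> (\<lambda>w. \<Sum>i\<in>X. f i w) holomorphic_on ball z e"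
        using sub ball_subset_cball[of z e]
        by (meson holomorphic_on_imp_continuous_on holomorphic_on_subset order_trans)
    qed
    ultimately have "?g holomorphic_on ball z e"
      using holomorphic_uniform_limit[of z e _ "finite_subsets_at_top I" ?g] by auto
    thus ?thesis
      using e(1) by (auto simp: analytic_at intro!: exI[of _ "ball z e"])
  qed
  hence "?g analytic_on S"
    using analytic_on_analytic_at by blast
  thus ?thesis
    by (rule analytic_imp_holomorphic)
qed

lemma holomorphic_suminf:
  fixes f :: "nat \<Rightarrow> complex \<Rightarrow> complex"
  assumes "open S" and hol: "\<And>i. f i holomorphic_on S"
    and bound: "\<And>z. z \<in> S \<Longrightarrow>
      \<exists>M. summable M \<and> (\<forall>\<^sub>F w in nhds z. \<forall>i. norm (f i w) \<le> M i)"
  shows "(\<lambda>z. \<Sum>i. f i z) holomorphic_on S"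
proof -
  have M: "\<exists>M. M summable_on UNIV \<and> (\<forall>\<^sub>F w in nhds z. \<forall>i\<in>UNIV. norm (f i w) \<le> M i)"
    if z: "z \<in> S" for z
  proof -
    obtain M where M: "summable M" "\<forall>\<^sub>F w in nhds z. \<forall>i. norm (f i w) \<le> M i"
      using bound[OF z] by blast
    from eventually_nhds_x_imp_x[OF M(2)] have "M i \<ge> 0" for i
      using norm_ge_zero order_trans by blast
    with M show ?thesis
      by (intro exI[of _ M]) (auto simp: summable_on_UNIV_nonneg_real_iff)
  qed
  hence "(\<lambda>z. \<Sum>\<^sub>\<infinity>i. f i z) holomorphic_on S"
    by (intro holomorphic_infsum assms) auto
  also have "?this \<longleftrightarrow> ?thesis"
  proof (intro holomorphic_cong refl)
    fix z assume z: "z \<in> S"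
    obtain M where M: "summable M" "\<forall>\<^sub>F w in nhds z. \<forall>i. norm (f i w) \<le> M i"
      using bound[OF z] by blast
    from eventually_nhds_x_imp_x[OF M(2)] have "summable (\<lambda>i. norm (f i z))"
      by (intro summable_comparison_test[OF _ M(1)]) auto
    thus "(\<Sum>\<^sub>\<infinity>i. f i z) = (\<Sum>i. f i z)"
      by (intro infsumI norm_summable_imp_has_sum) (auto intro: summable_sums summable_norm_cancel)
  qed
  finally show ?thesis .
qed

subsection \<open>Finite differences of powers\<close>

lemma has_bochner_integral_Gamma:
  fixes s :: complex and a :: real
  assumes s: "Re s > 0" and a: "a > 0"
  shows "has_bochner_integral lborel
           (\<lambda>t. indicator {0<..} t *\<^sub>R (of_real t powr (s - 1) * of_real (exp (-(a * t)))))
           (Gamma s * of_real a powr (-s))"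
proof -
  let ?f = "\<lambda>t::real. indicator {0<..} t *\<^sub>R (complex_of_real t powr (s - 1) * of_real (exp (- t)))"
  have meas: "?f \<in> borel_measurable lborel"
    unfolding measurable_lborel2
    by (intro borel_measurable_continuous_on_indicator) (auto intro!: continuous_intros)
  have eq: "?f = (\<lambda>t. indicator {0<..} t *\<^sub>R (complex_of_real t powr (s - 1) / of_real (exp t)))"
    by (auto simp: fun_eq_iff exp_minus field_simps)
  have ai: "(\<lambda>t. complex_of_real t powr (s - 1) / of_real (exp t)) absolutely_integrable_on {0<..}"
    using absolutely_integrable_Gamma_integral'[OF s] .
  have int: "integrable lebesgue ?f"
    using ai unfolding eq set_integrable_def by simp
  have "set_lebesgue_integral lebesgue {0<..} (\<lambda>t. complex_of_real t powr (s - 1) / of_real (exp t)) = Gamma s"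
    using set_lebesgue_integral_eq_integral(2)[OF ai] Gamma_integral_complex'[OF s]
    by (simp add: has_integral_iff)
  hence "integral\<^sup>L lebesgue ?f = Gamma s"
    unfolding eq set_lebesgue_integral_def .
  with int meas have "has_bochner_integral lborel ?f (Gamma s)"
    by (simp add: has_bochner_integral_iff integrable_completion integral_completion)
  hence "has_bochner_integral lborel (\<lambda>t. ?f (0 + a * t)) (Gamma s /\<^sub>R \<bar>a\<bar>)"
    using a by (subst (asm) lborel_has_bochner_integral_real_affine_iff[of a _ _ 0]) auto
  \<comment> \<open>Substituting \<open>a * t\<close> produces \<open>a powr (s - 1)\<close>; this
    factor removes it and, with the Jacobian \<open>1 / a\<close>, leaves \<open>a powr (-s)\<close>
    in the value.\<close>
  hence "has_bochner_integral lborel (\<lambda>t. of_real a powr (1 - s) * ?f (0 + a * t)) (of_real a powr (1 - s) * (Gamma s /\<^sub>R \<bar>a\<bar>))"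
    by (rule has_bochner_integral_mult_right)
  also have "(\<lambda>t. of_real a powr (1 - s) * ?f (0 + a * t)) =
     (\<lambda>t. indicator {0<..} t *\<^sub>R (of_real t powr (s - 1) * of_real (exp (-(a * t)))))"
  proof
    fix t :: real
    show "of_real a powr (1 - s) * ?f (0 + a * t) = 
        indicator {0<..} t *\<^sub>R (of_real t powr (s - 1) * of_real (exp (-(a * t))))"
    proof (cases "t > 0")
      case True
      have "of_real (a * t) powr (s - 1) = complex_of_real a powr (s - 1) * of_real t powr (s - 1)"
        using True a by (simp add: powr_times_real)
      moreover have "complex_of_real a powr (1 - s) * of_real a powr (s - 1) = 1"
        using a by (simp flip: powr_add)
      ultimately show ?thesis
        using True a by (simp add: mult.assoc[symmetric])
    next
      case False
      thus ?thesis
        using a by (auto simp: indicator_def zero_less_mult_iff)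
    qed
  qed
  also have "of_real a powr (1 - s) * (Gamma s /\<^sub>R \<bar>a\<bar>) = Gamma s * of_real a powr (-s)"
    using a by (simp add: powr_diff powr_minus field_simps scaleR_conv_of_real)
  finally show ?thesis .
qed

text \<open>Up to the sign \<open>(-1) ^ k\<close> this is the k-th forward difference of
  \<open>x powr (-s)\<close> at x = 1. These are the coefficients of Euler's transformation; as
  finite sums they are entire in \<open>s\<close>.\<close>

definition power_diff :: "nat \<Rightarrow> complex \<Rightarrow> complex" where
  "power_diff k s = (\<Sum>j\<le>k. (-1) ^ j * of_nat (k choose j) * of_nat (Suc j) powr (-s))"

lemma holomorphic_power_diff [holomorphic_intros]:
  "f holomorphic_on A \<Longrightarrow> (\<lambda>z. power_diff k (f z)) holomorphic_on A"
  unfolding power_diff_def by (intro holomorphic_intros) auto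

text \<open>The absorption identity \<open>(j + 1) * (k choose j) = (k + 1) * (k choose j) - k * (k
  - 1 choose j)\<close> trades the extra factor \<open>Suc j\<close> for a neighbouring difference.
  It drives both the growth bound for arbitrary \<open>s\<close> and the differential equation of
  the Euler sum. At k = 0 the truncated index \<open>k - 1\<close> is harmless, its factor being
  0.\<close>

lemma power_diff_rec:
  "power_diff k (s - 1) = of_nat (Suc k) * power_diff k s - of_nat k * power_diff (k - 1) s"
proof (cases k)
  case 0
  thus ?thesis by (simp add: power_diff_def)
next
  case (Suc l)
  have binom: "Suc j * (k choose j) + k * (l choose j) = Suc k * (k choose j)" for j
  proof (cases j)
    case (Suc i)
    have "k * (l choose i) = j * (k choose j)"
      using Suc_times_binomial[of i l] \<open>k = Suc l\<close> Suc by simp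
    moreover have "k choose j = (l choose i) + (l choose j)"
      using \<open>k = Suc l\<close> Suc by simp
    ultimately show ?thesis
      by (simp add: algebra_simps)
  qed auto
  have binom': "of_nat (Suc j) * of_nat (k choose j) = of_nat (Suc k) * of_nat (k choose j) - of_nat k * (of_nat (l choose j) :: complex)" for j
    using arg_cong[OF binom[of j], of "of_nat :: nat \<Rightarrow> complex"]
    by (simp only: of_nat_add of_nat_mult) (simp add: algebra_simps)
  have "power_diff k (s - 1) = (\<Sum>j\<le>k. (-1) ^ j * (of_nat (Suc j) * of_nat (k choose j)) * of_nat (Suc j) powr (-s))"
    unfolding power_diff_def
  proof (intro sum.cong refl)
    fix j
    have "of_nat (Suc j) powr (-(s - 1)) = of_nat (Suc j) * (of_nat (Suc j) powr (-s) :: complex)"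
      using powr_add[of "of_nat (Suc j) :: complex" 1 "-s"] by (simp del: of_nat_Suc)
    thus "(-1) ^ j * of_nat (k choose j) * of_nat (Suc j) powr (-(s - 1)) =
        (-1) ^ j * (of_nat (Suc j) * of_nat (k choose j)) * (of_nat (Suc j) powr (-s) :: complex)"
      by (simp del: of_nat_Suc)
  qed
  also have "\<dots> = of_nat (Suc k) * power_diff k s - of_nat k * (\<Sum>j\<le>k. (-1) ^ j * of_nat (l choose j) * of_nat (Suc j) powr (-s))"
    unfolding power_diff_def binom' sum_distrib_left
    by (simp add: algebra_simps sum_subtractf del: of_nat_Suc)
  also have "(\<Sum>j\<le>k. (-1) ^ j * of_nat (l choose j) * of_nat (Suc j) powr (-s)) = power_diff l s"
    unfolding power_diff_def \<open>k = Suc l\<close> by simp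
  finally show ?thesis
    using Suc by simp
qed

lemma has_bochner_integral_power_diff:
  assumes s: "Re s > 0"
  shows "has_bochner_integral lborel
           (\<lambda>t. indicator {0<..} t *\<^sub>R (of_real t powr (s - 1) * of_real (exp (-t) * (1 - exp (-t)) ^ k)))
           (Gamma s * power_diff k s)"
proof -
  have "has_bochner_integral lborel
      (\<lambda>t. \<Sum>j\<le>k. (-1) ^ j * of_nat (k choose j) *
         indicator {0<..} t *\<^sub>R (of_real t powr (s - 1) * of_real (exp (-(real (Suc j) * t)))))
      (\<Sum>j\<le>k. (-1) ^ j * of_nat (k choose j) * (Gamma s * of_real (real (Suc j)) powr (-s)))"
    by (intro has_bochner_integral_sum has_bochner_integral_mult_right has_bochner_integral_Gamma s) auto
  also have "(\<Sum>j\<le>k. (-1) ^ j * of_nat (k choose j) * (Gamma s * of_real (real (Suc j)) powr (-s))) =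
      Gamma s * power_diff k s"
    by (simp add: power_diff_def sum_distrib_left mult_ac)
  also have "(\<lambda>t. \<Sum>j\<le>k. (-1) ^ j * of_nat (k choose j) *
         indicator {0<..} t *\<^sub>R (complex_of_real t powr (s - 1) * of_real (exp (-(real (Suc j) * t))))) =
      (\<lambda>t. indicator {0<..} t *\<^sub>R (of_real t powr (s - 1) * of_real (exp (-t) * (1 - exp (-t)) ^ k)))"
  proof
    fix t :: real
    have "(1 - exp (-t)) ^ k = (\<Sum>j\<le>k. of_nat (k choose j) * (- exp (-t)) ^ j)"
      using binomial_ring[of "- exp (-t)" 1 k] by simp
    moreover have "exp (-t) * (of_nat (k choose j) * (- exp (-t)) ^ j) =
        (-1) ^ j * of_nat (k choose j) * exp (-(real (Suc j) * t))" for j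
    proof -
      have "exp (-(real (Suc j) * t)) = exp (-t) * exp (-t) ^ j"
        by (simp add: algebra_simps flip: exp_of_nat_mult exp_add)
      thus ?thesis
        by (simp add: power_minus[of "exp (-t)"])
    qed
    ultimately have "exp (-t) * (1 - exp (-t)) ^ k = (\<Sum>j\<le>k. (-1) ^ j * of_nat (k choose j) * exp (-(real (Suc j) * t)))"
      by (simp only: sum_distrib_left)
    thus "(\<Sum>j\<le>k. (-1) ^ j * of_nat (k choose j) *
         indicator {0<..} t *\<^sub>R (complex_of_real t powr (s - 1) * of_real (exp (-(real (Suc j) * t))))) =
      indicator {0<..} t *\<^sub>R (of_real t powr (s - 1) * of_real (exp (-t) * (1 - exp (-t)) ^ k))"
      by (simp add: sum_distrib_left scaleR_conv_of_real mult_ac)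
  qed
  finally show ?thesis .
qed

lemma powr_of_real_minus_one:
  "t \<ge> 0 \<Longrightarrow> complex_of_real t powr (of_real x - 1) = of_real (t powr (x - 1))"
  by (metis powr_of_real of_real_1 of_real_diff)

text \<open>In the integral representation the factor \<open>(1 - exp (-t)) ^ k\<close> lies between
  0 and 1, so \<open>k\<close> drops out of the estimate.\<close>

lemma norm_power_diff_le:
  assumes s: "Re s > 0"
  shows "norm (power_diff k s) \<le> Gamma (Re s) / norm (Gamma s)"
proof -
  let ?f = "\<lambda>t. indicator {0<..} t *\<^sub>R (complex_of_real t powr (s - 1) * of_real (exp (-t) * (1 - exp (-t)) ^ k))"
  let ?g = "\<lambda>t. indicator {0<..} t *\<^sub>R (complex_of_real t powr (of_real (Re s) - 1) * of_real (exp (-(1*t))))"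
  have g: "has_bochner_integral lborel ?g (Gamma (of_real (Re s)) * of_real 1 powr (- of_real (Re s)))"
    by (rule has_bochner_integral_Gamma) (use s in auto)
  have "norm (Gamma s * power_diff k s) = norm (integral\<^sup>L lborel ?f)"
    using has_bochner_integral_power_diff[OF s, of k] by (simp add: has_bochner_integral_iff)
  also have "\<dots> \<le> (\<integral>t. norm (?f t) \<partial>lborel)"
    by (rule integral_norm_bound)
  also have "\<dots> \<le> (\<integral>t. norm (?g t) \<partial>lborel)"
  proof (rule integral_mono)
    show "integrable lborel (\<lambda>t. norm (?f t))"
      using has_bochner_integral_power_diff[OF s, of k] by (intro integrable_norm) (auto simp: has_bochner_integral_iff)
    show "integrable lborel (\<lambda>t. norm (?g t))"
      using g by (intro integrable_norm) (auto simp: has_bochner_integral_iff)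
    fix t :: real
    show "norm (?f t) \<le> norm (?g t)"
    proof (cases "t > 0")
      case True
      have "(1 - exp (-t)) ^ k \<le> 1"
        using True by (intro power_le_one) auto
      hence "\<bar>exp (-t) * (1 - exp (-t)) ^ k\<bar> \<le> exp (-t)"
        using True by (simp add: abs_mult mult_left_le)
      thus ?thesis
        using True by (simp only: norm_mult norm_scaleR norm_of_real) 
          (simp add: norm_powr_real_powr mult_left_mono)
    qed auto
  qed
  also have "(\<lambda>t. norm (?g t)) = (\<lambda>t. Re (?g t))"
  proof
    fix t :: real
    have "?g t = of_real (indicator {0<..} t * (t powr (Re s - 1) * exp (-t)))"
      by (simp add: indicator_def powr_of_real_minus_one)
    thus "norm (?g t) = Re (?g t)"
      by (simp only: norm_of_real Re_complex_of_real) auto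
  qed
  also have "(\<integral>t. Re (?g t) \<partial>lborel) = Re (integral\<^sup>L lborel ?g)"
    using g by (intro integral_Re) (auto simp: has_bochner_integral_iff)
  also have "\<dots> = Gamma (Re s)"
    using g by (simp add: has_bochner_integral_iff Gamma_complex_of_real)
  finally show ?thesis
    using s Gamma_eq_zero_iff[of s] by (auto simp: norm_mult field_simps elim!: nonpos_Ints_cases)
qed

text \<open>The integrand is nonnegative for real exponents. This positivity later excludes a zero
  of \<open>eta\<close> at 1/2.\<close>

lemma power_diff_nonneg:
  fixes x :: real
  assumes x: "x > 0"
  shows "power_diff k (of_real x) \<in> \<real>" "Re (power_diff k (of_real x)) \<ge> 0"
proof -
  have "power_diff k (of_real x) = of_real (\<Sum>j\<le>k. (-1) ^ j * of_nat (k choose j) * of_nat (Suc j) powr (-x))"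
    unfolding power_diff_def of_real_sum
    by (intro sum.cong refl) (simp flip: powr_of_real)
  thus real: "power_diff k (of_real x) \<in> \<real>"
    by (metis Reals_of_real)
  let ?f = "\<lambda>t. indicator {0<..} t *\<^sub>R (complex_of_real t powr (of_real x - 1) * of_real (exp (-t) * (1 - exp (-t)) ^ k))"
  have "has_bochner_integral lborel ?f (Gamma (of_real x) * power_diff k (of_real x))"
    by (rule has_bochner_integral_power_diff) (use x in auto)
  hence "Re (Gamma (of_real x) * power_diff k (of_real x)) = (\<integral>t. Re (?f t) \<partial>lborel)"
    using integral_Re[of lborel ?f] unfolding has_bochner_integral_iff by metis
  also have "\<dots> \<ge> 0"
  proof (rule integral_nonneg_AE, intro AE_I2)
    fix t :: real
    have "?f t = of_real (indicator {0<..} t * (t powr (x - 1) * (exp (-t) * (1 - exp (-t)) ^ k)))"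
      by (simp add: indicator_def powr_of_real_minus_one)
    moreover have "indicator {0<..} t * (t powr (x - 1) * (exp (-t) * (1 - exp (-t)) ^ k)) \<ge> 0"
      by (auto simp: indicator_def)
    ultimately show "Re (?f t) \<ge> 0"
      by (simp only: Re_complex_of_real)
  qed
  finally show "Re (power_diff k (of_real x)) \<ge> 0"
    using Gamma_real_pos[OF x] by (auto simp: Gamma_complex_of_real zero_le_mult_iff)
qed

text \<open>For \<open>Re s > 0\<close> the integral bounds the differences independently of
  \<open>k\<close>, and each step to the left by \<open>power_diff_rec\<close> costs one factor
  \<open>Suc k\<close>. Hence the induction on a \<open>P\<close> with \<open>Re s + P > 0\<close>;
  the constant doubles because the recurrence has two terms.\<close>

lemma power_diff_bound:
  "\<exists>C P. \<forall>\<^sub>F w in nhds s. \<forall>k. norm (power_diff k w) \<le> C * real (Suc k) ^ P"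
proof -
  have "\<exists>C. \<forall>\<^sub>F w in nhds s. \<forall>k. norm (power_diff k w) \<le> C * real (Suc k) ^ P"
    if "Re s + real P > 0" for P s
    using that
  proof (induction P arbitrary: s)
    case 0
    define C where "C = Gamma (Re s) / norm (Gamma s) + 1"
    have "(\<lambda>w. Gamma (Re w) / norm (Gamma w)) \<midarrow>s\<rightarrow> Gamma (Re s) / norm (Gamma s)"
      using 0 Gamma_eq_zero_iff[of s] by (intro tendsto_intros) (auto elim!: nonpos_Ints_cases)
    hence "((\<lambda>w. Gamma (Re w) / norm (Gamma w)) \<longlongrightarrow> Gamma (Re s) / norm (Gamma s)) (nhds s)"
      using tendsto_at_iff_tendsto_nhds[of "\<lambda>w. Gamma (Re w) / norm (Gamma w)" s] by blast
    hence "\<forall>\<^sub>F w in nhds s. Gamma (Re w) / norm (Gamma w) < C"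
      by (rule order_tendstoD) (simp add: C_def)
    moreover have "\<forall>\<^sub>F w in nhds s. w \<in> {w. Re w > 0}"
      using 0 by (intro eventually_nhds_in_open open_halfspace_Re_gt) auto
    ultimately have "\<forall>\<^sub>F w in nhds s. \<forall>k. norm (power_diff k w) \<le> C * real (Suc k) ^ 0"
      by eventually_elim (auto intro: order_trans[OF norm_power_diff_le])
    thus ?case by blast
  next
    case (Suc P)
    have "Re (s + 1) + real P > 0" using Suc.prems by simp
    from Suc.IH[OF this] obtain C where
      C: "\<forall>\<^sub>F w in nhds (s + 1). \<forall>k. norm (power_diff k w) \<le> C * real (Suc k) ^ P" by blast
    have "filterlim (\<lambda>w. w + 1) (nhds (s + 1)) (nhds s)"
      by (intro tendsto_intros filterlim_ident)
    with C have "\<forall>\<^sub>F w in nhds s. \<forall>k. norm (power_diff k (w + 1)) \<le> C * real (Suc k) ^ P"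
      by (rule eventually_compose_filterlim)
    hence "\<forall>\<^sub>F w in nhds s. \<forall>k. norm (power_diff k w) \<le> (2 * C) * real (Suc k) ^ Suc P"
    proof eventually_elim
      case (elim w)
      have "C \<ge> 0"
        using elim[rule_format, of 0] norm_ge_zero[of "power_diff 0 (w + 1)"] by (simp add: power_diff_def)
      show ?case
      proof
        fix k
        have "norm (power_diff k w) = norm (of_nat (Suc k) * power_diff k (w + 1) - of_nat k * power_diff (k - 1) (w + 1))"
          using power_diff_rec[of k "w + 1"] by simp
        also have "\<dots> \<le> norm (of_nat (Suc k) * power_diff k (w + 1)) + norm (of_nat k * power_diff (k - 1) (w + 1))"
          by (rule norm_triangle_ineq4)
        also have "\<dots> = real (Suc k) * norm (power_diff k (w + 1)) + real k * norm (power_diff (k - 1) (w + 1))"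
          by (simp add: norm_mult del: of_nat_Suc)
        also have "\<dots> \<le> real (Suc k) * (C * real (Suc k) ^ P) + real (Suc k) * (C * real (Suc k) ^ P)"
        proof (intro add_mono mult_mono)
          show "norm (power_diff (k - 1) (w + 1)) \<le> C * real (Suc k) ^ P"
            by (rule order_trans[OF elim[rule_format]]) (intro mult_left_mono power_mono \<open>C \<ge> 0\<close>, auto)
        qed (use elim \<open>C \<ge> 0\<close> in \<open>auto\<close>)
        finally show "norm (power_diff k w) \<le> (2 * C) * real (Suc k) ^ Suc P"
          by (simp add: algebra_simps del: of_nat_Suc)
      qed
    qed
    thus ?case by blast
  qed
  moreover obtain P :: nat where "Re s + real P > 0"
    using reals_Archimedean2[of "- Re s"] by (metis neg_less_iff_less add.commute minus_less_iff real_0_less_add_iff)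
  ultimately show ?thesis by blast
qed

subsection \<open>Polylogarithms and Euler's transformation\<close>

lemma summable_Suc_power_mult_power:
  fixes x :: real
  assumes "\<bar>x\<bar> < 1"
  shows "summable (\<lambda>n. real (Suc n) ^ P * x ^ n)"
proof -
  have "summable (\<lambda>n. real (Suc n) ^ P * x ^ n)" if "\<bar>x\<bar> < 1" "x \<ge> 0" for x
    using that
  proof (induction P arbitrary: x)
    case (Suc P)
    have "summable (\<lambda>n. diffs (\<lambda>n. real (Suc n) ^ P) n * x ^ n)"
    proof (rule termdiff_converges[of _ 1])
      fix y :: real assume "norm y < 1"
      hence "summable (\<lambda>n. norm (real (Suc n) ^ P * y ^ n))"
        using Suc.IH[of "\<bar>y\<bar>"] by (simp add: abs_mult power_abs)
      thus "summable (\<lambda>n. real (Suc n) ^ P * y ^ n)"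
        by (rule summable_norm_cancel)
    qed (use Suc.prems in auto)
    \<comment> \<open>Termwise differentiation of the series for \<open>P\<close> yields the
      coefficients \<open>(n + 1) * (n + 2) ^ P\<close>, which dominate those for
      \<open>Suc P\<close>.\<close>
    moreover have "norm (real (Suc n) ^ Suc P * x ^ n) \<le> diffs (\<lambda>n. real (Suc n) ^ P) n * x ^ n" for n
    proof -
      have "real (Suc n) ^ P \<le> real (Suc (Suc n)) ^ P"
        by (intro power_mono) auto
      thus ?thesis
        using Suc.prems by (auto simp: diffs_def abs_mult intro!: mult_right_mono mult_left_mono)
    qed
    ultimately show ?case
      by (rule summable_comparison_test'[where N = 0])
  qed (auto intro: summable_geometric)
  from this[of "\<bar>x\<bar>"] assms have "summable (\<lambda>n. norm (real (Suc n) ^ P * x ^ n))"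
    by (simp add: abs_mult power_abs)
  thus ?thesis
    by (rule summable_norm_cancel)
qed

lemma norm_nat_powr_le:
  assumes "- Re s \<le> real P"
  shows "norm (of_nat n powr (-s) :: complex) \<le> real n ^ P"
proof (cases "n = 0")
  case False
  hence "norm (of_nat n powr (-s) :: complex) = real n powr (- Re s)"
    using norm_powr_real_powr[of "of_nat n" "-s"] by simp
  also have "\<dots> \<le> real n powr (real P)"
    using False assms by (intro powr_mono) auto
  finally show ?thesis
    using False by (simp add: powr_realpow)
qed auto

text \<open>Euler's transformation: for \<open>w = - z / (1 - z)\<close> this is
  \<open>- polylog s z\<close>. Polynomial growth of the coefficients gives convergence on the unit
  disc for every complex \<open>s\<close>, and the critical point \<open>z = -1\<close> is moved to
  1/2, well inside.\<close>

definition euler_sum :: "complex \<Rightarrow> complex \<Rightarrow> complex" where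
  "euler_sum s w = (\<Sum>k. power_diff k s * w ^ Suc k)"

text \<open>One majorant serves all exponents near \<open>s\<close> and all \<open>w\<close> in the
  closed disc simultaneously; the Cauchy estimate for \<open>eta\<close> takes a maximum over
  \<open>w\<close> while the exponent still varies.\<close>

lemma euler_sum_bound:
  assumes "q < 1"
  shows "\<exists>M. summable M \<and> (\<forall>\<^sub>F s' in nhds s. \<forall>k w. norm w \<le> q \<longrightarrow> norm (power_diff k s' * w ^ Suc k) \<le> M k)"
proof -
  obtain C P where C: "\<forall>\<^sub>F w in nhds s. \<forall>k. norm (power_diff k w) \<le> C * real (Suc k) ^ P"
    using power_diff_bound by blast
  have "C \<ge> 0"
    using eventually_nhds_x_imp_x[OF C, rule_format, of 0] norm_ge_zero[of "power_diff 0 s"]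
    by (simp add: power_diff_def)
  let ?M = "\<lambda>k. C * (real (Suc k) ^ P * \<bar>q\<bar> ^ k)"
  show ?thesis
  proof (cases "q \<ge> 0")
    case True
    have "summable ?M"
      by (intro summable_mult summable_Suc_power_mult_power) (use assms True in auto)
    moreover from C have "\<forall>\<^sub>F s' in nhds s. \<forall>k w. norm w \<le> q \<longrightarrow> norm (power_diff k s' * w ^ Suc k) \<le> ?M k"
    proof eventually_elim
      case (elim s')
      show ?case
      proof (intro allI impI)
        fix k and w :: complex assume w: "norm w \<le> q"
        have "norm w ^ Suc k \<le> q ^ Suc k"
          using w by (intro power_mono) auto
        also have "\<dots> \<le> q ^ k"
          using assms True by (intro power_decreasing) auto
        finally have "norm (power_diff k s') * norm w ^ Suc k \<le> (C * real (Suc k) ^ P) * q ^ k"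
          using elim \<open>C \<ge> 0\<close> by (intro mult_mono) auto
        thus "norm (power_diff k s' * w ^ Suc k) \<le> ?M k"
          using True by (simp add: norm_mult norm_power mult.assoc)
      qed
    qed
    ultimately show ?thesis by blast
  next
    case False
    hence "\<not> norm w \<le> q" for w :: complex
      using norm_ge_zero[of w] by linarith
    thus ?thesis
      by (intro exI[of _ "\<lambda>_. 0"]) auto
  qed
qed

lemma summable_norm_euler_sum:
  assumes "norm w < 1"
  shows "summable (\<lambda>k. norm (power_diff k s * w ^ Suc k))"
proof -
  obtain M where M: "summable M" "\<forall>\<^sub>F s' in nhds s. \<forall>k v. norm v \<le> norm w \<longrightarrow> norm (power_diff k s' * v ^ Suc k) \<le> M k"
    using euler_sum_bound[OF assms] by blast
  from eventually_nhds_x_imp_x[OF M(2)] show ?thesis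
    by (intro summable_comparison_test[OF _ M(1)]) auto
qed

lemma euler_sum_locally_bounded:
  assumes "q < 1"
  shows "\<exists>C. \<forall>\<^sub>F s' in nhds s. \<forall>w. norm w \<le> q \<longrightarrow> norm (euler_sum s' w) \<le> C"
proof -
  obtain M where M: "summable M" "\<forall>\<^sub>F s' in nhds s. \<forall>k v. norm v \<le> q \<longrightarrow> norm (power_diff k s' * v ^ Suc k) \<le> M k"
    using euler_sum_bound[OF assms] by blast
  from M(2) have "\<forall>\<^sub>F s' in nhds s. \<forall>w. norm w \<le> q \<longrightarrow> norm (euler_sum s' w) \<le> suminf M"
  proof eventually_elim
    case (elim s')
    show ?case
    proof (intro allI impI)
      fix w :: complex assume w: "norm w \<le> q"
      have "summable (\<lambda>k. norm (power_diff k s' * w ^ Suc k))"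
        using w assms by (intro summable_norm_euler_sum) auto
      thus "norm (euler_sum s' w) \<le> suminf M"
        unfolding euler_sum_def using elim w M(1)
        by (intro order_trans[OF summable_norm] suminf_le) auto
    qed
  qed
  thus ?thesis by blast
qed

lemma holomorphic_euler_sum_left:
  assumes "norm w < 1"
  shows "(\<lambda>s. euler_sum s w) holomorphic_on A"
proof -
  have "(\<lambda>s. euler_sum s w) holomorphic_on UNIV"
    unfolding euler_sum_def
  proof (rule holomorphic_suminf)
    fix s
    obtain M where M: "summable M" "\<forall>\<^sub>F s' in nhds s. \<forall>k v. norm v \<le> norm w \<longrightarrow> norm (power_diff k s' * v ^ Suc k) \<le> M k"
      using euler_sum_bound[OF assms] by blast
    thus "\<exists>M. summable M \<and> (\<forall>\<^sub>F s' in nhds s. \<forall>k. norm (power_diff k s' * w ^ Suc k) \<le> M k)"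
      by (intro exI[of _ M] conjI) (auto elim: eventually_mono)
  qed (auto intro!: holomorphic_intros)
  thus ?thesis
    by (rule holomorphic_on_subset) auto
qed

text \<open>The factor \<open>w\<^sup>2 - w\<close> is the derivative of
  \<open>w = 1 / (exp t + 1)\<close>, so in the variable t differentiation lowers the exponent by
  one. The product form avoids a division at w = 0.\<close>

lemma has_field_derivative_euler_sum:
  assumes w: "norm w < 1"
  shows "\<exists>D. (euler_sum s has_field_derivative D) (at w) \<and> (w\<^sup>2 - w) * D = - euler_sum (s - 1) w"
proof -
  \<comment> \<open>Shifting by one with \<open>c 0 = 0\<close> makes this an ordinary power series,
    as termwise differentiation expects.\<close>
  define c where "c = (\<lambda>n. if n = 0 then 0 else power_diff (n - 1) s)"
  have sums: "(\<lambda>n. c n * x ^ n) sums euler_sum s x" if "norm x < 1" for x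
  proof -
    have "(\<lambda>n. c (Suc n) * x ^ Suc n) sums euler_sum s x"
      using summable_norm_cancel[OF summable_norm_euler_sum[OF that, of s]] unfolding euler_sum_def c_def
      by (simp add: summable_sums)
    thus ?thesis
      by (subst (asm) sums_Suc_iff) (simp add: c_def)
  qed
  obtain K where K: "norm w < K" "K < 1"
    using w dense by blast
  have "K > 0"
    using K(1) norm_ge_zero[of w] by linarith
  have "((\<lambda>x. \<Sum>n. c n * x ^ n) has_field_derivative (\<Sum>n. diffs c n * w ^ n)) (at w)"
    by (rule termdiffs_strong[of _ "of_real K"]) (use sums[of "of_real K"] K \<open>K > 0\<close> in \<open>auto simp: sums_iff\<close>)
  hence "(euler_sum s has_field_derivative (\<Sum>n. diffs c n * w ^ n)) (at w)"
  proof (rule DERIV_cong_ev[THEN iffD1, rotated -1])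
    have "\<forall>\<^sub>F x in nhds w. x \<in> ball 0 1"
      using w by (intro eventually_nhds_in_open) auto
    thus "\<forall>\<^sub>F x in nhds w. (\<Sum>n. c n * x ^ n) = euler_sum s x"
      by eventually_elim (use sums in \<open>auto simp: sums_iff\<close>)
  qed auto
  moreover have "(w\<^sup>2 - w) * (\<Sum>n. diffs c n * w ^ n) = - euler_sum (s - 1) w"
  proof -
    define S where "S = (\<Sum>n. diffs c n * w ^ n)"
    have dsum: "(\<lambda>n. diffs c n * w ^ n) sums S"
      unfolding S_def by (intro summable_sums termdiff_converges[of _ 1]) (use w sums in \<open>auto simp: sums_iff\<close>)
    have d: "diffs c n = of_nat (Suc n) * power_diff n s" for n
      by (simp add: diffs_def c_def)
    have 1: "(\<lambda>n. of_nat (Suc n) * power_diff n s * w ^ Suc n) sums (w * S)"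
      using sums_mult[OF dsum, of w] by (simp add: d mult_ac)
    have "(\<lambda>n. of_nat (Suc n) * power_diff (Suc n - 1) s * w ^ Suc (Suc n)) sums (w\<^sup>2 * S)"
      using sums_mult[OF dsum, of "w\<^sup>2"] by (simp add: d mult_ac power2_eq_square)
    hence 2: "(\<lambda>n. of_nat n * power_diff (n - 1) s * w ^ Suc n) sums (w\<^sup>2 * S)"
      by (subst (asm) sums_Suc_iff) simp
    have "(\<lambda>n. power_diff n (s - 1) * w ^ Suc n) sums (w * S - w\<^sup>2 * S)"
      using sums_diff[OF 1 2] unfolding power_diff_rec[of _ s] by (simp only: left_diff_distrib)
    hence "euler_sum (s - 1) w = w * S - w\<^sup>2 * S"
      by (simp add: euler_sum_def sums_iff)
    thus ?thesis
      unfolding S_def[symmetric] by (simp add: algebra_simps)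
  qed
  ultimately show ?thesis by blast
qed

lemma holomorphic_euler_sum_right: "euler_sum s holomorphic_on ball 0 1"
  unfolding holomorphic_on_open[OF open_ball] using has_field_derivative_euler_sum by fastforce

text \<open>Since \<open>0 powr (-s) = 0\<close>, also for \<open>s = 0\<close>, the summation
  effectively starts at n = 1.\<close>

definition polylog :: "complex \<Rightarrow> complex \<Rightarrow> complex" where
  "polylog s z = (\<Sum>n. of_nat n powr (-s) * z ^ n)"

lemma summable_norm_polylog:
  assumes "norm z < 1"
  shows "summable (\<lambda>n. norm (of_nat n powr (-s) * z ^ n :: complex))"
proof -
  obtain P where P: "- Re s \<le> real P"
    using real_arch_simple by blast
  have "summable (\<lambda>n. real (Suc n) ^ P * norm z ^ n)"
    using assms by (intro summable_Suc_power_mult_power) auto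
  moreover have "norm (norm (of_nat n powr (-s) * z ^ n :: complex)) \<le> real (Suc n) ^ P * norm z ^ n" for n
  proof -
    have "norm (of_nat n powr (-s) :: complex) \<le> real n ^ P"
      by (rule norm_nat_powr_le[OF P])
    also have "\<dots> \<le> real (Suc n) ^ P"
      by (intro power_mono) auto
    finally show ?thesis
      by (auto simp: norm_mult norm_power intro!: mult_right_mono)
  qed
  ultimately show ?thesis
    by (rule summable_comparison_test'[where N = 0])
qed

lemma sums_polylog:
  assumes "norm z < 1"
  shows "(\<lambda>n. of_nat n powr (-s) * z ^ n) sums polylog s z"
  unfolding polylog_def using summable_norm_cancel[OF summable_norm_polylog[OF assms]] by (rule summable_sums)

lemma holomorphic_polylog: "polylog s holomorphic_on ball 0 1"
proof -
  have "(\<lambda>n. of_nat n powr (-s) * (z - 0) ^ n) sums polylog s z" if "z \<in> ball 0 1" for z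
    using sums_polylog[of z s] that by simp
  thus ?thesis
    by (rule power_series_holomorphic)
qed

lemma power_minus_not_even:
  "n \<notin> range ((*) 2) \<Longrightarrow> (- z :: 'a :: comm_ring_1) ^ n = - (z ^ n)" for n :: nat
  by (metis dvdE power_minus_odd rangeI)

lemma polylog_duplication:
  assumes z: "norm z < 1"
  shows "polylog s z + polylog s (-z) = 2 powr (1 - s) * polylog s (z\<^sup>2)"
proof -
  have "(\<lambda>n. of_nat n powr (-s) * z ^ n + of_nat n powr (-s) * (-z) ^ n) sums (polylog s z + polylog s (-z))"
    using z by (intro sums_add sums_polylog) auto
  hence "(\<lambda>n. of_nat (2 * n) powr (-s) * z ^ (2 * n) + of_nat (2 * n) powr (-s) * (-z) ^ (2 * n)) sums (polylog s z + polylog s (-z))"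
    by (subst sums_mono_reindex[of "\<lambda>n. 2 * n" "\<lambda>n. of_nat n powr (-s) * z ^ n + of_nat n powr (-s) * (-z) ^ n"])
       (auto simp: strict_mono_def power_minus_not_even)
  also have "(\<lambda>n. of_nat (2 * n) powr (-s) * z ^ (2 * n) + of_nat (2 * n) powr (-s) * (-z) ^ (2 * n)) =
     (\<lambda>n. 2 powr (1 - s) * (of_nat n powr (-s) * (z\<^sup>2) ^ n))"
  proof
    fix n
    have "of_nat (2 * n) powr (-s) = 2 powr (-s) * (of_nat n powr (-s) :: complex)"
      using powr_times_real[of 2 "of_nat n" "-s"] by simp
    moreover have "2 powr (1 - s) = 2 * (2 powr (-s) :: complex)"
      by (simp add: powr_diff powr_minus field_simps)
    ultimately show "of_nat (2 * n) powr (-s) * z ^ (2 * n) + of_nat (2 * n) powr (-s) * (-z) ^ (2 * n) =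
       2 powr (1 - s) * (of_nat n powr (-s) * (z\<^sup>2) ^ n)"
      by (simp only:) (simp add: power_mult)
  qed
  finally have "(\<lambda>n. 2 powr (1 - s) * (of_nat n powr (-s) * (z\<^sup>2) ^ n)) sums (polylog s z + polylog s (-z))" .
  moreover have "(\<lambda>n. 2 powr (1 - s) * (of_nat n powr (-s) * (z\<^sup>2) ^ n)) sums (2 powr (1 - s) * polylog s (z\<^sup>2))"
    using z by (intro sums_mult sums_polylog) (auto simp: norm_power power_less_one_iff)
  ultimately show ?thesis
    by (rule sums_unique2)
qed

text \<open>The binomial series for the exponent \<open>-(j + 1)\<close>, shifted by
  \<open>j\<close>; the terms with \<open>k < j\<close> vanish.\<close>

lemma binomial_column_sums:
  fixes w :: complex
  assumes w: "norm w < 1"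
  shows "(\<lambda>k. of_nat (k choose j) * w ^ k) sums (w ^ j / (1 - w) ^ Suc j)"
proof -
  have "(\<lambda>n. ((- of_nat (Suc j)) gchoose n) * (-w) ^ n) sums (1 + -w) powr (- of_nat (Suc j))"
    using w by (intro gen_binomial_complex) auto
  also have "(\<lambda>n. ((- of_nat (Suc j)) gchoose n) * (-w) ^ n) = (\<lambda>n. of_nat ((n + j) choose j) * w ^ n)"
  proof
    fix n
    have "(- of_nat (Suc j) gchoose n) = (-1) ^ n * (of_nat (n + j) gchoose n :: complex)"
      by (subst gbinomial_minus) (simp add: algebra_simps)
    also have "(of_nat (n + j) gchoose n :: complex) = of_nat ((n + j) choose j)"
      by (subst binomial_gbinomial[symmetric]) (simp add: binomial_symmetric[of n "n + j"])
    finally have g: "(- of_nat (Suc j) gchoose n) = (-1) ^ n * complex_of_nat ((n + j) choose j)" .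
    have "(-1) ^ n * (-w) ^ n = w ^ n"
      by (simp flip: power_mult_distrib)
    thus "((- of_nat (Suc j)) gchoose n) * (-w) ^ n = of_nat ((n + j) choose j) * w ^ n"
      unfolding g by (simp add: mult_ac)
  qed
  also have "1 + -w \<noteq> 0"
    using w by auto
  hence "(1 + -w) powr (- of_nat (Suc j)) = 1 / (1 - w) ^ Suc j"
    by (simp add: powr_minus powr_nat' field_simps del: of_nat_Suc)
  finally have "(\<lambda>n. w ^ j * (of_nat ((n + j) choose j) * w ^ n)) sums (w ^ j * (1 / (1 - w) ^ Suc j))"
    by (rule sums_mult)
  hence "(\<lambda>n. of_nat ((n + j) choose j) * w ^ (n + j)) sums (w ^ j / (1 - w) ^ Suc j)"
    by (simp add: power_add mult_ac)
  thus ?thesis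
    by (subst (asm) sums_iff_shift[of "\<lambda>k. of_nat (k choose j) * w ^ k"]) (simp add: binomial_eq_0)
qed

text \<open>Inserting the definition of \<open>power_diff\<close> gives a double series whose rows
  have absolute sums at most \<open>2 ^ k * norm w ^ (k + 1)\<close>, up to a polynomial factor. The
  restriction to \<open>norm z < 1 / 3\<close> forces \<open>norm w < 1 / 2\<close>, so the series
  converges absolutely and may be summed by columns, each a negative binomial series in
  \<open>w\<close>.\<close>

lemma polylog_eq_euler_sum_aux:
  assumes z: "norm z < 1 / 3"
  shows "polylog s z = - euler_sum s (- z / (1 - z))"
proof -
  define w where "w = - z / (1 - z)"
  have "1 - z \<noteq> 0"
    using z by auto
  hence w1: "w / (1 - w) = - z" "1 - w \<noteq> 0"
    by (auto simp: w_def field_simps)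
  have "norm (1 - z) > 2 / 3"
    using z norm_triangle_ineq2[of 1 z] by simp
  hence w: "norm w < 1 / 2"
    using z by (auto simp: w_def norm_divide divide_less_eq)
  define g where "g = (\<lambda>k j. w ^ Suc k * ((-1) ^ j * of_nat (k choose j) * of_nat (Suc j) powr (-s)))"
  have g0: "g k j = 0" if "j \<notin> {..k}" for k j
    using that by (auto simp: g_def binomial_eq_0)
  obtain P where P: "- Re s \<le> real P"
    using real_arch_simple by blast
  have norm_g: "norm (g k j) \<le> norm w ^ Suc k * (of_nat (k choose j) * real (Suc k) ^ P)" for k j
  proof (cases "j \<le> k")
    case True
    have "norm (of_nat (Suc j) powr (-s) :: complex) \<le> real (Suc j) ^ P"
      by (rule norm_nat_powr_le[OF P])
    also have "\<dots> \<le> real (Suc k) ^ P"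
      using True by (intro power_mono) auto
    finally show ?thesis
      unfolding g_def norm_mult norm_power by (auto intro!: mult_left_mono)
  qed (auto simp: g0)
  have inner: "((\<lambda>j. norm (g k j)) has_sum (\<Sum>j\<le>k. norm (g k j))) UNIV" for k
    by (rule has_sum_finite_neutralI[of "{..k}"]) (use g0 in auto)
  have abs_g: "(\<lambda>(k, j). norm (g k j)) summable_on UNIV \<times> UNIV"
  proof (rule summable_on_SigmaI)
    have "summable (\<lambda>k. norm w * (real (Suc k) ^ P * (2 * norm w) ^ k))"
      using w by (intro summable_mult summable_Suc_power_mult_power) auto
    moreover have "(\<Sum>j\<le>k. norm (g k j)) \<le> norm w * (real (Suc k) ^ P * (2 * norm w) ^ k)" for k
    proof -
      have "(\<Sum>j\<le>k. norm (g k j)) \<le> (\<Sum>j\<le>k. norm w ^ Suc k * (of_nat (k choose j) * real (Suc k) ^ P))"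
        by (intro sum_mono norm_g)
      also have "\<dots> = norm w ^ Suc k * real (Suc k) ^ P * of_nat (\<Sum>j\<le>k. k choose j)"
        by (simp add: sum_distrib_left mult_ac)
      also have "\<dots> = norm w * (real (Suc k) ^ P * (2 * norm w) ^ k)"
        by (simp add: choose_row_sum power_mult_distrib)
      finally show ?thesis .
    qed
    ultimately have "summable (\<lambda>k. \<Sum>j\<le>k. norm (g k j))"
      by - (rule summable_comparison_test'[where N = 0 and g = "\<lambda>k. norm w * (real (Suc k) ^ P * (2 * norm w) ^ k)"],
          auto simp: sum_nonneg)
    thus "(\<lambda>k. \<Sum>j\<le>k. norm (g k j)) summable_on UNIV"
      by (subst summable_on_UNIV_nonneg_real_iff) (auto intro: sum_nonneg)
  qed (use inner in auto)
  hence abs: "(\<lambda>(k, j). g k j) summable_on UNIV \<times> UNIV"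
    by (rule abs_summable_summable[OF back_subst[of "\<lambda>f. f summable_on UNIV \<times> UNIV"]]) (auto simp: fun_eq_iff)
  have inner1: "(\<Sum>\<^sub>\<infinity>j. g k j) = power_diff k s * w ^ Suc k" for k
  proof -
    have "((\<lambda>j. g k j) has_sum (\<Sum>j\<le>k. g k j)) UNIV"
      by (rule has_sum_finite_neutralI[of "{..k}"]) (use g0 in auto)
    hence "(\<Sum>\<^sub>\<infinity>j. g k j) = (\<Sum>j\<le>k. g k j)"
      by (rule infsumI)
    thus ?thesis
      by (simp add: g_def power_diff_def sum_distrib_left sum_distrib_right mult_ac)
  qed
  have inner2: "(\<Sum>\<^sub>\<infinity>k. g k j) = - (of_nat (Suc j) powr (-s) * z ^ Suc j)" for j
  proof -
    have "summable (\<lambda>k. norm (g k j))"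
    proof -
      have "(\<lambda>(j, k). norm (g k j)) summable_on UNIV \<times> UNIV"
        using abs_g by (subst summable_on_swap) (simp add: case_prod_unfold)
      hence "(\<lambda>k. norm (g k j)) summable_on UNIV"
        by (rule summable_on_SigmaD1) auto
      thus ?thesis
        by (simp add: summable_on_UNIV_nonneg_real_iff)
    qed
    moreover have "(\<lambda>k. (-1) ^ j * of_nat (Suc j) powr (-s) * w * (of_nat (k choose j) * w ^ k)) sums
        ((-1) ^ j * of_nat (Suc j) powr (-s) * w * (w ^ j / (1 - w) ^ Suc j))"
      using w by (intro sums_mult binomial_column_sums) auto
    hence "(\<lambda>k. g k j) sums ((-1) ^ j * of_nat (Suc j) powr (-s) * (w / (1 - w)) ^ Suc j)"
      by (simp add: g_def mult_ac power_divide)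
    ultimately have "((\<lambda>k. g k j) has_sum ((-1) ^ j * of_nat (Suc j) powr (-s) * (w / (1 - w)) ^ Suc j)) UNIV"
      by (rule norm_summable_imp_has_sum)
    thus ?thesis
      unfolding w1 by (simp add: infsumI power_minus[of z] flip: power_add mult_2)
  qed
  have "(\<lambda>k. \<Sum>\<^sub>\<infinity>j. g k j) summable_on UNIV"
    using summable_on_Sigma_banach[OF abs] .
  hence "(\<lambda>k. \<Sum>\<^sub>\<infinity>j. g k j) sums (\<Sum>\<^sub>\<infinity>k. \<Sum>\<^sub>\<infinity>j. g k j)"
    by (intro has_sum_imp_sums has_sum_infsum)
  hence 1: "euler_sum s w = (\<Sum>\<^sub>\<infinity>k. \<Sum>\<^sub>\<infinity>j. g k j)"
    unfolding inner1 euler_sum_def by (simp add: sums_iff)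
  have "(\<lambda>n. of_nat n powr (-s) * z ^ n) sums polylog s z"
    using z by (intro sums_polylog) auto
  hence "(\<lambda>j. of_nat (Suc j) powr (-s) * z ^ Suc j) sums polylog s z"
    by (subst sums_Suc_iff) simp
  hence "(\<lambda>j. - (of_nat (Suc j) powr (-s) * z ^ Suc j)) sums - polylog s z"
    by (rule sums_minus)
  moreover have "summable (\<lambda>j. norm (- (of_nat (Suc j) powr (-s) * z ^ Suc j)))"
    unfolding norm_minus_cancel
    by (subst summable_Suc_iff[of "\<lambda>j. norm (of_nat j powr (-s) * z ^ j)"]) (use z in \<open>auto intro: summable_norm_polylog\<close>)
  ultimately have "((\<lambda>j. - (of_nat (Suc j) powr (-s) * z ^ Suc j)) has_sum (- polylog s z)) UNIV"
    by (rule norm_summable_imp_has_sum[rotated])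
  hence "(\<Sum>\<^sub>\<infinity>j. \<Sum>\<^sub>\<infinity>k. g k j) = - polylog s z"
    unfolding inner2 by (rule infsumI)
  with 1 infsum_swap_banach[OF abs] show ?thesis
    by (simp add: w_def)
qed

text \<open>The transformed argument lies in the unit disc exactly when \<open>Re z < 1 / 2\<close>.
  On the convex intersection of this half-plane with the unit disc both sides are holomorphic, so
  agreement near 0 propagates.\<close>

lemma polylog_eq_euler_sum:
  assumes z: "norm z < 1" "Re z < 1 / 2"
  shows "polylog s z = - euler_sum s (- z / (1 - z))"
proof -
  let ?S = "ball 0 1 \<inter> {z. Re z < 1 / 2}"
  have w: "norm (- z / (1 - z)) < 1" if "z \<in> ?S" for z :: complex
  proof -
    have "(norm z)\<^sup>2 < (norm (1 - z))\<^sup>2"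
      using that unfolding cmod_power2 by (simp add: power2_eq_square algebra_simps)
    hence "norm z < norm (1 - z)"
      by (rule power2_less_imp_less) auto
    moreover from this have "norm (1 - z) > 0"
      using norm_ge_zero[of z] by linarith
    ultimately show ?thesis
      by (simp add: norm_divide)
  qed
  show ?thesis
  proof (rule analytic_continuation_open[of "ball 0 (1 / 3)" ?S "polylog s" "\<lambda>z. - euler_sum s (- z / (1 - z))"])
    show "open ?S"
      by (intro open_Int open_ball open_halfspace_Re_lt)
    show "connected ?S"
      by (intro convex_connected convex_Int convex_ball convex_halfspace_Re_lt)
    show "ball 0 (1 / 3) \<subseteq> ?S"
    proof (rule subsetI)
      fix x :: complex assume "x \<in> ball 0 (1 / 3)"
      thus "x \<in> ?S"
        using complex_Re_le_cmod[of x] by auto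
    qed
    show "polylog s holomorphic_on ?S"
      by (rule holomorphic_on_subset[OF holomorphic_polylog]) auto
    have "(euler_sum s \<circ> (\<lambda>z. - z / (1 - z))) holomorphic_on ?S"
      by (rule holomorphic_on_compose_gen[OF _ holomorphic_euler_sum_right])
         (use w in \<open>auto intro!: holomorphic_intros\<close>)
    thus "(\<lambda>z. - euler_sum s (- z / (1 - z))) holomorphic_on ?S"
      by (intro holomorphic_on_minus) (simp add: o_def)
  qed (use z polylog_eq_euler_sum_aux[of _ s] in auto)
qed

subsection \<open>The continuation of the zeta function\<close>

definition eta_exp :: "complex \<Rightarrow> complex \<Rightarrow> complex" where
  "eta_exp s t = euler_sum s (1 / (exp t + 1))"

definition eta :: "complex \<Rightarrow> complex" where
  "eta s = eta_exp s 0"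

text \<open>In this strip \<open>exp t\<close> has positive real part, so the real part of the
  denominator exceeds 1.\<close>

lemma norm_inverse_exp_plus_1:
  assumes "\<bar>Im t\<bar> < pi / 2"
  shows "norm (1 / (exp t + 1)) < 1" "exp t + 1 \<noteq> 0"
proof -
  have "cos (Im t) > 0"
    using assms by (intro cos_gt_zero_pi) auto
  hence "Re (exp t + 1) > 1"
    by (simp add: Re_exp)
  moreover have "Re (exp t + 1) \<le> norm (exp t + 1)"
    by (rule complex_Re_le_cmod)
  ultimately have "norm (exp t + 1) > 1"
    by linarith
  thus "norm (1 / (exp t + 1)) < 1" "exp t + 1 \<noteq> 0"
    by (auto simp: norm_divide divide_less_eq)
qed

lemma has_field_derivative_eta_exp:
  assumes "\<bar>Im t\<bar> < pi / 2"
  shows "(eta_exp s has_field_derivative - eta_exp (s - 1) t) (at t)"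
proof -
  define w where "w = 1 / (exp t + 1)"
  have w: "norm w < 1" "exp t + 1 \<noteq> 0"
    using norm_inverse_exp_plus_1[OF assms] by (auto simp: w_def)
  obtain D where D: "(euler_sum s has_field_derivative D) (at w)" "(w\<^sup>2 - w) * D = - euler_sum (s - 1) w"
    using has_field_derivative_euler_sum[OF w(1)] by blast
  have "((\<lambda>t. 1 / (exp t + 1)) has_field_derivative (w\<^sup>2 - w)) (at t)"
    using w(2) by (auto intro!: derivative_eq_intros simp: w_def power2_eq_square divide_simps)
  from DERIV_chain2[OF D(1)[unfolded w_def] this] D(2)
  show ?thesis
    by (simp add: eta_exp_def[abs_def] w_def mult.commute)
qed

lemma holomorphic_eta_exp: "eta_exp s holomorphic_on {t. \<bar>Im t\<bar> < pi / 2}"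
  by (rule holomorphic_onI) 
     (use has_field_derivative_eta_exp field_differentiable_at_within field_differentiable_def in blast)

lemma holomorphic_eta [holomorphic_intros]: 
  assumes "f holomorphic_on A"
  shows "(\<lambda>z. eta (f z)) holomorphic_on A"
proof -
  have "((\<lambda>s. euler_sum s (1 / 2)) \<circ> f) holomorphic_on A"
    by (intro holomorphic_on_compose assms holomorphic_euler_sum_left) auto
  thus ?thesis
    by (simp add: eta_def eta_exp_def o_def)
qed

lemma open_abs_Im_less: "open {t. \<bar>Im t\<bar> < c}"
  by (intro open_Collect_less continuous_intros)

lemma higher_deriv_eta_exp:
  assumes "\<bar>Im t\<bar> < pi / 2"
  shows "(deriv ^^ n) (eta_exp s) t = (-1) ^ n * eta_exp (s - of_nat n) t"
  using assms
proof (induction n arbitrary: t)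
  case (Suc n)
  have "\<forall>\<^sub>F x in nhds t. x \<in> {t. \<bar>Im t\<bar> < pi / 2}"
    using Suc.prems by (intro eventually_nhds_in_open open_abs_Im_less) auto
  hence "\<forall>\<^sub>F x in nhds t. (deriv ^^ n) (eta_exp s) x = (-1) ^ n * eta_exp (s - of_nat n) x"
    by eventually_elim (use Suc.IH in auto)
  hence "deriv ((deriv ^^ n) (eta_exp s)) t = deriv (\<lambda>x. (-1) ^ n * eta_exp (s - of_nat n) x) t"
    by (intro deriv_cong_ev) auto
  also have "\<dots> = (-1) ^ n * (- eta_exp (s - of_nat n - 1) t)"
    by (intro DERIV_imp_deriv DERIV_cmult has_field_derivative_eta_exp Suc.prems)
  finally show ?case
    by (simp add: algebra_simps)
qed auto

lemma cball_subset_abs_Im: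
  assumes "r < pi / 2"
  shows "cball 0 r \<subseteq> {t. \<bar>Im t\<bar> < pi / 2}"
proof
  fix t :: complex assume "t \<in> cball 0 r"
  thus "t \<in> {t. \<bar>Im t\<bar> < pi / 2}"
    using assms abs_Im_le_cmod[of t] by auto
qed

lemma one_less_pi_half: "1 < pi / 2"
  using pi_gt3 by simp

text \<open>Up to sign, \<open>eta (s - n)\<close> is the n-th derivative of
  \<open>eta_exp s\<close> at 0. The closed unit disc lies in the strip of holomorphy because
  \<open>1 < pi / 2\<close>, so Cauchy's inequality applies with radius 1. Compactness keeps the
  argument of the Euler sum away from the unit circle, which makes the bound uniform for exponents
  near \<open>s\<close>.\<close>

lemma eta_bound: "\<exists>C. \<forall>\<^sub>F s' in nhds s. \<forall>n. norm (eta (s' - of_nat n)) \<le> C * fact n"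
proof -
  have sub: "cball 0 1 \<subseteq> {t. \<bar>Im t\<bar> < pi / 2}"
    by (rule cball_subset_abs_Im[OF one_less_pi_half])
  have "\<exists>t0\<in>cball 0 1. \<forall>t\<in>cball 0 1. norm (1 / (exp t + 1) :: complex) \<le> norm (1 / (exp t0 + 1) :: complex)"
    using sub norm_inverse_exp_plus_1(2)
    by (intro continuous_attains_sup) (auto intro!: continuous_intros)
  then obtain t0 where t0: "t0 \<in> cball 0 1"
    "\<And>t. t \<in> cball 0 1 \<Longrightarrow> norm (1 / (exp t + 1) :: complex) \<le> norm (1 / (exp t0 + 1) :: complex)"
    by blast
  have "norm (1 / (exp t0 + 1)) < 1"
    using sub t0 by (intro norm_inverse_exp_plus_1) auto
  then obtain C where "\<forall>\<^sub>F s' in nhds s. \<forall>w. norm w \<le> norm (1 / (exp t0 + 1)) \<longrightarrow> norm (euler_sum s' w) \<le> C"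
    using euler_sum_locally_bounded by blast
  hence "\<forall>\<^sub>F s' in nhds s. \<forall>n. norm (eta (s' - of_nat n)) \<le> C * fact n"
  proof eventually_elim
    case (elim s')
    show ?case
    proof
      fix n
      have hol: "eta_exp s' holomorphic_on cball 0 1"
        using holomorphic_eta_exp sub by (rule holomorphic_on_subset)
      have "norm ((deriv ^^ n) (eta_exp s') 0) \<le> fact n * C / 1 ^ n"
      proof (rule Cauchy_inequality)
        show "eta_exp s' holomorphic_on ball 0 1"
          using hol by (rule holomorphic_on_subset) auto
        show "continuous_on (cball 0 1) (eta_exp s')"
          using hol by (rule holomorphic_on_imp_continuous_on)
        fix t :: complex assume "norm (0 - t) = 1"
        thus "norm (eta_exp s' t) \<le> C"
          unfolding eta_exp_def using elim t0(2)[of t] by auto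
      qed auto
      thus "norm (eta (s' - of_nat n)) \<le> C * fact n"
        by (simp add: higher_deriv_eta_exp eta_def norm_mult norm_power mult.commute)
    qed
  qed
  thus ?thesis by blast
qed

lemma eta_exp_sums:
  assumes "norm t < 1"
  shows "(\<lambda>n. (-1) ^ n / fact n * eta (s - of_nat n) * t ^ n) sums eta_exp s t"
proof -
  have "eta_exp s holomorphic_on ball 0 1"
    by (rule holomorphic_on_subset[OF holomorphic_eta_exp])
       (use cball_subset_abs_Im[OF one_less_pi_half] ball_subset_cball in blast)
  hence "(\<lambda>n. (deriv ^^ n) (eta_exp s) 0 / fact n * (t - 0) ^ n) sums eta_exp s t"
    by (rule holomorphic_power_series) (use assms in auto)
  thus ?thesis
    by (simp add: higher_deriv_eta_exp eta_def)
qed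

text \<open>
  The zeros of the denominator on the line \<open>Re s = 1\<close> do no harm: the continuation of \<open>\<zeta>\<close> is
  \<open>remove_sings zeta_eta\<close>, and its values are needed off that line only.
\<close>
definition zeta_eta :: "complex \<Rightarrow> complex" where
  "zeta_eta s = eta s / (1 - 2 powr (1 - s))"

lemma norm_two_powr: "norm (2 powr z :: complex) = 2 powr Re z"
  using norm_powr_real_powr[of 2 z] by simp

lemma one_minus_two_powr_ne_0: "Re s \<noteq> 1 \<Longrightarrow> 1 - 2 powr (1 - s) \<noteq> (0 :: complex)"
  using norm_two_powr[of "1 - s"] by (auto simp: powr_eq_one_iff)

lemma holomorphic_zeta_eta: "zeta_eta holomorphic_on {s. Re s \<noteq> 1}"
  unfolding zeta_eta_def using one_minus_two_powr_ne_0 by (intro holomorphic_intros) auto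

definition zeta_coeff :: "nat \<Rightarrow> complex \<Rightarrow> complex" where
  "zeta_coeff n s = (-1) ^ n / fact n * zeta_eta (s - of_nat n)"

lemma holomorphic_zeta_coeff: "zeta_coeff n holomorphic_on {s. Re s < 1}"
proof -
  have "(zeta_eta \<circ> (\<lambda>s. s - of_nat n)) holomorphic_on {s. Re s < 1}"
    by (rule holomorphic_on_compose_gen[OF _ holomorphic_zeta_eta]) (auto intro!: holomorphic_intros)
  thus ?thesis
    unfolding zeta_coeff_def by (intro holomorphic_intros) (simp add: o_def)
qed

lemma zeta_coeff_shift: "of_nat (Suc n) * zeta_coeff (Suc n) s = - zeta_coeff n (s - 1)"
proof -
  have "s - of_nat (Suc n) = s - 1 - of_nat n"
    by simp
  thus ?thesis
    by (simp add: zeta_coeff_def field_simps del: of_nat_Suc)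
qed

text \<open>The denominator \<open>1 - 2 powr (1 - s + n)\<close> grows like \<open>2 ^ n\<close>,
  which is the gain over \<open>eta_bound\<close>. The midpoint \<open>r\<close> between
  \<open>Re s\<close> and 1 keeps all denominators away from 0 while the exponent varies.\<close>

lemma zeta_coeff_bound:
  assumes s: "Re s < 1"
  shows "\<exists>C. \<forall>\<^sub>F s' in nhds s. \<forall>n. norm (zeta_coeff n s') \<le> C * (1 / 2) ^ n"
proof -
  obtain C where C: "\<forall>\<^sub>F s' in nhds s. \<forall>n. norm (eta (s' - of_nat n)) \<le> C * fact n"
    using eta_bound by blast
  define r where "r = (Re s + 1) / 2"
  have r: "Re s < r" "r < 1"
    using s by (auto simp: r_def)
  define d where "d = 2 powr (1 - r) - 1"
  have d: "d > 0"
    using r by (simp add: d_def)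
  have "\<forall>\<^sub>F s' in nhds s. s' \<in> {s. Re s < r}"
    using r by (intro eventually_nhds_in_open open_halfspace_Re_lt) auto
  with C have "\<forall>\<^sub>F s' in nhds s. \<forall>n. norm (zeta_coeff n s') \<le> C / d * (1 / 2) ^ n"
  proof eventually_elim
    case (elim s')
    show ?case
    proof
      fix n
      have "C \<ge> 0"
        using elim(1)[rule_format, of 0] order_trans[OF norm_ge_zero[of "eta s'"]] by auto
      have "2 ^ n * d \<le> 2 ^ n * (2 powr (1 - Re s') - 1)"
        using elim(2) by (simp add: d_def)
      also have "\<dots> \<le> 2 ^ n * 2 powr (1 - Re s') - 1"
        by (simp add: algebra_simps)
      also have "2 ^ n * 2 powr (1 - Re s') = norm (2 powr (1 - (s' - of_nat n)) :: complex)"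
        unfolding norm_two_powr by (simp add: powr_add powr_diff powr_realpow)
      also have "norm (2 powr (1 - (s' - of_nat n)) :: complex) - 1 \<le> norm (1 - 2 powr (1 - (s' - of_nat n)) :: complex)"
        by (metis norm_one norm_minus_commute norm_triangle_ineq2)
      finally have le: "2 ^ n * d \<le> norm (1 - 2 powr (1 - (s' - of_nat n)) :: complex)" .
      have "norm (zeta_coeff n s') = (norm (eta (s' - of_nat n)) / fact n) / norm (1 - 2 powr (1 - (s' - of_nat n)) :: complex)"
        by (simp add: zeta_coeff_def zeta_eta_def norm_mult norm_divide norm_power)
      also have "\<dots> \<le> C / (2 ^ n * d)"
        using elim(1) d le \<open>C \<ge> 0\<close> by (intro frac_le) (auto simp: field_simps)
      finally show "norm (zeta_coeff n s') \<le> C / d * (1 / 2) ^ n"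
        by (simp add: field_simps power_divide)
    qed
  qed
  thus ?thesis by blast
qed

lemma summable_norm_zeta_coeff:
  assumes s: "Re s < 1" and t: "norm t < 2"
  shows "summable (\<lambda>n. norm (zeta_coeff n s * t ^ n))"
proof -
  obtain C where "\<forall>\<^sub>F s' in nhds s. \<forall>n. norm (zeta_coeff n s') \<le> C * (1 / 2) ^ n"
    using zeta_coeff_bound[OF s] by blast
  from eventually_nhds_x_imp_x[OF this] have "norm (zeta_coeff n s * t ^ n) \<le> C * (norm t / 2) ^ n" for n
    by (auto simp: norm_mult norm_power power_divide intro!: mult_right_mono[of "norm (zeta_coeff n s)" "C / 2 ^ n" "norm t ^ n", simplified])
  moreover have "summable (\<lambda>n. C * (norm t / 2) ^ n)"
    using t by (intro summable_mult summable_geometric) auto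
  ultimately show ?thesis
    by - (rule summable_comparison_test'[where N = 0 and g = "\<lambda>n. C * (norm t / 2) ^ n"], auto)
qed

definition zeta_series :: "complex \<Rightarrow> complex \<Rightarrow> complex" where
  "zeta_series s t = (\<Sum>n. zeta_coeff n s * t ^ n)"

lemma zeta_series_sums:
  assumes "Re s < 1" and "norm t < 2"
  shows "(\<lambda>n. zeta_coeff n s * t ^ n) sums zeta_series s t"
  unfolding zeta_series_def using summable_norm_cancel[OF summable_norm_zeta_coeff[OF assms]] by (rule summable_sums)

lemma has_field_derivative_zeta_series:
  assumes s: "Re s < 1" and t: "norm t < 2"
  shows "(zeta_series s has_field_derivative - zeta_series (s - 1) t) (at t)"
proof -
  have "((\<lambda>x. \<Sum>n. zeta_coeff n s * x ^ n) has_field_derivative (\<Sum>n. diffs (\<lambda>n. zeta_coeff n s) n * t ^ n)) (at t)"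
    by (rule termdiffs_strong'[of 2]) (use t zeta_series_sums[OF s] in \<open>auto simp: sums_iff\<close>)
  moreover have "(\<Sum>n. diffs (\<lambda>n. zeta_coeff n s) n * t ^ n) = - zeta_series (s - 1) t"
    unfolding zeta_series_def diffs_def zeta_coeff_shift
    using zeta_series_sums[of "s - 1" t] s t by (subst suminf_minus[symmetric]) (auto simp: sums_iff)
  ultimately show ?thesis
    by (simp add: zeta_series_def[abs_def])
qed

lemma holomorphic_zeta_series:
  assumes "Re s < 1"
  shows "zeta_series s holomorphic_on ball 0 2"
  unfolding holomorphic_on_open[OF open_ball] using has_field_derivative_zeta_series[OF assms] by fastforce

text \<open>Coefficientwise, the factor \<open>1 - 2 powr (1 - s + n)\<close> cancels the
  denominator in \<open>zeta_eta\<close>, and the Taylor series of \<open>eta_exp\<close> remains.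
  The bound on \<open>t\<close> keeps \<open>2 * t\<close> within the radius 2.\<close>

lemma zeta_series_duplication:
  assumes s: "Re s < 1" and t: "norm t < 1"
  shows "zeta_series s t - 2 powr (1 - s) * zeta_series s (2 * t) = eta_exp s t"
proof -
  have "(\<lambda>n. zeta_coeff n s * t ^ n - 2 powr (1 - s) * (zeta_coeff n s * (2 * t) ^ n)) sums
          (zeta_series s t - 2 powr (1 - s) * zeta_series s (2 * t))"
    using s t by (intro sums_diff sums_mult zeta_series_sums) (auto simp: norm_mult)
  also have "(\<lambda>n. zeta_coeff n s * t ^ n - 2 powr (1 - s) * (zeta_coeff n s * (2 * t) ^ n)) =
        (\<lambda>n. (-1) ^ n / fact n * eta (s - of_nat n) * t ^ n)"
  proof
    fix n
    have "2 powr (1 - (s - of_nat n)) = 2 powr (1 - s) * (2 ^ n :: complex)"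
      using powr_add[of 2 "1 - s" "of_nat n"] by (simp add: powr_nat' algebra_simps)
    hence "zeta_coeff n s * t ^ n - 2 powr (1 - s) * (zeta_coeff n s * (2 * t) ^ n) =
        (-1) ^ n / fact n * (zeta_eta (s - of_nat n) * (1 - 2 powr (1 - (s - of_nat n)))) * t ^ n"
      by (simp add: zeta_coeff_def power_mult_distrib algebra_simps)
    moreover have "1 - 2 powr (1 - (s - of_nat n)) \<noteq> (0 :: complex)"
      using s by (intro one_minus_two_powr_ne_0) auto
    hence "zeta_eta (s - of_nat n) * (1 - 2 powr (1 - (s - of_nat n))) = eta (s - of_nat n)"
      by (simp add: zeta_eta_def)
    ultimately show "zeta_coeff n s * t ^ n - 2 powr (1 - s) * (zeta_coeff n s * (2 * t) ^ n) =
        (-1) ^ n / fact n * eta (s - of_nat n) * t ^ n"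
      by simp
  qed
  finally show ?thesis
    using eta_exp_sums[OF t, of s] sums_unique2 by blast
qed

lemma polylog_exp_duplication:
  assumes t: "t > 0"
  shows "polylog s (exp (- of_real t)) - 2 powr (1 - s) * polylog s (exp (- (2 * of_real t))) = eta_exp s (of_real t)"
proof -
  define z where "z = exp (- complex_of_real t)"
  have z: "norm z < 1"
    using t by (simp add: z_def)
  have z2: "z\<^sup>2 = exp (- (2 * of_real t))"
    by (simp add: z_def flip: exp_double)
  have [simp]: "exp (complex_of_real t) + 1 \<noteq> 0"
    by (rule norm_inverse_exp_plus_1) auto
  have "z = of_real (exp (-t))"
    by (simp add: z_def exp_of_real[symmetric])
  hence "polylog s (-z) = - euler_sum s (- (-z) / (1 - (-z)))"
    using z by (intro polylog_eq_euler_sum) (auto intro: less_trans[of _ 0])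
  also have "- (-z) / (1 - (-z)) = 1 / (exp (of_real t) + 1)"
    by (simp add: z_def exp_minus field_simps)
  finally have "polylog s (-z) = - eta_exp s (of_real t)"
    by (simp add: eta_exp_def)
  thus ?thesis
    using polylog_duplication[OF z, of s] unfolding z2 by (simp add: z_def algebra_simps)
qed

subsection \<open>The polylogarithm near 1\<close>

lemma summable_powr_mult_power:
  fixes v :: real
  assumes v: "0 \<le> v" "v < 1" 
  shows "summable (\<lambda>n. real n powr (-s) * v ^ n)"
proof -
  have "norm (of_nat n powr (- of_real s) * of_real v ^ n :: complex) = real n powr (-s) * v ^ n" for n
    using v norm_powr_real_powr[of "of_nat n" "- of_real s"] by (cases "n = 0") (auto simp: norm_mult norm_power)
  thus ?thesis
    using summable_norm_polylog[of "of_real v" "of_real s"] v by simp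
qed

text \<open>
  The coefficients of \<open>(1 - v) powr (s - 1)\<close> are asymptotically equivalent to those of
  the polylogarithm, up to the factor \<open>Gamma (1 - s)\<close>.
\<close>
lemma polylog_real_asymptotic_bound:
  fixes s e :: real
  assumes s: "s < 1" and e: "e > 0"
  shows "\<exists>C. \<forall>v. 0 \<le> v \<and> v < 1 \<longrightarrow>
           \<bar>(\<Sum>n. real n powr (-s) * v ^ n) - Gamma (1 - s) * (1 - v) powr (s - 1)\<bar> \<le> C + e * (1 - v) powr (s - 1)"
proof -
  define b where "b = (\<lambda>n. pochhammer (1 - s) n / fact n)"
  have b_pos: "b n > 0" for n
    unfolding b_def using s by (intro divide_pos_pos pochhammer_pos) auto
  have gb: "((s - 1) gchoose n) = (-1) ^ n * b n" for n
    by (simp add: gbinomial_pochhammer b_def)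
  have b_sums: "(\<lambda>n. b n * v ^ n) sums (1 - v) powr (s - 1)" if "\<bar>v\<bar> < 1" for v
  proof -
    have "(\<lambda>n. ((s - 1) gchoose n) * (-v) ^ n) sums (1 + -v) powr (s - 1)"
      by (rule gen_binomial_real) (use that in auto)
    moreover have "((s - 1) gchoose n) * (-v) ^ n = b n * v ^ n" for n
      unfolding gb by (simp add: power_minus[of v] mult_ac flip: power_add mult_2)
    ultimately show ?thesis by simp
  qed
  have "(\<lambda>n. ((s - 1) gchoose n) / ((-1) ^ n / exp ((s - 1 + 1) * of_real (ln (real n))))) \<longlonglongrightarrow>
          inverse (Gamma (- (s - 1)))"
    by (rule gbinomial_asymptotic)
  hence "(\<lambda>n. inverse (((s - 1) gchoose n) / ((-1) ^ n / exp ((s - 1 + 1) * of_real (ln (real n)))))) \<longlonglongrightarrow>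
          inverse (inverse (Gamma (- (s - 1))))"
    by (rule tendsto_inverse) (use less_imp_neq[OF Gamma_real_pos[of "1 - s"]] s in auto)
  hence "(\<lambda>n. inverse (((s - 1) gchoose n) / ((-1) ^ n / exp ((s - 1 + 1) * of_real (ln (real n)))))) \<longlonglongrightarrow>
          Gamma (1 - s)"
    by simp
  moreover have "\<forall>\<^sub>F n in sequentially. inverse (((s - 1) gchoose n) / ((-1) ^ n / exp ((s - 1 + 1) * of_real (ln (real n))))) =
      real n powr (-s) / b n"
    using eventually_gt_at_top[of 0]
  proof eventually_elim
    case (elim n)
    have "(-1) ^ n * (-1) ^ n = (1 :: real)"
      by (simp flip: power_add mult_2)
    thus ?case
      using elim b_pos[of n] unfolding gb by (simp add: powr_def exp_minus field_simps)
  qed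
  ultimately have "(\<lambda>n. real n powr (-s) / b n) \<longlonglongrightarrow> Gamma (1 - s)"
    by (rule Lim_transform_eventually)
  then obtain N where N: "\<And>n. n \<ge> N \<Longrightarrow> \<bar>real n powr (-s) / b n - Gamma (1 - s)\<bar> < e"
    using e by (auto simp: LIMSEQ_iff)
  define c where "c = (\<lambda>n. real n powr (-s) - Gamma (1 - s) * b n)"
  have c: "\<bar>c n\<bar> \<le> e * b n" if "n \<ge> N" for n
  proof -
    have "c n = (real n powr (-s) / b n - Gamma (1 - s)) * b n"
      using b_pos[of n] by (simp add: c_def field_simps)
    also have "\<bar>\<dots>\<bar> = \<bar>real n powr (-s) / b n - Gamma (1 - s)\<bar> * b n"
      using b_pos[of n] by (simp add: abs_mult)
    also have "\<dots> \<le> e * b n"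
      using N[OF that] b_pos[of n] by (intro mult_right_mono) auto
    finally show ?thesis .
  qed
  show ?thesis
  \<comment> \<open>Only the coefficients below \<open>N\<close> may violate the estimate
    \<open>c\<close>; their total absolute value is the constant.\<close>
  proof (intro exI[of _ "\<Sum>n<N. \<bar>c n\<bar>"] allI impI)
    fix v :: real assume v: "0 \<le> v \<and> v < 1"
    have "(\<lambda>n. real n powr (-s) * v ^ n - Gamma (1 - s) * (b n * v ^ n)) sums
        ((\<Sum>n. real n powr (-s) * v ^ n) - Gamma (1 - s) * (1 - v) powr (s - 1))"
      using v by (intro sums_diff sums_mult b_sums summable_sums summable_powr_mult_power) auto
    hence 1: "(\<lambda>n. c n * v ^ n) sums ((\<Sum>n. real n powr (-s) * v ^ n) - Gamma (1 - s) * (1 - v) powr (s - 1))"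
      by (simp add: c_def algebra_simps)
    have 2: "(\<lambda>n. (if n \<in> {..<N} then \<bar>c n\<bar> else 0) + e * (b n * v ^ n)) sums ((\<Sum>n<N. \<bar>c n\<bar>) + e * (1 - v) powr (s - 1))"
      by (intro sums_add sums_If_finite_set sums_mult b_sums) (use v in auto)
    have 3: "norm (c n * v ^ n) \<le> (if n \<in> {..<N} then \<bar>c n\<bar> else 0) + e * (b n * v ^ n)" for n
    proof (cases "n < N")
      case True
      have "\<bar>c n\<bar> * v ^ n \<le> \<bar>c n\<bar> * 1"
        using v by (intro mult_left_mono power_le_one) auto
      moreover have "e * (b n * v ^ n) \<ge> 0"
        using e b_pos[of n] v by auto
      ultimately show ?thesis
        using True v by (simp add: abs_mult power_abs)
    next
      case False
      thus ?thesis
        using c[of n] v by (auto simp: abs_mult power_abs mult.assoc[symmetric] intro!: mult_right_mono)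
    qed
    have "summable (\<lambda>n. norm (c n * v ^ n))"
      using 3 by (intro summable_comparison_test'[where N = 0, OF sums_summable[OF 2]]) auto
    hence "norm (\<Sum>n. c n * v ^ n) \<le> (\<Sum>n. (if n \<in> {..<N} then \<bar>c n\<bar> else 0) + e * (b n * v ^ n))"
      by (intro order_trans[OF summable_norm] suminf_le 3 sums_summable[OF 2])
    thus "\<bar>(\<Sum>n. real n powr (-s) * v ^ n) - Gamma (1 - s) * (1 - v) powr (s - 1)\<bar> \<le>
        (\<Sum>n<N. \<bar>c n\<bar>) + e * (1 - v) powr (s - 1)"
      using sums_unique[OF 1] sums_unique[OF 2] by simp
  qed
qed

text \<open>With \<open>v = exp (-t)\<close>, multiplication by \<open>t powr (1 - s)\<close> makes
  the constant of the preceding bound disappear as \<open>t\<close> tends to 0, while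
  \<open>1 - v\<close> is asymptotic to \<open>t\<close>.\<close>

lemma polylog_real_limit:
  fixes s :: real
  assumes s: "s < 1"
  shows "((\<lambda>t. t powr (1 - s) * (\<Sum>n. real n powr (-s) * exp (-t) ^ n)) \<longlongrightarrow> Gamma (1 - s)) (at_right 0)"
proof -
  define p where "p = (\<lambda>t. \<Sum>n. real n powr (-s) * exp (-t) ^ n)"
  define Y where "Y = (\<lambda>t. t powr (1 - s) * (1 - exp (-t)) powr (s - 1))"
  have "((\<lambda>t::real. (1 - exp (-t)) / t) \<longlongrightarrow> 1) (at_right 0)"
    by real_asymp
  hence "((\<lambda>t. ((1 - exp (-t)) / t) powr (s - 1)) \<longlongrightarrow> 1 powr (s - 1)) (at_right (0::real))"
    by (intro tendsto_powr tendsto_const) auto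
  moreover have "\<forall>\<^sub>F t in at_right 0. ((1 - exp (-t)) / t) powr (s - 1) = Y t"
    using eventually_at_right_less[of 0]
  proof eventually_elim
    case (elim t)
    hence "((1 - exp (-t)) / t) powr (s - 1) = (1 - exp (-t)) powr (s - 1) / t powr (s - 1)"
      by (intro powr_divide)
    also have "t powr (s - 1) = 1 / t powr (1 - s)"
      using powr_minus_divide[of t "1 - s"] by simp
    finally show ?case
      by (simp add: Y_def mult.commute)
  qed
  ultimately have Y: "(Y \<longlongrightarrow> 1) (at_right 0)"
    by (simp add: tendsto_cong)
  have u: "((\<lambda>t. t powr (1 - s)) \<longlongrightarrow> 0) (at_right 0)"
    using tendsto_powr'[of "\<lambda>t. t" 0 "at_right 0" "\<lambda>_. 1 - s" "1 - s"] s
    by (auto simp: eventually_at_right_less eventually_at_filter)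
  have "((\<lambda>t. t powr (1 - s) * p t - Gamma (1 - s) * Y t) \<longlongrightarrow> 0) (at_right 0)"
  proof (rule tendstoI)
    fix e :: real assume e: "e > 0"
    \<comment> \<open>\<open>Y\<close> is eventually below 2, so an error of \<open>e / 4\<close>
      contributes less than \<open>e / 2\<close>; the term with \<open>C\<close> uses the other
      half.\<close>
    obtain C where C: "\<And>v. 0 \<le> v \<Longrightarrow> v < 1 \<Longrightarrow>
        \<bar>(\<Sum>n. real n powr (-s) * v ^ n) - Gamma (1 - s) * (1 - v) powr (s - 1)\<bar> \<le> C + e / 4 * (1 - v) powr (s - 1)"
      using polylog_real_asymptotic_bound[OF s, of "e / 4"] e by auto
    have "((\<lambda>t. t powr (1 - s) * C) \<longlongrightarrow> 0 * C) (at_right 0)"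
      by (intro tendsto_intros u)
    hence "\<forall>\<^sub>F t in at_right 0. t powr (1 - s) * C < e / 2"
      by (rule order_tendstoD) (use e in auto)
    moreover have "\<forall>\<^sub>F t in at_right 0. Y t < 2"
      by (rule order_tendstoD[OF Y]) auto
    moreover have "\<forall>\<^sub>F t in at_right (0::real). t > 0"
      by (rule eventually_at_right_less)
    ultimately show "\<forall>\<^sub>F t in at_right 0. dist (t powr (1 - s) * p t - Gamma (1 - s) * Y t) 0 < e"
    proof eventually_elim
      case (elim t)
      have "\<bar>t powr (1 - s) * p t - Gamma (1 - s) * Y t\<bar> =
          t powr (1 - s) * \<bar>p t - Gamma (1 - s) * (1 - exp (-t)) powr (s - 1)\<bar>"
        by (simp add: Y_def abs_mult[symmetric, of "t powr (1 - s)", simplified] algebra_simps)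
      also have "\<dots> \<le> t powr (1 - s) * (C + e / 4 * (1 - exp (-t)) powr (s - 1))"
        unfolding p_def using C[of "exp (-t)"] elim(3) by (intro mult_left_mono) auto
      also have "\<dots> = t powr (1 - s) * C + e / 4 * Y t"
        by (simp add: Y_def algebra_simps)
      also have "e / 4 * Y t < e / 4 * 2"
        using elim e by (intro mult_strict_left_mono) auto
      finally show ?case
        using elim(1) by simp
    qed
  qed
  from tendsto_add[OF this tendsto_mult[OF tendsto_const[of "Gamma (1 - s)"] Y]] show ?thesis
    by (simp add: p_def)
qed

lemma of_nat_powr_of_real: "complex_of_nat n powr (- complex_of_real s) = of_real (real n powr (-s))"
  using powr_of_real[of "real n" "-s"] by simp

lemma polylog_of_real:
  assumes v: "0 \<le> v" "v < 1"
  shows "polylog (of_real s) (of_real v) = of_real (\<Sum>n. real n powr (-s) * v ^ n)"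
  unfolding polylog_def of_nat_powr_of_real
  using suminf_of_real[OF summable_powr_mult_power[OF v], of s, where ?'a = complex] by simp

text \<open>The difference \<open>f\<close> of the two sides satisfies
  \<open>f t = 2 powr (1 - s) * f (2 * t)\<close>, so \<open>g\<close> is invariant under doubling.
  By \<open>polylog_real_limit\<close> it tends to 0 at 0, and \<open>g t = g (t / 2 ^ m)\<close>
  forces \<open>g t = 0\<close>.\<close>

lemma polylog_expansion_real:
  fixes s t :: real
  assumes s: "s < 1" and t: "0 < t" "t < 2"
  shows "polylog (of_real s) (exp (- of_real t)) =
           Gamma (1 - of_real s) * of_real t powr (of_real s - 1) + zeta_series (of_real s) (of_real t)"
proof -
  define f where "f = (\<lambda>t. polylog (of_real s) (exp (- of_real t)) -
           of_real (Gamma (1 - s) * t powr (s - 1)) - zeta_series (of_real s) (of_real t))"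
  define g where "g = (\<lambda>t. of_real (t powr (1 - s)) * f t)"
  have two: "2 powr (1 - complex_of_real s) = of_real (2 powr (1 - s))"
    using powr_of_real[of 2 "1 - s"] by simp
  have g2: "g (2 * t) = g t" if t: "0 < t" "t < 1" for t
  proof -
    have p1: "2 powr (1 - s) * (2 * t) powr (s - 1) = t powr (s - 1)"
      using t by (simp add: powr_mult mult.assoc[symmetric] flip: powr_add)
    have "f t - of_real (2 powr (1 - s)) * f (2 * t) =
       (polylog (of_real s) (exp (- of_real t)) - 2 powr (1 - of_real s) * polylog (of_real s) (exp (- (2 * of_real t)))) -
       of_real (Gamma (1 - s) * (t powr (s - 1) - 2 powr (1 - s) * (2 * t) powr (s - 1))) -
       (zeta_series (of_real s) (of_real t) - 2 powr (1 - of_real s) * zeta_series (of_real s) (2 * of_real t))"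
      by (simp add: f_def two algebra_simps)
    also have "\<dots> = 0"
      unfolding p1 using t s by (simp add: polylog_exp_duplication zeta_series_duplication)
    finally have "f t = of_real (2 powr (1 - s)) * f (2 * t)"
      by simp
    thus ?thesis
      using t by (simp add: g_def powr_mult)
  qed
  have g_pow: "g (t / 2 ^ m) = g t" for m
  proof (induction m)
    case (Suc m)
    have "t / 2 ^ Suc m < 1"
      using t by (simp add: field_simps) (smt (verit, best) one_le_power)
    hence "g (2 * (t / 2 ^ Suc m)) = g (t / 2 ^ Suc m)"
      using t by (intro g2) auto
    thus ?case
      using Suc.IH by simp
  qed auto
  have "((\<lambda>t. of_real (t powr (1 - s) * (\<Sum>n. real n powr (-s) * exp (-t) ^ n)) -
           of_real (Gamma (1 - s)) - of_real (t powr (1 - s)) * zeta_series (of_real s) (of_real t)) \<longlongrightarrow>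
          complex_of_real (Gamma (1 - s)) - of_real (Gamma (1 - s)) - of_real 0 * zeta_series (of_real s) (of_real 0)) (at_right 0)"
  proof (intro tendsto_diff tendsto_of_real tendsto_mult polylog_real_limit s tendsto_const)
    show "((\<lambda>t. t powr (1 - s)) \<longlongrightarrow> 0) (at_right 0)"
      using tendsto_powr'[of "\<lambda>t. t" 0 "at_right 0" "\<lambda>_. 1 - s" "1 - s"] s
      by (auto simp: eventually_at_right_less eventually_at_filter)
    have "isCont (zeta_series (of_real s)) 0"
      using has_field_derivative_zeta_series[of "of_real s" 0] s by (intro DERIV_isCont) auto
    thus "((\<lambda>t. zeta_series (of_real s) (complex_of_real t)) \<longlongrightarrow> zeta_series (of_real s) (of_real 0)) (at_right 0)"
      by (intro isCont_tendsto_compose[of _ "zeta_series (of_real s)"] tendsto_of_real) (auto simp: tendsto_ident_at)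
  qed
  moreover have "\<forall>\<^sub>F t in at_right 0. of_real (t powr (1 - s) * (\<Sum>n. real n powr (-s) * exp (-t) ^ n)) -
           of_real (Gamma (1 - s)) - of_real (t powr (1 - s)) * zeta_series (of_real s) (of_real t) = g t"
    using eventually_at_right_less[of 0]
  proof eventually_elim
    case (elim t)
    have "polylog (of_real s) (exp (- of_real t)) = of_real (\<Sum>n. real n powr (-s) * exp (-t) ^ n)"
      using polylog_of_real[of "exp (-t)" s] elim by (simp flip: exp_of_real)
    moreover have "t powr (1 - s) * t powr (s - 1) = 1"
      using elim by (simp flip: powr_add)
    hence "complex_of_real (t powr (1 - s)) * of_real (t powr (s - 1)) = 1"
      by (simp flip: of_real_mult)
    ultimately show ?case
      by (simp add: g_def f_def right_diff_distrib mult.left_commute)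
  qed
  ultimately have "(g \<longlongrightarrow> 0) (at_right 0)"
    by (simp add: tendsto_cong)
  moreover have "filterlim (\<lambda>m. t / 2 ^ m) (at_right 0) sequentially"
    using t by real_asymp
  ultimately have "(\<lambda>m. g (t / 2 ^ m)) \<longlonglongrightarrow> 0"
    by (rule filterlim_compose)
  hence "g t = 0"
    by (simp add: g_pow LIMSEQ_const_iff)
  hence "f t = 0"
    using t by (simp add: g_def)
  moreover have "complex_of_real t powr (of_real s - 1) = of_real (t powr (s - 1))"
    using t by (simp add: powr_of_real_minus_one)
  moreover have "Gamma (1 - complex_of_real s) = of_real (Gamma (1 - s))"
    using Gamma_complex_of_real[of "1 - s"] by simp
  ultimately show ?thesis
    by (simp add: f_def algebra_simps)
qed

lemma islimpt_complex_of_real_Ioo: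
  assumes "a \<le> x" "x < b"
  shows "complex_of_real x islimpt complex_of_real ` {a<..<b}"
  unfolding islimpt_approachable
proof (intro allI impI)
  fix e :: real assume e: "e > 0"
  define d where "d = min (e / 2) ((b - x) / 2)"
  have d: "d > 0" "x + d < b" "d < e"
    using e assms by (auto simp: d_def min_def field_simps)
  have "dist (complex_of_real (x + d)) (of_real x) = d"
    using d by (simp only: dist_of_real) (simp add: dist_real_def)
  moreover have "complex_of_real (x + d) \<noteq> of_real x"
    using d by simp
  moreover have "complex_of_real (x + d) \<in> complex_of_real ` {a<..<b}"
    using d assms by (intro imageI) auto
  ultimately show "\<exists>x'\<in>complex_of_real ` {a<..<b}. x' \<noteq> of_real x \<and> dist x' (of_real x) < e"
    using d by metis
qed

text \<open>Complex \<open>t\<close> serve the boundedness argument for the lattice sum, which takes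
  place on a half-plane.\<close>

lemma polylog_expansion:
  fixes s :: real and t :: complex
  assumes s: "s < 1" and t: "Re t > 0" "norm t < 2"
  shows "polylog (of_real s) (exp (- t)) = Gamma (1 - of_real s) * t powr (of_real s - 1) + zeta_series (of_real s) t"
proof -
  let ?S = "{t. Re t > 0} \<inter> ball 0 2"
  let ?U = "complex_of_real ` {0<..<2}"
  let ?f = "\<lambda>t. polylog (of_real s) (exp (- t)) - (Gamma (1 - of_real s) * t powr (of_real s - 1) + zeta_series (of_real s) t)"
  have "?f t = 0"
  proof (rule analytic_continuation[of ?f ?S ?U 1])
    have "(polylog (of_real s) \<circ> (\<lambda>t. exp (- t))) holomorphic_on ?S"
      by (rule holomorphic_on_compose_gen[OF _ holomorphic_polylog]) (auto intro!: holomorphic_intros)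
    moreover have "zeta_series (of_real s) holomorphic_on ?S"
      by (rule holomorphic_on_subset[OF holomorphic_zeta_series]) (use s in auto)
    ultimately show "?f holomorphic_on ?S"
      unfolding o_def by (intro holomorphic_intros) (auto simp: complex_nonpos_Reals_iff)
    show "open ?S" "connected ?S"
      by (auto intro!: open_halfspace_Re_gt convex_connected convex_Int convex_halfspace_Re_gt)
    show "1 islimpt ?U"
      using islimpt_complex_of_real_Ioo[of 0 1 2] by simp
    fix z assume "z \<in> ?U"
    thus "?f z = 0"
      using polylog_expansion_real[OF s] by auto
  qed (use t in auto)
  thus ?thesis by simp
qed

section \<open>Agreement with the Dirichlet series for Re s > 1\<close>

lemma summable_norm_zeta:
  assumes "Re s > 1"
  shows "summable (\<lambda>n. norm (of_nat n powr (-s) :: complex))"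
proof -
  have "summable (\<lambda>n. real n powr (- Re s))"
    using assms by (subst summable_real_powr_iff) auto
  moreover have "norm (of_nat n powr (-s) :: complex) = real n powr (- Re s)" for n
    using norm_powr_real_powr[of "of_nat n" "-s"] by (cases "n = 0") auto
  ultimately show ?thesis by simp
qed

lemma continuous_on_polylog:
  assumes "Re s > 1"
  shows "continuous_on (cball 0 1) (polylog s)"
proof -
  have "uniform_limit (cball 0 1) (\<lambda>N z. \<Sum>n<N. of_nat n powr (-s) * z ^ n) (polylog s) sequentially"
    unfolding polylog_def[abs_def]
  proof (rule Weierstrass_m_test[OF _ summable_norm_zeta[OF assms]])
    fix n and z :: complex assume "z \<in> cball 0 1"
    hence "norm z ^ n \<le> 1"
      by (intro power_le_one) auto
    thus "norm (of_nat n powr (-s) * z ^ n) \<le> norm (of_nat n powr (-s) :: complex)"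
      by (simp add: norm_mult norm_power mult_left_le)
  qed
  thus ?thesis
    by (rule uniform_limit_theorem[rotated]) (auto intro!: always_eventually continuous_intros)
qed

text \<open>For \<open>Re s > 1\<close> the polylogarithm is continuous up to the unit circle, so
  letting \<open>t\<close> tend to 0 in \<open>polylog_exp_duplication\<close> yields
  \<open>(1 - 2 powr (1 - s)) * polylog s 1 = eta s\<close>.\<close>

lemma zeta_eta_eq:
  assumes s: "Re s > 1"
  shows "zeta_eta s = (\<Sum>\<^sub>\<infinity>n\<in>{1::nat..}. of_nat n powr (-s))"
proof -
  have lim: "((\<lambda>t. polylog s (exp (- (of_real c * of_real t)))) \<longlongrightarrow> polylog s 1) (at_right 0)" if "c > 0" for c
  proof (rule continuous_on_tendsto_compose[OF continuous_on_polylog[OF s]])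
    show "((\<lambda>t. exp (- (of_real c * of_real t))) \<longlongrightarrow> (1 :: complex)) (at_right 0)"
      by (rule tendsto_eq_intros refl tendsto_ident_at | simp)+
    show "\<forall>\<^sub>F t in at_right 0. exp (- (of_real c * of_real t)) \<in> cball (0 :: complex) 1"
      using eventually_at_right_less[of 0] by eventually_elim (use that in auto)
  qed auto
  have "((\<lambda>t. polylog s (exp (- of_real t)) - 2 powr (1 - s) * polylog s (exp (- (2 * of_real t)))) \<longlongrightarrow>
      polylog s 1 - 2 powr (1 - s) * polylog s 1) (at_right 0)"
    using lim[of 1] lim[of 2] by (intro tendsto_diff tendsto_mult tendsto_const) auto
  moreover have "\<forall>\<^sub>F t in at_right 0. polylog s (exp (- of_real t)) - 2 powr (1 - s) * polylog s (exp (- (2 * of_real t))) = eta_exp s (of_real t)"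
    using eventually_at_right_less[of 0] by eventually_elim (rule polylog_exp_duplication)
  ultimately have "((\<lambda>t. eta_exp s (of_real t)) \<longlongrightarrow> polylog s 1 - 2 powr (1 - s) * polylog s 1) (at_right 0)"
    by (simp add: tendsto_cong)
  moreover have "isCont (eta_exp s) 0"
    by (rule DERIV_isCont[OF has_field_derivative_eta_exp]) auto
  hence "((\<lambda>t. eta_exp s (complex_of_real t)) \<longlongrightarrow> eta_exp s (of_real 0)) (at_right 0)"
    by (intro isCont_tendsto_compose[of _ "eta_exp s"] tendsto_of_real) (auto simp: tendsto_ident_at)
  ultimately have "polylog s 1 - 2 powr (1 - s) * polylog s 1 = eta s"
    using tendsto_unique[OF trivial_limit_at_right_real] by (fastforce simp: eta_def)
  hence "zeta_eta s = polylog s 1"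
    using one_minus_two_powr_ne_0[of s] s by (simp add: zeta_eta_def field_simps)
  moreover have "((\<lambda>n. of_nat n powr (-s)) has_sum polylog s 1) UNIV"
    using summable_norm_zeta[OF s] unfolding polylog_def
    by (intro norm_summable_imp_has_sum) (auto intro!: summable_sums summable_norm_cancel[of "\<lambda>n. of_nat n powr (-s)"])
  hence "((\<lambda>n. of_nat n powr (-s)) has_sum polylog s 1) {1::nat..}"
    by (rule has_sum_cong_neutral[THEN iffD1, rotated -1]) auto
  ultimately show ?thesis
    by (simp add: infsumI)
qed

lemma analytic_zeta_eta: "zeta_eta analytic_on {s. Re s \<noteq> 1}"
proof -
  have "open {s. Re s \<noteq> 1}"
    by (intro open_Collect_neq continuous_intros)
  thus ?thesis
    using holomorphic_zeta_eta by (simp add: analytic_on_open)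
qed

lemma zeta_eq_zeta_eta:
  assumes "Re s \<noteq> 1"
  shows "zeta s = zeta_eta s"
proof -
  have "eta analytic_on UNIV"
    using holomorphic_eta[of "\<lambda>s. s" UNIV] by (simp add: analytic_on_open holomorphic_on_ident)
  moreover have "(\<lambda>s. 1 - 2 powr (1 - s)) analytic_on (UNIV :: complex set)"
    by (intro analytic_intros) auto
  ultimately have mero: "zeta_eta meromorphic_on UNIV"
    unfolding zeta_eta_def[abs_def] by (intro meromorphic_intros analytic_on_imp_meromorphic_on)
  have rem: "remove_sings zeta_eta s = zeta_eta s" if "Re s \<noteq> 1" for s
    using that analytic_on_subset[OF analytic_zeta_eta, of "{s}"] by (intro remove_sings_at_analytic) auto
  let ?f = "\<lambda>s. \<Sum>\<^sub>\<infinity>n\<in>{1::nat..}. of_nat n powr (-s)"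
  have "is_meromorphic_continuation {s. Re s > 1} ?f (remove_sings zeta_eta)"
    unfolding is_meromorphic_continuation_def
    using remove_sings_nicely_meromorphic[OF mero] by (auto simp: rem zeta_eta_eq)
  moreover from this have "F = remove_sings zeta_eta" if "is_meromorphic_continuation {s. Re s > 1} ?f F" for F
    using that is_meromorphic_continuation_unique[OF open_halfspace_Re_gt[of 1]]
    by (metis (mono_tags, lifting) empty_iff mem_Collect_eq one_complex.sel(1) plus_complex.sel(1) less_add_one)
  ultimately have "zeta = remove_sings zeta_eta"
    unfolding zeta_def meromorphic_continuation_def by (rule the_equality)
  thus ?thesis
    using rem[OF assms] by simp
qed

text \<open>All terms of the Euler series have nonnegative real part, and the term k = 0 equals
  1/2.\<close>

lemma eta_half_ne_0: "eta (1 / 2) \<noteq> 0"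
proof -
  have sums: "(\<lambda>k. power_diff k (of_real (1 / 2)) * (1 / 2) ^ Suc k) sums eta (1 / 2)"
    using summable_sums[OF summable_norm_cancel[OF summable_norm_euler_sum[of "1 / 2" "1 / 2"]]]
    by (simp add: eta_def eta_exp_def euler_sum_def)
  have eq: "Re (power_diff k (of_real (1 / 2)) * (1 / 2) ^ Suc k) = Re (power_diff k (of_real (1 / 2))) * (1 / 2) ^ Suc k" for k
  proof -
    have "(1 / 2) ^ Suc k = complex_of_real ((1 / 2) ^ Suc k)"
      by simp
    thus ?thesis
      by (simp only: Re_complex_of_real times_complex.sel Im_complex_of_real mult_zero_right diff_zero)
  qed
  have "(\<lambda>k. Re (power_diff k (of_real (1 / 2))) * (1 / 2) ^ Suc k) sums Re (eta (1 / 2))"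
    using sums_Re[OF sums] unfolding eq .
  moreover have "(\<Sum>k\<in>{0}. Re (power_diff k (of_real (1 / 2))) * (1 / 2) ^ Suc k) \<le> 
      (\<Sum>k. Re (power_diff k (of_real (1 / 2))) * (1 / 2) ^ Suc k)"
  proof (rule sum_le_suminf)
    show "0 \<le> Re (power_diff k (of_real (1 / 2))) * (1 / 2) ^ Suc k" for k
      by (intro mult_nonneg_nonneg power_diff_nonneg) auto
  qed (use calculation in \<open>auto simp: sums_iff\<close>)
  ultimately have "Re (eta (1 / 2)) > 0"
    by (simp add: sums_iff power_diff_def)
  thus ?thesis by auto
qed

lemma zeta_eta_half_ne_0: "zeta_eta (1 / 2) \<noteq> 0"
  using eta_half_ne_0 one_minus_two_powr_ne_0[of "1 / 2"] by (simp add: zeta_eta_def)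

subsection \<open>The functional equation\<close>

lemma summable_on_abs_int_powr:
  fixes a :: real
  assumes a: "a < -1"
  shows "(\<lambda>k::int. \<bar>of_int k\<bar> powr a) summable_on UNIV"
proof -
  have nat: "(\<lambda>n. real n powr a) summable_on UNIV"
    by (subst summable_on_UNIV_nonneg_real_iff) (use a in \<open>auto simp: summable_real_powr_iff\<close>)
  have "(\<lambda>k::int. \<bar>of_int k\<bar> powr a) summable_on {0..}"
    by (rule summable_on_reindex_bij_witness[of UNIV nat int "{0..}" "\<lambda>k::int. \<bar>of_int k\<bar> powr a" "\<lambda>n. real n powr a", THEN iffD1])
       (use nat in auto)
  moreover have "(\<lambda>k::int. \<bar>of_int k\<bar> powr a) summable_on {..0}"
    by (rule summable_on_reindex_bij_witness[of UNIV "\<lambda>k. nat (-k)" "\<lambda>n. - int n" "{..0}" "\<lambda>k::int. \<bar>of_int k\<bar> powr a" "\<lambda>n. real n powr a", THEN iffD1])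
       (use nat in auto)
  hence "(\<lambda>k::int. \<bar>of_int k\<bar> powr a) summable_on {..<0}"
    by (rule summable_on_subset_banach) auto
  ultimately have "(\<lambda>k::int. \<bar>of_int k\<bar> powr a) summable_on ({0..} \<union> {..<0})"
    by (rule summable_on_Un_disjoint) auto
  also have "{0..} \<union> {..<0} = (UNIV :: int set)"
    by auto
  finally show ?thesis .
qed

text \<open>The terms of Lipschitz's formula, which expresses \<open>polylog s (exp (- t))\<close>
  as \<open>Gamma (1 - s)\<close> times their sum. For \<open>Re t > 0\<close> all bases lie in the
  right half-plane, and at \<open>t = 0\<close> those with nonzero \<open>k\<close> lie on the
  imaginary axis, so the principal branch stays clear of its cut.\<close>

definition lattice_term :: "real \<Rightarrow> complex \<Rightarrow> int \<Rightarrow> complex" where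
  "lattice_term s t k = (t + 2 * of_real pi * \<i> * of_int k) powr (of_real s - 1)"

definition lattice_sum :: "real \<Rightarrow> complex \<Rightarrow> complex" where
  "lattice_sum s t = (\<Sum>\<^sub>\<infinity>k. lattice_term s t k)"

lemma norm_lattice_term: "norm (lattice_term s t k) = norm (t + 2 * of_real pi * \<i> * of_int k) powr (s - 1)"
  unfolding lattice_term_def by (subst norm_powr_real_powr') (auto intro: Reals_diff)

text \<open>The imaginary part of the base has modulus at least \<open>2 * pi * |k| - pi\<close>,
  hence at least \<open>pi * |k|\<close>; the resulting majorant is independent of
  \<open>t\<close>.\<close>

lemma norm_lattice_term_le:
  assumes s: "s < 1" and t: "\<bar>Im t\<bar> \<le> pi" and k: "k \<noteq> 0"
  shows "norm (lattice_term s t k) \<le> pi powr (s - 1) * \<bar>of_int k\<bar> powr (s - 1)"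
proof -
  have "pi * \<bar>of_int k\<bar> \<le> \<bar>2 * pi * of_int k\<bar> - pi"
    using k pi_gt_zero by (simp add: abs_mult)
  also have "\<dots> \<le> \<bar>Im (t + 2 * of_real pi * \<i> * of_int k)\<bar>"
    using t by simp
  also have "\<dots> \<le> norm (t + 2 * of_real pi * \<i> * of_int k)"
    by (rule abs_Im_le_cmod)
  finally have "norm (lattice_term s t k) \<le> (pi * \<bar>of_int k\<bar>) powr (s - 1)"
    unfolding norm_lattice_term using s k by (intro powr_mono2') auto
  thus ?thesis
    by (simp add: powr_mult)
qed

lemma lattice_term_shift: "lattice_term s (t + 2 * of_real pi * \<i> * of_int m) k = lattice_term s t (k + m)"
  by (simp add: lattice_term_def algebra_simps)

lemma ex_strip_representative:
  obtains t' m where "t = t' + 2 * of_real pi * \<i> * of_int m" "\<bar>Im t'\<bar> \<le> pi" "Re t' = Re t"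
proof
  define m where "m = round (Im t / (2 * pi))"
  define t' where "t' = t - 2 * of_real pi * \<i> * of_int m"
  show "t = t' + 2 * of_real pi * \<i> * of_int m" "Re t' = Re t"
    by (simp_all add: t'_def)
  have "\<bar>Im t / (2 * pi) - of_int m\<bar> \<le> 1 / 2"
    unfolding m_def using of_int_round_abs_le[of "Im t / (2 * pi)"] by linarith
  hence "\<bar>Im t / (2 * pi) - of_int m\<bar> * (2 * pi) \<le> pi"
    using mult_right_mono[of _ "1 / 2" "2 * pi"] by simp
  also have "\<bar>Im t / (2 * pi) - of_int m\<bar> * (2 * pi) = \<bar>(Im t / (2 * pi) - of_int m) * (2 * pi)\<bar>"
    by (simp add: abs_mult)
  also have "(Im t / (2 * pi) - of_int m) * (2 * pi) = Im t'"
    by (simp add: t'_def field_simps)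
  finally show "\<bar>Im t'\<bar> \<le> pi" .
qed

lemma abs_summable_lattice_term:
  assumes s: "s < 0"
  shows "(\<lambda>k. norm (lattice_term s t k)) summable_on UNIV"
proof -
  obtain t' m where t': "t = t' + 2 * of_real pi * \<i> * of_int m" "\<bar>Im t'\<bar> \<le> pi"
    using ex_strip_representative[of t] by metis
  have "(\<lambda>k::int. pi powr (s - 1) * \<bar>of_int k\<bar> powr (s - 1)) summable_on UNIV"
    using s by (intro summable_on_cmult_right summable_on_abs_int_powr) auto
  hence "(\<lambda>k::int. pi powr (s - 1) * \<bar>of_int k\<bar> powr (s - 1)) summable_on (-{0})"
    by (rule summable_on_subset_banach) auto
  hence "(\<lambda>k. norm (lattice_term s t' k)) summable_on (-{0})"
    by (rule Infinite_Sum.abs_summable_on_comparison_test') (use t' s in \<open>auto intro!: norm_lattice_term_le\<close>)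
  hence "(\<lambda>k. norm (lattice_term s t' k)) summable_on insert 0 (-{0})"
    by (subst summable_on_insert_iff)
  also have "insert 0 (-{0}) = (UNIV :: int set)"
    by auto
  finally have "(\<lambda>k. norm (lattice_term s t' k)) summable_on UNIV" .
  moreover have "bij (\<lambda>k::int. k + m)"
    by (rule bij_betwI[of _ _ _ "\<lambda>k. k - m"]) auto
  ultimately have "(\<lambda>k. norm (lattice_term s t' (k + m))) summable_on UNIV"
    by (subst summable_on_reindex_bij_betw[of "\<lambda>k. k + m" UNIV UNIV "\<lambda>k. norm (lattice_term s t' k)"]) auto
  thus ?thesis
    unfolding t'(1) lattice_term_shift .
qed

lemma summable_lattice_term:
  assumes "s < 0"
  shows "lattice_term s t summable_on A"
  using abs_summable_summable[OF abs_summable_lattice_term[OF assms]] by (rule summable_on_subset_banach) auto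

lemma lattice_sum_shift: "lattice_sum s (t + 2 * of_real pi * \<i> * of_int m) = lattice_sum s t"
proof -
  have "bij (\<lambda>k::int. k + m)"
    by (rule bij_betwI[of _ _ _ "\<lambda>k. k - m"]) auto
  thus ?thesis
    unfolding lattice_sum_def lattice_term_shift by (rule infsum_reindex_bij_betw)
qed

text \<open>The two shifted lattices with step \<open>2 * pi * i\<close> together form the lattice
  through \<open>t\<close> with step \<open>pi * i\<close>, which is half of the lattice belonging
  to \<open>2 * t\<close>. Even and odd indices separate them again.\<close>

lemma lattice_sum_duplication:
  assumes s: "s < 0"
  shows "lattice_sum s t + lattice_sum s (t + of_real pi * \<i>) = of_real (2 powr (1 - s)) * lattice_sum s (2 * t)"
proof -
  define h where "h = (\<lambda>k::int. of_real (2 powr (1 - s)) * lattice_term s (2 * t) k)"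
  have h: "h summable_on A" for A
    unfolding h_def by (intro summable_on_cmult_right summable_lattice_term s)
  have h_eq: "h k = (t + of_real pi * \<i> * of_int k) powr (of_real s - 1)" for k
  proof -
    have "lattice_term s (2 * t) k = (2 * (t + of_real pi * \<i> * of_int k)) powr (of_real s - 1)"
      by (simp add: lattice_term_def algebra_simps)
    also have "\<dots> = 2 powr (of_real s - 1) * (t + of_real pi * \<i> * of_int k) powr (of_real s - 1)"
      by (rule powr_times_real_left) auto
    also have "2 powr (of_real s - 1) = complex_of_real (2 powr (s - 1))"
      using powr_of_real_minus_one[of 2 s] by simp
    finally have "h k = of_real (2 powr (1 - s) * 2 powr (s - 1)) * (t + of_real pi * \<i> * of_int k) powr (of_real s - 1)"
      by (simp add: h_def)
    thus ?thesis
      by (simp flip: powr_add)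
  qed
  have "infsum h ({k. even k} \<union> {k. odd k}) = infsum h {k. even k} + infsum h {k. odd k}"
    by (rule infsum_Un_disjoint) (auto intro: h)
  also have "{k. even k} \<union> {k. odd k} = (UNIV :: int set)"
    by auto
  also have "infsum h {k. even k} = lattice_sum s t"
    unfolding lattice_sum_def
    by (rule infsum_reindex_bij_witness[of _ "\<lambda>k. 2 * k" "\<lambda>k. k div 2"])
       (auto simp: h_eq lattice_term_def algebra_simps elim!: evenE)
  also have "infsum h {k. odd k} = lattice_sum s (t + of_real pi * \<i>)"
    unfolding lattice_sum_def
    by (rule infsum_reindex_bij_witness[of _ "\<lambda>k. 2 * k + 1" "\<lambda>k. k div 2"])
       (auto simp: h_eq lattice_term_def algebra_simps elim!: oddE)
  also have "infsum h UNIV = of_real (2 powr (1 - s)) * lattice_sum s (2 * t)"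
    unfolding h_def lattice_sum_def by (rule infsum_cmult_right')
  finally show ?thesis by simp
qed

lemma diff_mult_add_diff_mult: "(p - c * l) + (q - c * m) = (p + q) - c * (l + m)"
  for c :: "'a :: comm_ring"
  by (simp add: algebra_simps)

text \<open>
  Herglotz's argument: the difference of the two sides is periodic and bounded on the right
  half-plane and satisfies the duplication formula, whose factor is contracting for negative \<open>s\<close>.
\<close>
lemma polylog_eq_lattice_sum:
  fixes s :: real and t :: complex
  assumes s: "s < 0" and t: "Re t > 0"
  shows "polylog (of_real s) (exp (- t)) = of_real (Gamma (1 - s)) * lattice_sum s t"
proof -
  define f where "f = (\<lambda>t. polylog (of_real s) (exp (- t)) - of_real (Gamma (1 - s)) * lattice_sum s t)"
  define \<Gamma> where "\<Gamma> = Gamma (1 - s)"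
  have \<Gamma>: "\<Gamma> > 0"
    unfolding \<Gamma>_def using s by (intro Gamma_real_pos) auto
  have \<Gamma>_eq: "Gamma (1 - complex_of_real s) = of_real \<Gamma>"
    using Gamma_complex_of_real[of "1 - s"] by (simp add: \<Gamma>_def)
  have f_shift: "f (t + 2 * of_real pi * \<i> * of_int m) = f t" for t m
  proof -
    have "exp (- (t + 2 * of_real pi * \<i> * of_int m)) = exp (- t)"
      by (subst exp_eq) (auto intro!: exI[of _ "-m"] simp: algebra_simps)
    thus ?thesis
      by (simp add: f_def lattice_sum_shift)
  qed
  have f_dup: "f t + f (t + of_real pi * \<i>) = of_real (2 powr (1 - s)) * f (2 * t)" if "Re t > 0" for t
  proof -
    have "exp (- (t + of_real pi * \<i>)) = - exp (- t)"
      by (simp add: exp_diff mult.commute[of _ \<i>])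
    moreover have "(exp (- t))\<^sup>2 = exp (- (2 * t))"
      by (simp flip: exp_double)
    moreover have "2 powr (1 - complex_of_real s) = of_real (2 powr (1 - s))"
      using powr_of_real[of 2 "1 - s"] by simp
    ultimately have 1: "polylog (of_real s) (exp (- t)) + polylog (of_real s) (exp (- (t + of_real pi * \<i>))) =
        of_real (2 powr (1 - s)) * polylog (of_real s) (exp (- (2 * t)))"
      using polylog_duplication[of "exp (- t)" "of_real s"] that by simp
    have "f t + f (t + of_real pi * \<i>) =
        (polylog (of_real s) (exp (- t)) + polylog (of_real s) (exp (- (t + of_real pi * \<i>)))) -
        of_real (Gamma (1 - s)) * (lattice_sum s t + lattice_sum s (t + of_real pi * \<i>))"
      unfolding f_def by (rule diff_mult_add_diff_mult)
    also have "\<dots> = of_real (2 powr (1 - s)) * f (2 * t)"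
      unfolding 1 lattice_sum_duplication[OF s] f_def by (simp only: right_diff_distrib mult.left_commute)
    finally show ?thesis .
  qed
  define S where "S = (\<Sum>\<^sub>\<infinity>k\<in>-{0::int}. pi powr (s - 1) * \<bar>of_int k\<bar> powr (s - 1))"
  have S_summable: "(\<lambda>k::int. pi powr (s - 1) * \<bar>of_int k\<bar> powr (s - 1)) summable_on -{0}"
    by (rule summable_on_subset_banach[of _ UNIV])
       (use s in \<open>auto intro!: summable_on_cmult_right summable_on_abs_int_powr\<close>)
  have "S \<ge> 0"
    unfolding S_def by (intro infsum_nonneg) auto
  have split: "lattice_sum s t = t powr (of_real s - 1) + (\<Sum>\<^sub>\<infinity>k\<in>-{0}. lattice_term s t k)" for t
  proof -
    have "lattice_sum s t = (\<Sum>\<^sub>\<infinity>k\<in>insert 0 (-{0}). lattice_term s t k)"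
      unfolding lattice_sum_def by (rule arg_cong[of _ _ "infsum _"]) auto
    also have "\<dots> = lattice_term s t 0 + (\<Sum>\<^sub>\<infinity>k\<in>-{0}. lattice_term s t k)"
      by (intro infsum_insert summable_lattice_term s) auto
    finally show ?thesis
      by (simp add: lattice_term_def)
  qed
  have S_bound: "norm (\<Sum>\<^sub>\<infinity>k\<in>-{0}. lattice_term s t k) \<le> S" if "\<bar>Im t\<bar> \<le> pi" for t
  proof -
    have abs: "(\<lambda>k. norm (lattice_term s t k)) summable_on -{0}"
      by (rule summable_on_subset_banach[OF abs_summable_lattice_term[OF s]]) auto
    hence "norm (\<Sum>\<^sub>\<infinity>k\<in>-{0}. lattice_term s t k) \<le> (\<Sum>\<^sub>\<infinity>k\<in>-{0}. norm (lattice_term s t k))"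
      by (rule norm_infsum_bound)
    also have "\<dots> \<le> S"
      unfolding S_def using that s by (intro infsum_mono abs S_summable norm_lattice_term_le) auto
    finally show ?thesis .
  qed
  \<comment> \<open>Three bounds for three regions of the half-strip. Near 0 the expansion cancels
    the singular lattice term. Further out, if \<open>Re t \<ge> 1 / 2\<close>, the point
    \<open>exp (- t)\<close> stays in a compact disc. In the rest
    \<open>Re (exp (- t)) \<le> 0\<close>, where Euler's transformation applies with an argument of
    norm at most 3/4.\<close>
  obtain B1 where B1: "\<And>t. norm t \<le> 9 / 5 \<Longrightarrow> norm (zeta_series (of_real s) t) \<le> B1"
  proof -
    have "continuous_on (cball 0 (9 / 5)) (zeta_series (of_real s))"
      by (rule holomorphic_on_imp_continuous_on[OF holomorphic_on_subset[OF holomorphic_zeta_series]]) (use s in auto)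
    hence "bounded (zeta_series (of_real s) ` cball 0 (9 / 5))"
      by (intro compact_imp_bounded compact_continuous_image) auto
    thus ?thesis
      using that by (force simp: bounded_iff)
  qed
  obtain B2 where B2: "\<And>z. norm z \<le> exp (- 1 / 2) \<Longrightarrow> norm (polylog (of_real s) z) \<le> B2"
  proof -
    have "exp (- 1 / 2) < (1 :: real)"
      by simp
    hence "cball 0 (exp (- 1 / 2)) \<subseteq> ball (0 :: complex) 1"
      by (simp only: cball_subset_ball_iff) auto
    hence "continuous_on (cball 0 (exp (- 1 / 2))) (polylog (of_real s))"
      by (intro holomorphic_on_imp_continuous_on[OF holomorphic_on_subset[OF holomorphic_polylog]]) auto
    hence "bounded (polylog (of_real s) ` cball 0 (exp (- 1 / 2)))"
      by (intro compact_imp_bounded compact_continuous_image) auto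
    thus ?thesis
      using that by (force simp: bounded_iff)
  qed
  obtain B3 where B3: "\<And>w. norm w \<le> 3 / 4 \<Longrightarrow> norm (euler_sum (of_real s) w) \<le> B3"
  proof -
    obtain C where C: "\<forall>\<^sub>F s' in nhds (of_real s). \<forall>w. norm w \<le> 3 / 4 \<longrightarrow> norm (euler_sum s' w) \<le> C"
      using euler_sum_locally_bounded[of "3 / 4" "of_real s"] by auto
    show ?thesis
      using that eventually_nhds_x_imp_x[OF C] by blast
  qed
  have "B1 \<ge> 0" "B2 \<ge> 0" "B3 \<ge> 0"
    using order_trans[OF norm_ge_zero B1[of 0]] order_trans[OF norm_ge_zero B2[of 0]]
      order_trans[OF norm_ge_zero B3[of 0]] by auto
  define B where "B = B1 + B2 + B3 + \<Gamma> * (1 + S)"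
  have bound_strip: "norm (f t) \<le> B" if t: "Re t > 0" "\<bar>Im t\<bar> \<le> pi" for t
  proof (cases "norm t \<le> 9 / 5")
    case True
    have "f t = zeta_series (of_real s) t - of_real \<Gamma> * (\<Sum>\<^sub>\<infinity>k\<in>-{0}. lattice_term s t k)"
      unfolding f_def split using polylog_expansion[of s t] s t True
      by (simp add: \<Gamma>_eq \<Gamma>_def algebra_simps)
    also have "norm \<dots> \<le> norm (zeta_series (of_real s) t) + norm (of_real \<Gamma> * (\<Sum>\<^sub>\<infinity>k\<in>-{0}. lattice_term s t k))"
      by (rule norm_triangle_ineq4)
    also have "\<dots> \<le> B1 + \<Gamma> * S"
      using \<Gamma> by (intro add_mono B1 True) (auto simp: norm_mult intro!: S_bound t)
    also have "\<dots> \<le> B"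
      using \<open>B2 \<ge> 0\<close> \<open>B3 \<ge> 0\<close> \<Gamma> by (simp add: B_def algebra_simps)
    finally show ?thesis .
  next
    case False
    have "norm (t powr (of_real s - 1)) = norm t powr (s - 1)"
      by (subst norm_powr_real_powr') auto
    also have "\<dots> \<le> norm t powr 0"
      using False s by (intro powr_mono) auto
    also have "\<dots> \<le> 1"
      using False by auto
    finally have L: "norm (lattice_sum s t) \<le> 1 + S"
      unfolding split by (intro order_trans[OF norm_triangle_ineq] add_mono S_bound t)
    have P: "norm (polylog (of_real s) (exp (- t))) \<le> B2 + B3"
    proof (cases "Re t \<ge> 1 / 2")
      case True
      thus ?thesis
        using B2[of "exp (- t)"] \<open>B3 \<ge> 0\<close> by auto
    next
      case re: False
      define z where "z = exp (- t)"
      \<comment> \<open>The radius 9/5 is below 2, yet large enough: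
        \<open>3.24 - 0.25 > 2.89\<close>, the square of 17/10, and
        \<open>17 / 10 > pi / 2\<close>.\<close>
      have "(Re t)\<^sup>2 \<le> (1 / 2)\<^sup>2"
        using re t by (intro power_mono) auto
      moreover have "(norm t)\<^sup>2 > (9 / 5)\<^sup>2"
        using False by (intro power_strict_mono) auto
      ultimately have "(Im t)\<^sup>2 > (17 / 10)\<^sup>2"
        unfolding cmod_power2 by (simp add: power2_eq_square)
      hence "\<not> \<bar>Im t\<bar> \<le> \<bar>17 / 10\<bar>"
        unfolding abs_le_square_iff by linarith
      hence "\<bar>Im t\<bar> > 17 / 10"
        by simp
      hence "\<bar>Im t\<bar> > pi / 2"
        using pi_approx by simp
      hence "cos (pi - \<bar>Im t\<bar>) \<ge> 0"
        using t by (intro cos_ge_zero) auto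
      hence "cos \<bar>Im t\<bar> \<le> 0"
        by simp
      hence z1: "Re z \<le> 0"
        by (simp add: z_def Re_exp mult_le_0_iff)
      have z2: "norm z < 1"
        using t by (simp add: z_def)
      have "norm (1 - z) \<ge> 1"
        using z1 complex_Re_le_cmod[of "1 - z"] by simp
      \<comment> \<open>From \<open>Re z \<le> 0\<close> the square of \<open>norm (1 - z)\<close>
        is at least 1 plus that of \<open>norm z\<close>. So the quotient of the norms stays below
        \<open>1 / sqrt 2\<close>, and 3/4 is a convenient rational above it.\<close>
      have "16 * (norm z)\<^sup>2 \<le> 9 * (norm (1 - z))\<^sup>2"
      proof -
        have "(norm (1 - z))\<^sup>2 = 1 - 2 * Re z + (norm z)\<^sup>2"
          unfolding cmod_power2 by (simp add: power2_eq_square algebra_simps)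
        moreover have "(norm z)\<^sup>2 \<le> 1"
          using z2 by (intro power_le_one) auto
        ultimately show ?thesis
          using z1 by linarith
      qed
      hence "(4 * norm z)\<^sup>2 \<le> (3 * norm (1 - z))\<^sup>2"
        by (simp add: power_mult_distrib)
      hence "4 * norm z \<le> 3 * norm (1 - z)"
        by (rule power2_le_imp_le) auto
      hence "norm (- z / (1 - z)) \<le> 3 / 4"
        using \<open>norm (1 - z) \<ge> 1\<close> by (auto simp: norm_divide divide_le_eq)
      hence "norm (euler_sum (of_real s) (- z / (1 - z))) \<le> B3"
        by (rule B3)
      moreover have "polylog (of_real s) z = - euler_sum (of_real s) (- z / (1 - z))"
        using z1 z2 by (intro polylog_eq_euler_sum) auto
      ultimately show ?thesis
        using \<open>B2 \<ge> 0\<close> by (simp add: z_def)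
    qed
    have "norm (f t) \<le> norm (polylog (of_real s) (exp (- t))) + norm (of_real \<Gamma> * lattice_sum s t)"
      unfolding f_def \<Gamma>_def by (rule norm_triangle_ineq4)
    also have "\<dots> \<le> (B2 + B3) + \<Gamma> * (1 + S)"
      using \<Gamma> L P by (intro add_mono) (auto simp: norm_mult)
    also have "\<dots> \<le> B"
      using \<open>B1 \<ge> 0\<close> by (simp add: B_def)
    finally show ?thesis .
  qed
  have bound: "norm (f t) \<le> B" if "Re t > 0" for t
  proof -
    obtain t' m where t': "t = t' + 2 * of_real pi * \<i> * of_int m" "\<bar>Im t'\<bar> \<le> pi" "Re t' = Re t"
      using ex_strip_representative[of t] by metis
    show ?thesis
      unfolding t'(1) f_shift using t' that by (intro bound_strip) auto
  qed
  \<comment> \<open>Going back to \<open>t / 2\<close> involves two values of \<open>f\<close>: a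
    bound \<open>b\<close> on the half-plane improves to
    \<open>2 * b / 2 powr (1 - s) = 2 powr s * b\<close>, and \<open>2 powr s < 1\<close>.\<close>
  have "norm (f t) \<le> (2 powr s) ^ m * B" if "Re t > 0" for m t
    using that
  proof (induction m arbitrary: t)
    case (Suc m)
    have "of_real (2 powr (1 - s)) * f t = f (t / 2) + f (t / 2 + of_real pi * \<i>)"
      using f_dup[of "t / 2"] Suc.prems by simp
    hence "2 powr (1 - s) * norm (f t) = norm (f (t / 2) + f (t / 2 + of_real pi * \<i>))"
      by (metis norm_mult norm_of_real abs_of_nonneg powr_ge_zero)
    also have "\<dots> \<le> (2 powr s) ^ m * B + (2 powr s) ^ m * B"
      using Suc.prems by (intro order_trans[OF norm_triangle_ineq] add_mono Suc.IH) auto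
    finally have "2 powr (1 - s) * norm (f t) \<le> 2 * ((2 powr s) ^ m * B)"
      by (simp only: mult_2)
    hence "2 powr s / 2 * (2 powr (1 - s) * norm (f t)) \<le> 2 powr s / 2 * (2 * ((2 powr s) ^ m * B))"
      by (rule mult_left_mono) auto
    moreover have "2 powr s * 2 powr (1 - s) = (2 :: real)"
      by (simp flip: powr_add)
    hence "2 powr s / 2 * (2 powr (1 - s) * norm (f t)) = norm (f t)"
      by (simp add: mult.assoc[symmetric])
    ultimately show ?case
      by (simp only:) simp
  qed (use bound in auto)
  hence "norm (f t) \<le> (2 powr s) ^ m * B" for m
    using t by blast
  moreover have "(\<lambda>m. (2 powr s) ^ m * B) \<longlonglongrightarrow> 0 * B"
    using s powr_less_one[of 2 s] by (intro tendsto_intros LIMSEQ_power_zero) auto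
  ultimately have "norm (f t) \<le> 0"
    by (intro LIMSEQ_le_const[of "\<lambda>m. (2 powr s) ^ m * B"]) auto
  thus ?thesis
    by (simp add: f_def)
qed

text \<open>The singular term of the expansion is the term k = 0 of the lattice sum. Once it is
  cancelled, both sides of Lipschitz's formula extend continuously to t = 0, where the power series
  takes the value \<open>zeta_eta s\<close>. This is the functional equation.\<close>

lemma zeta_eta_eq_lattice_sum:
  fixes s :: real
  assumes s: "s < 0"
  shows "zeta_eta (of_real s) = of_real (Gamma (1 - s)) * (\<Sum>\<^sub>\<infinity>k\<in>-{0}. lattice_term s 0 k)"
proof -
  define h where "h = (\<lambda>t. \<Sum>\<^sub>\<infinity>k\<in>-{0}. lattice_term s (of_real t) k)"
  have \<Gamma>_eq: "Gamma (1 - complex_of_real s) = of_real (Gamma (1 - s))"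
    using Gamma_complex_of_real[of "1 - s"] by simp
  have "continuous_on {0..} h"
  proof (rule uniform_limit_theorem)
    show "uniform_limit {0..} (\<lambda>X t. \<Sum>k\<in>X. lattice_term s (of_real t) k) h (finite_subsets_at_top (-{0}))"
      unfolding h_def
    proof (rule Weierstrass_m_test_general)
      show "(\<lambda>k::int. pi powr (s - 1) * \<bar>of_int k\<bar> powr (s - 1)) summable_on -{0}"
        by (rule summable_on_subset_banach[of _ UNIV])
           (use s in \<open>auto intro!: summable_on_cmult_right summable_on_abs_int_powr\<close>)
    qed (use s in \<open>auto intro!: norm_lattice_term_le\<close>)
    show "\<forall>\<^sub>F X in finite_subsets_at_top (-{0}). continuous_on {0..} (\<lambda>t. \<Sum>k\<in>X. lattice_term s (of_real t) k)"
    proof (rule eventually_finite_subsets_at_top_weakI)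
      fix X assume "X \<subseteq> -{0 :: int}"
      thus "continuous_on {0..} (\<lambda>t. \<Sum>k\<in>X. lattice_term s (of_real t) k)"
        unfolding lattice_term_def by (auto intro!: continuous_intros simp: complex_nonpos_Reals_iff complex_eq_iff)
    qed
  qed auto
  hence "(h \<longlongrightarrow> h 0) (at 0 within {0..})"
    by (simp add: continuous_on_def)
  hence h: "((\<lambda>t. of_real (Gamma (1 - s)) * h t) \<longlongrightarrow> of_real (Gamma (1 - s)) * h 0) (at_right 0)"
    by (intro tendsto_mult tendsto_const) (rule tendsto_within_subset, auto)
  have "\<forall>\<^sub>F t in at_right (0::real). t \<in> {0<..<2}"
    by (rule eventually_at_right_real) auto
  hence "\<forall>\<^sub>F t in at_right 0. zeta_series (of_real s) (of_real t) = of_real (Gamma (1 - s)) * h t"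
  proof eventually_elim
    case (elim t)
    have "lattice_sum s (of_real t) = (\<Sum>\<^sub>\<infinity>k\<in>insert 0 (-{0}). lattice_term s (of_real t) k)"
      unfolding lattice_sum_def by (rule arg_cong[of _ _ "infsum _"]) auto
    also have "\<dots> = of_real t powr (of_real s - 1) + h t"
      unfolding h_def by (subst infsum_insert) (auto simp: lattice_term_def[of _ _ 0] intro!: summable_lattice_term s)
    finally show ?case
      using polylog_eq_lattice_sum[of s "of_real t"] polylog_expansion[of s "of_real t"] s elim
      by (simp add: \<Gamma>_eq algebra_simps)
  qed
  with h have "((\<lambda>t. zeta_series (of_real s) (of_real t)) \<longlongrightarrow> of_real (Gamma (1 - s)) * h 0) (at_right 0)"
    by (simp add: tendsto_cong)
  moreover have "isCont (zeta_series (of_real s)) 0"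
    using has_field_derivative_zeta_series[of "of_real s" 0] s by (intro DERIV_isCont) auto
  hence "((\<lambda>t. zeta_series (of_real s) (complex_of_real t)) \<longlongrightarrow> zeta_series (of_real s) (of_real 0)) (at_right 0)"
    by (intro isCont_tendsto_compose[of _ "zeta_series (of_real s)"] tendsto_of_real) (auto simp: tendsto_ident_at)
  ultimately have "zeta_series (of_real s) 0 = of_real (Gamma (1 - s)) * h 0"
    using tendsto_unique[OF trivial_limit_at_right_real] by fastforce
  moreover have "zeta_series (of_real s) 0 = zeta_eta (of_real s)"
    unfolding zeta_series_def powser_zero by (simp add: zeta_coeff_def)
  ultimately show ?thesis
    by (simp add: h_def)
qed

text \<open>At t = 0 all bases lie on the imaginary axis, so the real parts of the terms are
  positive multiples of one cosine and cannot cancel. The cosine vanishes exactly at even integers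
  \<open>s\<close>, where for negative \<open>s\<close> zeta has its trivial zeros.\<close>

lemma zeta_eta_ne_0:
  fixes s :: real
  assumes s: "s < 0" and cos: "cos (pi * (s - 1) / 2) \<noteq> 0"
  shows "zeta_eta (of_real s) \<noteq> 0"
proof -
  have Re: "Re (lattice_term s 0 k) = (2 * pi * \<bar>of_int k\<bar>) powr (s - 1) * cos (pi * (s - 1) / 2)" if k: "k \<noteq> 0" for k
  proof -
    define y where "y = 2 * pi * of_int k"
    have y: "y \<noteq> 0"
      using k by (simp add: y_def)
    \<comment> \<open>The argument is \<open>pi / 2\<close> or \<open>- pi / 2\<close> according to
      the sign of \<open>y\<close>; since the cosine is even, both signs give the same real
      part.\<close>
    have eq: "Ln (\<i> * of_real y) = of_real (ln \<bar>y\<bar>) + \<i> * of_real (sgn y * pi / 2)"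
    proof (cases "y > 0")
      case True
      thus ?thesis
        using Ln_times_of_real[of y \<i>] by (simp add: mult.commute Ln_of_real)
    next
      case False
      hence "Ln (complex_of_real (-y)) = of_real (ln (-y))"
        using y by (intro Ln_of_real) auto
      moreover have "Ln (of_real (-y) * (-\<i>)) = Ln (of_real (-y)) + Ln (-\<i>)"
        using y False by (subst Ln_times_of_real) auto
      ultimately show ?thesis
        using y False by (simp add: mult.commute)
    qed
    have "lattice_term s 0 k = (\<i> * of_real y) powr of_real (s - 1)"
      by (simp add: lattice_term_def y_def mult_ac)
    also have "\<dots> = exp (of_real (s - 1) * (of_real (ln \<bar>y\<bar>) + \<i> * of_real (sgn y * pi / 2)))"
      using y eq by (simp add: powr_def)
    also have "Re \<dots> = exp ((s - 1) * ln \<bar>y\<bar>) * cos ((s - 1) * (sgn y * pi / 2))"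
      by (simp add: Re_exp)
    also have "cos ((s - 1) * (sgn y * pi / 2)) = cos (pi * (s - 1) / 2)"
      using y by (cases "y > 0") (auto simp: mult_ac)
    also have "exp ((s - 1) * ln \<bar>y\<bar>) = (2 * pi * \<bar>of_int k\<bar>) powr (s - 1)"
      using y by (simp add: powr_def y_def abs_mult)
    finally show ?thesis .
  qed
  have summable: "(\<lambda>k::int. (2 * pi * \<bar>of_int k\<bar>) powr (s - 1)) summable_on -{0}"
    unfolding powr_mult using s
    by (intro summable_on_subset_banach[of _ UNIV "-{0}"] summable_on_cmult_right summable_on_abs_int_powr) auto
  define S where "S = (\<Sum>\<^sub>\<infinity>k\<in>-{0::int}. (2 * pi * \<bar>of_int k\<bar>) powr (s - 1))"
  have "0 < (2 * pi) powr (s - 1)"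
    by simp
  also have "\<dots> = (\<Sum>k\<in>{1::int}. (2 * pi * \<bar>of_int k\<bar>) powr (s - 1))"
    by simp
  also have "\<dots> \<le> S"
    unfolding S_def by (intro finite_sum_le_infsum summable) auto
  finally have "S > 0" .
  have "Re (\<Sum>\<^sub>\<infinity>k\<in>-{0}. lattice_term s 0 k) = (\<Sum>\<^sub>\<infinity>k\<in>-{0}. Re (lattice_term s 0 k))"
    by (intro infsum_Re[symmetric] summable_lattice_term s)
  also have "\<dots> = (\<Sum>\<^sub>\<infinity>k\<in>-{0::int}. (2 * pi * \<bar>of_int k\<bar>) powr (s - 1) * cos (pi * (s - 1) / 2))"
    by (intro infsum_cong Re) auto
  also have "\<dots> = S * cos (pi * (s - 1) / 2)"
    unfolding S_def by (rule infsum_cmult_left')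
  finally have "Re (\<Sum>\<^sub>\<infinity>k\<in>-{0}. lattice_term s 0 k) \<noteq> 0"
    using cos \<open>S > 0\<close> by simp
  hence "(\<Sum>\<^sub>\<infinity>k\<in>-{0}. lattice_term s 0 k) \<noteq> 0"
    by auto
  moreover have "Gamma (1 - s) > 0"
    using s by (intro Gamma_real_pos) auto
  ultimately show ?thesis
    unfolding zeta_eta_eq_lattice_sum[OF s] by simp
qed

text \<open>The points \<open>(1/2 - k) - 2 * k\<close> at which the residues involve zeta. For
  \<open>k > 0\<close> they are negative and never even integers; \<open>k = 0\<close> lies outside
  the range of the lattice formula and is settled by positivity.\<close>

lemma zeta_eta_half_minus_ne_0: "zeta_eta (1 / 2 - 3 * of_nat k) \<noteq> 0"
proof (cases "k = 0")
  case True
  thus ?thesis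
    using zeta_eta_half_ne_0 by simp
next
  case False
  define s :: real where "s = 1 / 2 - 3 * of_nat k"
  have "cos (pi * (s - 1) / 2) \<noteq> 0"
  proof
    assume "cos (pi * (s - 1) / 2) = 0"
    then obtain i where "odd i" "pi * (s - 1) / 2 = of_int i * (pi / 2)"
      by (auto simp: cos_zero_iff_int)
    hence "pi * (s - 1) = pi * of_int i"
      by simp
    hence "s - 1 = of_int i"
      by simp
    hence "of_int (2 * i) = (of_int (- 1 - 6 * int k) :: real)"
      by (simp add: s_def field_simps)
    hence "2 * i = - 1 - 6 * int k"
      by (simp only: of_int_eq_iff)
    thus False
      by presburger
  qed
  moreover have "s < 0"
    using False by (simp add: s_def)
  ultimately have "zeta_eta (of_real s) \<noteq> 0"
    by (intro zeta_eta_ne_0)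
  thus ?thesis
    by (simp add: s_def)
qed

subsection \<open>A quadratic identity for Bernoulli numbers\<close>

lemma polylog_0:
  assumes "norm z < 1"
  shows "polylog 0 z = z / (1 - z)"
proof -
  have "(\<lambda>n. of_nat (Suc n) powr (-0) * z ^ Suc n) sums (z * (1 / (1 - z)))"
    using sums_mult[OF geometric_sums[OF assms], of z] by (simp del: of_nat_Suc)
  hence "(\<lambda>n. of_nat n powr (-0) * z ^ n) sums (z * (1 / (1 - z)))"
    by (subst (asm) sums_Suc_iff) simp
  thus ?thesis
    by (simp add: polylog_def sums_iff)
qed

text \<open>The Laurent series of \<open>1 / (exp t - 1)\<close> without its polar part.\<close>
definition bern :: "complex fps" where
  "bern = Abs_fps (\<lambda>n. zeta_coeff n 0)"

text \<open>At \<open>s = 0\<close> the polylogarithm is a geometric series with value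
  \<open>1 / (exp t - 1)\<close>. Hence \<open>zeta_coeff n 0\<close> is the Bernoulli number of
  index \<open>n + 1\<close> divided by \<open>fact (n + 1)\<close>. Clearing denominators gives a
  form valid at t = 0.\<close>

lemma zeta_series_0_eq:
  assumes "norm t < 2"
  shows "(exp t - 1) * (1 + t * zeta_series 0 t) = t"
proof -
  let ?f = "\<lambda>t. (exp t - 1) * (1 + t * zeta_series 0 t) - t"
  have "?f t = 0"
  proof (rule analytic_continuation[of ?f "ball 0 2" "complex_of_real ` {0<..<2}" 0])
    have "zeta_series 0 holomorphic_on ball 0 2"
      by (rule holomorphic_zeta_series) auto
    thus "?f holomorphic_on ball 0 2"
      by (intro holomorphic_intros)
    show "0 islimpt complex_of_real ` {0<..<2}"
      using islimpt_complex_of_real_Ioo[of 0 0 2] by simp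
    fix z assume "z \<in> complex_of_real ` {0<..<2}"
    then obtain x where x: "z = of_real x" "0 < x" "x < 2"
      by auto
    have "polylog 0 (exp (-z)) = 1 / z + zeta_series 0 z"
      using polylog_expansion_real[of 0 x] x by (simp add: powr_minus field_simps)
    moreover have "polylog 0 (exp (-z)) = exp (-z) / (1 - exp (-z))"
      using x by (intro polylog_0) auto
    moreover have "exp z \<noteq> 1"
      using x by (simp add: exp_of_real)
    moreover have "exp (-z) / (1 - exp (-z)) = 1 / (exp z - 1)"
      using \<open>exp z \<noteq> 1\<close> by (simp add: exp_minus divide_simps)
    ultimately have *: "1 / (exp z - 1) = 1 / z + zeta_series 0 z"
      by simp
    have "1 + z * zeta_series 0 z = z * (1 / z + zeta_series 0 z)"
      using x by (simp add: distrib_left)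
    hence "1 + z * zeta_series 0 z = z / (exp z - 1)"
      unfolding *[symmetric] by simp
    thus "?f z = 0"
      using \<open>exp z \<noteq> 1\<close> by simp
  qed (use assms in auto)
  thus ?thesis
    by simp
qed

lemma bern_fps: "(fps_exp 1 - 1) * (1 + fps_X * bern) = fps_X"
proof -
  have "zeta_series 0 has_fps_expansion bern"
  proof (rule has_fps_expansionI)
    have "\<forall>\<^sub>F t in nhds (0 :: complex). t \<in> ball 0 2"
      by (intro eventually_nhds_in_open) auto
    thus "\<forall>\<^sub>F t in nhds 0. (\<lambda>n. fps_nth bern n * t ^ n) sums zeta_series 0 t"
      by eventually_elim (use zeta_series_sums[of 0] in \<open>auto simp: bern_def\<close>)
  qed
  hence "(\<lambda>t. (exp t - 1) * (1 + t * zeta_series 0 t)) has_fps_expansion ((fps_exp 1 - 1) * (1 + fps_X * bern))"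
    by (intro fps_expansion_intros)
  also have "?this \<longleftrightarrow> (\<lambda>t. t) has_fps_expansion ((fps_exp 1 - 1) * (1 + fps_X * bern))"
  proof (rule has_fps_expansion_cong)
    have "\<forall>\<^sub>F t in nhds (0 :: complex). t \<in> ball 0 2"
      by (intro eventually_nhds_in_open) auto
    thus "\<forall>\<^sub>F t in nhds 0. (exp t - 1) * (1 + t * zeta_series 0 t) = t"
      by eventually_elim (use zeta_series_0_eq in auto)
  qed auto
  finally show ?thesis
    using fps_expansion_unique_complex has_fps_expansion_fps_X by blast
qed

text \<open>For nonzero \<open>c\<close>, the Laurent series of \<open>1 / (exp (c * t) - 1)\<close>
  without its polar part \<open>1 / (c * t)\<close>.\<close>

definition bern_scaled :: "complex \<Rightarrow> complex fps" where
  "bern_scaled c = bern oo (fps_const c * fps_X)"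

lemma bern_scaled_nth: "fps_nth (bern_scaled c) n = c ^ n * zeta_coeff n 0"
  by (simp add: bern_scaled_def fps_compose_linear bern_def)

lemma bern_scaled_fps: "(fps_exp c - 1) * (1 + fps_const c * fps_X * bern_scaled c) = fps_const c * fps_X"
proof -
  have "((fps_exp 1 - 1) * (1 + fps_X * bern)) oo (fps_const c * fps_X) = fps_X oo (fps_const c * fps_X)"
    by (simp only: bern_fps)
  thus ?thesis
    by (simp add: fps_compose_mult_distrib fps_compose_add_distrib fps_compose_sub_distrib bern_scaled_def
          fps_exp_compose_linear)
qed

lemma fps_exp_minus_1_ne_0: "c \<noteq> 0 \<Longrightarrow> fps_exp c - 1 \<noteq> (0 :: complex fps)"
proof
  assume "c \<noteq> 0" "fps_exp c - 1 = 0"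
  hence "fps_nth (fps_exp c - 1) 1 = 0"
    by (simp only: fps_zero_nth)
  thus False
    using \<open>c \<noteq> 0\<close> by simp
qed

text \<open>This is \<open>1 / (exp t - 1) + 1 / (exp (- t) - 1) = - 1\<close>, in which the polar
  parts cancel. It yields the constant coefficient and the vanishing of the other even ones.\<close>

lemma bern_reflect: "bern + bern_scaled (-1) = - 1"
proof -
  define E where "E = fps_exp (1 :: complex)"
  have E: "fps_exp (-1) * E = 1"
    using fps_exp_add_mult[of "-1" "1 :: complex"] by (simp add: E_def)
  have 1: "(E - 1) * (1 + fps_X * bern) = fps_X"
    using bern_fps by (simp add: E_def)
  have "E * ((fps_exp (-1) - 1) * (1 - fps_X * bern_scaled (-1))) = - (E * fps_X)"
    using bern_scaled_fps[of "-1"] by (simp add: fps_const_neg[symmetric] del: fps_const_neg)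
  moreover have "1 - E = E * (fps_exp (-1) - 1)"
    using E by (simp add: algebra_simps)
  ultimately have 2: "(1 - E) * (1 - fps_X * bern_scaled (-1)) = - (E * fps_X)"
    by (simp only: mult.assoc)
  have "(E - 1) * (fps_X * (bern + bern_scaled (-1) + 1)) =
      (E - 1) * (1 + fps_X * bern) + (1 - E) * (1 - fps_X * bern_scaled (-1)) + (E - 1) * fps_X"
    by (simp add: algebra_simps)
  also have "\<dots> = 0"
    unfolding 1 2 by (simp add: algebra_simps)
  finally have "(E - 1) * (fps_X * (bern + bern_scaled (-1) + 1)) = 0" .
  hence "bern + bern_scaled (-1) + 1 = 0"
    using fps_exp_minus_1_ne_0[of 1] by (simp add: E_def)
  thus ?thesis
    by (simp add: eq_neg_iff_add_eq_0)
qed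

lemma zeta_coeff_0_0: "zeta_coeff 0 0 = - 1 / 2"
proof -
  have "zeta_coeff 0 0 + zeta_coeff 0 0 = -1"
    using arg_cong[OF bern_reflect, of "\<lambda>F. fps_nth F 0"] by (simp add: bern_scaled_nth bern_def)
  hence "(zeta_coeff 0 0 + zeta_coeff 0 0) / 2 = -1 / 2"
    by simp
  thus ?thesis
    by simp
qed

lemma zeta_coeff_even_0:
  assumes "even n" "n > 0"
  shows "zeta_coeff n 0 = 0"
  using arg_cong[OF bern_reflect, of "\<lambda>F. fps_nth F n"] assms by (simp add: bern_scaled_nth bern_def)

lemma zeta_coeff_1_0: "zeta_coeff 1 0 = 1 / 12"
proof -
  \<comment> \<open>The cubic coefficient reads
    \<open>1 / 6 + zeta_coeff 0 0 / 2 + zeta_coeff 1 0 = 0\<close>.\<close>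
  have "fps_nth ((fps_exp 1 - 1) * (1 + fps_X * bern)) 3 = 0"
    unfolding bern_fps by simp
  thus ?thesis
    by (simp add: fps_mult_nth numeral_3_eq_3 bern_def zeta_coeff_0_0 fact_numeral field_simps)
qed

text \<open>Both coefficients are multiples of the zeta value at \<open>-(M + n)\<close>. Hence
  everything at a negative integer is expressed by Bernoulli coefficients.\<close>

lemma zeta_coeff_neg_nat:
  "zeta_coeff n (- of_nat M) = (-1) ^ M * (fact (M + n) / fact n) * zeta_coeff (M + n) 0"
proof -
  have "- of_nat M - of_nat n = (0 - of_nat (M + n) :: complex)"
    by simp
  moreover have "(-1) ^ M * (-1) ^ (M + n) = ((-1) ^ n :: complex)"
    by (simp add: power_add flip: mult.assoc power_mult_distrib)
  ultimately show ?thesis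
    by (simp add: zeta_coeff_def)
qed

text \<open>
  The addition theorem of the hyperbolic cotangent, in the form
  \<open>c x * c y + c y * c z + c z * c x = const\<close> for \<open>x + y + z = 0\<close>, with the polar parts cleared.
\<close>
lemma bern_addition:
  assumes xz: "x + z = 1" "x \<noteq> 0" "z \<noteq> 0"
  defines "G \<equiv> \<lambda>c. bern_scaled c + fps_const (1 / 2)"
  shows "fps_const (x * z) * fps_X * (G x * G z - G 1 * G x - G 1 * G z + fps_const (1 / 4)) =
           G 1 - fps_const (x\<^sup>2) * G x - fps_const (z\<^sup>2) * G z"
proof -
  define E where "E = (\<lambda>c :: complex. fps_exp c)"
  define u where "u = (\<lambda>c. 1 + fps_const c * fps_X * bern_scaled c)"
  define X where "X = (fps_X :: complex fps)"
  define a where "a = fps_const x"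
  define b where "b = fps_const z"
  have ab: "b = 1 - a"
  proof -
    have "z = 1 - x"
      using xz(1) by (metis add_diff_cancel_left')
    hence "b = fps_const 1 - fps_const x"
      by (simp only: b_def fps_const_sub)
    thus ?thesis
      by (simp only: a_def fps_const_1_eq_1)
  qed
  have E: "E x * E z = E 1"
    unfolding E_def using fps_exp_add_mult[of x z] xz(1) by metis
  have ux: "(E x - 1) * u x = a * X" and uz: "(E z - 1) * u z = b * X" and u1: "(E 1 - 1) * u 1 = X"
    using bern_scaled_fps[of x] bern_scaled_fps[of z] bern_scaled_fps[of 1]
    by (simp_all add: E_def u_def a_def b_def X_def)
  \<comment> \<open>With \<open>U c = 1 / (E c - 1)\<close> the relation
    \<open>E x * E z = E 1\<close> says \<open>U x * U z = U 1 * (1 + U x + U z)\<close>. Here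
    \<open>u c\<close> stands for \<open>c * X * U c\<close>, and all denominators are multiplied
    out so that they can be cancelled in the integral domain of power series.\<close>
  have "(E x - 1) * (E z - 1) * (E 1 - 1) * (u x * u z - u 1 * (a * b * X + b * u x + a * u z)) = 0"
  proof -
    have "(E x - 1) * (E z - 1) * (E 1 - 1) * (u x * u z - u 1 * (a * b * X + b * u x + a * u z)) =
        ((E x - 1) * u x) * ((E z - 1) * u z) * (E 1 - 1) -
        ((E 1 - 1) * u 1) * (a * b * X * (E x - 1) * (E z - 1) + b * ((E x - 1) * u x) * (E z - 1) + a * ((E z - 1) * u z) * (E x - 1))"
      by (simp add: algebra_simps)
    also have "\<dots> = 0"
      unfolding ux uz u1 unfolding E[symmetric] by (simp add: algebra_simps)
    finally show ?thesis .
  qed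
  hence *: "u x * u z = u 1 * (a * b * X + b * u x + a * u z)"
    using fps_exp_minus_1_ne_0[of x] fps_exp_minus_1_ne_0[of z] fps_exp_minus_1_ne_0[of 1] xz by (simp add: E_def)
  \<comment> \<open>Adding 1/2 turns \<open>1 / (exp t - 1)\<close> into half the hyperbolic
    cotangent of \<open>t / 2\<close>. The elimination below knows \<open>h\<close> only through
    \<open>2 * h = 1\<close>, so it is pure ring arithmetic.\<close>
  define h :: "complex fps" where "h = fps_const (1 / 2)"
  have h: "2 * h = 1" "h * h = fps_const (1 / 4)"
    by (simp_all add: h_def fps_numeral_fps_const)
  have u_eq: "u c = 1 + fps_const c * X * (G c - h)" for c
    by (simp add: u_def X_def G_def h_def)
  have u': "u x = 1 + a * X * (G x - h)" "u z = 1 + b * X * (G z - h)" "u 1 = 1 + X * (G 1 - h)"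
    unfolding u_eq by (simp_all add: a_def b_def)
  have "X * (a * b * X * (G x * G z - G 1 * G x - G 1 * G z + h * h) - (G 1 - a * a * G x - b * b * G z)) = 0"
    using * h(1) unfolding u' ab by algebra
  hence "a * b * X * (G x * G z - G 1 * G x - G 1 * G z + h * h) = G 1 - a * a * G x - b * b * G z"
    by (simp add: X_def)
  thus ?thesis
    by (simp add: a_def b_def X_def h(2) power2_eq_square)
qed

section \<open>Binomial sums and the residue weights\<close>

text \<open>Compare the coefficients of \<open>x ^ a\<close> in \<open>x ^ M * (1 + x) ^ M\<close>,
  once directly and once with \<open>x ^ M\<close> expanded as
  \<open>((1 + x) - 1) ^ M\<close>.\<close>

lemma alternating_binomial_sum:
  "(\<Sum>n\<le>M. (-1) ^ n * of_nat (M choose n) * of_nat ((2 * M - n) choose a)) =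
     (if M \<le> a then of_nat (M choose (a - M)) else (0 :: 'a :: comm_ring_1))"
proof -
  define p where "p = [:1, 1 :: 'a:]"
  have coeff_p: "coeff (p ^ n) i = of_nat (n choose i)" for n i
  proof (cases "i \<le> n")
    case False
    have "degree (p ^ n) \<le> n"
      using degree_power_le[of p n] by (auto simp: p_def split: if_splits intro: order_trans)
    thus ?thesis
      using False by (simp add: coeff_eq_0 binomial_eq_0)
  qed (simp add: p_def coeff_linear_poly_power)
  have "monom 1 M = (-1 + p) ^ M"
    by (simp add: p_def monom_altdef one_pCons)
  also have "\<dots> = (\<Sum>n\<le>M. of_nat (M choose n) * (-1) ^ n * p ^ (M - n))"
    by (rule binomial_ring)
  finally have "monom 1 M * p ^ M = (\<Sum>n\<le>M. of_nat (M choose n) * (-1) ^ n * p ^ (M - n) * p ^ M)"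
    by (simp only: sum_distrib_right)
  also have "\<dots> = (\<Sum>n\<le>M. of_nat (M choose n) * (-1) ^ n * p ^ (2 * M - n))"
  proof (intro sum.cong refl)
    fix n assume "n \<in> {..M}"
    hence "2 * M - n = (M - n) + M"
      by auto
    thus "of_nat (M choose n) * (-1) ^ n * p ^ (M - n) * p ^ M = of_nat (M choose n) * (-1) ^ n * p ^ (2 * M - n)"
      by (simp only: power_add mult.assoc)
  qed
  finally have "monom 1 M * p ^ M = (\<Sum>n\<le>M. of_nat (M choose n) * (-1) ^ n * p ^ (2 * M - n))" .
  hence "coeff (monom 1 M * p ^ M) a = coeff (\<Sum>n\<le>M. of_nat (M choose n) * (-1) ^ n * p ^ (2 * M - n)) a"
    by simp
  also have "\<dots> = (\<Sum>n\<le>M. (-1) ^ n * of_nat (M choose n) * of_nat ((2 * M - n) choose a))"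
    unfolding coeff_sum
  proof (intro sum.cong refl)
    fix n
    have "of_nat (M choose n) * (-1) ^ n * p ^ (2 * M - n) = smult (of_nat (M choose n) * (-1) ^ n) (p ^ (2 * M - n))"
      by (simp add: of_nat_poly poly_const_pow minus_one_power_iff)
    thus "coeff (of_nat (M choose n) * (-1) ^ n * p ^ (2 * M - n)) a = (-1) ^ n * of_nat (M choose n) * of_nat ((2 * M - n) choose a)"
      by (simp add: coeff_p mult_ac)
  qed
  finally show ?thesis
    by (simp add: coeff_monom_mult coeff_p not_less[symmetric] split: if_splits)
qed

text \<open>Vandermonde's identity with both upper indices equal to \<open>-(M + 1)\<close>.
  Negating the upper index turns the generalized binomials into ordinary ones, and the signs combine
  to \<open>(-1) ^ M\<close> on either side.\<close>

lemma binomial_diagonal_sum: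
  "(\<Sum>n\<le>M. ((M + n) choose M) * ((2 * M - n) choose M)) = (3 * M + 1) choose M"
proof -
  have g: "(- of_nat (Suc M) gchoose k) = (-1) ^ k * (of_nat ((M + k) choose M) :: rat)" for k
  proof -
    have "(- of_nat (Suc M) gchoose k) = (-1) ^ k * (of_nat (M + k) gchoose k :: rat)"
      by (subst gbinomial_minus) (simp add: algebra_simps)
    also have "(of_nat (M + k) gchoose k :: rat) = of_nat ((M + k) choose M)"
      by (subst binomial_gbinomial[symmetric]) (simp add: binomial_symmetric[of k "M + k"])
    finally show ?thesis .
  qed
  have "(\<Sum>n\<le>M. (- of_nat (Suc M) gchoose n) * (- of_nat (Suc M) gchoose (M - n))) =
      (- of_nat (Suc M) + - of_nat (Suc M) gchoose M :: rat)"
    using gbinomial_Vandermonde[of "- of_nat (Suc M)" "- of_nat (Suc M)" M] by (simp add: atMost_atLeast0)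
  also have "- of_nat (Suc M) + - of_nat (Suc M) = (- of_nat (Suc (2 * M + 1)) :: rat)"
    by simp
  also have "(- of_nat (Suc (2 * M + 1)) gchoose M :: rat) = (-1) ^ M * of_nat ((3 * M + 1) choose M)"
    by (subst gbinomial_minus) (simp add: binomial_gbinomial algebra_simps)
  also have "(\<Sum>n\<le>M. (- of_nat (Suc M) gchoose n) * (- of_nat (Suc M) gchoose (M - n))) =
     ((-1) ^ M * of_nat (\<Sum>n\<le>M. ((M + n) choose M) * ((2 * M - n) choose M)) :: rat)"
    unfolding of_nat_sum sum_distrib_left
  proof (intro sum.cong refl)
    fix n assume n: "n \<in> {..M}"
    have "(-1) ^ n * (-1) ^ (M - n) = ((-1) ^ M :: rat)"
      using n by (simp flip: power_add)
    moreover have "M + (M - n) = 2 * M - n"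
      using n by auto
    ultimately show "(- of_nat (Suc M) gchoose n) * (- of_nat (Suc M) gchoose (M - n)) =
        (-1) ^ M * (of_nat (((M + n) choose M) * ((2 * M - n) choose M)) :: rat)"
      unfolding g by (simp add: mult_ac)
  qed
  finally have "of_nat (\<Sum>n\<le>M. ((M + n) choose M) * ((2 * M - n) choose M)) = (of_nat ((3 * M + 1) choose M) :: rat)"
    by simp
  thus ?thesis
    by (simp only: of_nat_eq_iff)
qed

text \<open>
  The weights are \<open>(\<partial>\<^sub>x \<partial>\<^sub>y (\<partial>\<^sub>x + \<partial>\<^sub>y))\<^sup>M (x\<^sup>i y\<^sup>3\<^sup>M\<^sup>-\<^sup>i)\<close>. For even \<open>M\<close> this differential operator is
  invariant under the symmetries of the \<open>A\<^sub>2\<close> lattice, and so it identifies the three products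
  in the addition theorem.
\<close>
definition res_weight :: "nat \<Rightarrow> nat \<Rightarrow> complex" where
  "res_weight M i = (if M \<le> i then fact i * fact (3 * M - i) * of_nat (M choose (i - M)) else 0)"

lemma res_weight_shift: "res_weight M (M + n) = fact (M + n) * fact (2 * M - n) * of_nat (M choose n)"
proof -
  have "3 * M - (M + n) = 2 * M - n"
    by auto
  thus ?thesis
    by (simp add: res_weight_def)
qed

lemma res_weight_eq_0: "i \<le> 3 * M \<Longrightarrow> i \<notin> (\<lambda>n. M + n) ` {..M} \<Longrightarrow> res_weight M i = 0"
proof -
  assume i: "i \<notin> (\<lambda>n. M + n) ` {..M}"
  show "res_weight M i = 0"
  proof (cases "M \<le> i")
    case True
    hence "i = M + (i - M)"
      by auto
    hence "\<not> i - M \<le> M"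
      using i by blast
    thus ?thesis
      by (simp add: res_weight_def binomial_eq_0)
  qed (auto simp: res_weight_def)
qed

lemma sum_res_weight_conv:
  "(\<Sum>i\<le>3 * M. f i * res_weight M i) = (\<Sum>n\<le>M. f (M + n) * (fact (M + n) * fact (2 * M - n) * of_nat (M choose n)))"
proof -
  have "(\<Sum>i\<le>3 * M. f i * res_weight M i) = (\<Sum>i\<in>(\<lambda>n. M + n) ` {..M}. f i * res_weight M i)"
    by (rule sum.mono_neutral_right) (auto simp: res_weight_eq_0)
  thus ?thesis
    by (simp add: sum.reindex res_weight_shift)
qed

lemma res_weight_symmetric: 
  assumes "i \<le> 3 * M"
  shows "res_weight M (3 * M - i) = res_weight M i"
proof (cases "M \<le> i \<and> i \<le> 2 * M")
  case True
  have "3 * M - i - M = M - (i - M)"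
    using True by auto
  hence "M choose (3 * M - i - M) = M choose (i - M)"
    by (simp only:) (rule binomial_symmetric[symmetric], use True in auto)
  moreover have "M \<le> 3 * M - i" "3 * M - (3 * M - i) = i"
    using True by auto
  ultimately show ?thesis
    using True by (simp add: res_weight_def mult_ac)
next
  case False
  thus ?thesis
    using assms by (auto simp: res_weight_def binomial_eq_0)
qed

lemma fact_mult_fact_mult_choose:
  "fact m * fact n * of_nat (n + m choose n) = (fact (n + m) :: 'a :: field_char_0)"
proof -
  have "fact n * fact m * (n + m choose n) = fact (n + m)"
    using binomial_fact_lemma[of n "n + m"] by simp
  from arg_cong[OF this, of "of_nat :: nat \<Rightarrow> 'a"] show ?thesis
    by (simp only: of_nat_mult of_nat_fact ac_simps)
qed

text \<open>Each nonzero weight is \<open>fact M ^ 3\<close> times a product of two binomials, which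
  reduces the total to \<open>binomial_diagonal_sum\<close>.\<close>

lemma sum_res_weight:
  "(\<Sum>i\<le>3 * M. res_weight M i) = fact M * fact M * fact (3 * M + 1) / fact (2 * M + 1)"
proof -
  have "(\<Sum>i\<le>3 * M. res_weight M i) = (\<Sum>n\<le>M. fact (M + n) * fact (2 * M - n) * of_nat (M choose n))"
    using sum_res_weight_conv[of "\<lambda>_. 1" M] by simp
  also have "\<dots> = (\<Sum>n\<le>M. fact M ^ 3 * of_nat (((M + n) choose M) * ((2 * M - n) choose M)))"
  proof (intro sum.cong refl)
    fix n assume n: "n \<in> {..M}"
    then obtain k where k: "M = n + k"
      using le_Suc_ex by auto
    have a: "fact n * fact M * of_nat (M + n choose M) = (fact (M + n) :: complex)"
      by (rule fact_mult_fact_mult_choose)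
    have b: "fact k * fact M * of_nat (M + k choose M) = (fact (M + k) :: complex)"
      by (rule fact_mult_fact_mult_choose)
    have c: "fact k * fact n * of_nat (M choose n) = (fact M :: complex)"
      unfolding k by (rule fact_mult_fact_mult_choose)
    have d: "2 * M - n = M + k"
      using k by auto
    have "fact (M + n) * fact (2 * M - n) * of_nat (M choose n) =
        fact M ^ 2 * of_nat (M + n choose M) * of_nat (M + k choose M) * (fact k * fact n * of_nat (M choose n) :: complex)"
      unfolding d a[symmetric] b[symmetric] by (simp add: power2_eq_square mult_ac)
    thus "fact (M + n) * fact (2 * M - n) * of_nat (M choose n) = fact M ^ 3 * (of_nat (((M + n) choose M) * ((2 * M - n) choose M)) :: complex)"
      unfolding c d by (simp add: power2_eq_square power3_eq_cube mult_ac)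
  qed
  also have "\<dots> = fact M ^ 3 * of_nat ((3 * M + 1) choose M)"
    by (simp only: binomial_diagonal_sum sum_distrib_left[symmetric] of_nat_sum[symmetric])
  also have "\<dots> = fact M * fact M * fact (3 * M + 1) / fact (2 * M + 1)"
  proof -
    have "3 * M + 1 = M + (2 * M + 1)"
      by simp
    hence "fact (2 * M + 1) * fact M * of_nat (3 * M + 1 choose M) = (fact (3 * M + 1) :: complex)"
      by (metis fact_mult_fact_mult_choose)
    moreover have "m ^ 3 * c = m * m * g / F" if "F * m * c = g" "F \<noteq> 0" for F m c g :: complex
      using that by (auto simp: power3_eq_cube)
    ultimately show ?thesis
      using fact_nonzero by blast
  qed
  finally show ?thesis .
qed

text \<open>The left side applies the functional sending \<open>x ^ i\<close> to
  \<open>res_weight M i\<close> to the polynomial \<open>(1 - x) ^ b\<close>. Homogeneously the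
  substitution is \<open>(x, y)\<close> to \<open>(y - x, y)\<close>, which multiplies the
  differential operator by \<open>(-1) ^ M\<close>; hence \<open>M\<close> is even. The evaluation
  rests on \<open>alternating_binomial_sum\<close>.\<close>

lemma sum_res_weight_one_minus_power:
  assumes M: "even M" and b: "b \<le> 3 * M"
  shows "(\<Sum>i\<le>3 * M. of_nat (b choose i) * (-1) ^ i * res_weight M i) = res_weight M b"
proof -
  define a where "a = 3 * M - b"
  have ab: "3 * M = a + b"
    using b by (simp add: a_def)
  have "(\<Sum>i\<le>3 * M. of_nat (b choose i) * (-1) ^ i * res_weight M i) =
      (\<Sum>n\<le>M. of_nat (b choose (M + n)) * (-1) ^ (M + n) * (fact (M + n) * fact (2 * M - n) * of_nat (M choose n)))"
    by (rule sum_res_weight_conv)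
  also have "\<dots> = (\<Sum>n\<le>M. fact a * fact b * ((-1) ^ n * of_nat (M choose n) * of_nat ((2 * M - n) choose a)))"
  proof (intro sum.cong refl)
    fix n assume n: "n \<in> {..M}"
    show "of_nat (b choose (M + n)) * (-1) ^ (M + n) * (fact (M + n) * fact (2 * M - n) * of_nat (M choose n)) =
       (fact a * fact b * ((-1) ^ n * of_nat (M choose n) * of_nat ((2 * M - n) choose a)) :: complex)"
    proof (cases "M + n \<le> b")
      case True
      then obtain k where k: "b = (M + n) + k"
        using le_Suc_ex by blast
      have d: "2 * M - n = a + k"
        using ab k by auto
      have 1: "fact k * fact (M + n) * of_nat (b choose (M + n)) = (fact b :: complex)"
        unfolding k by (rule fact_mult_fact_mult_choose)
      have 2: "fact k * fact a * of_nat (a + k choose a) = (fact (a + k) :: complex)"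
        by (rule fact_mult_fact_mult_choose)
      show ?thesis
        unfolding d 1[symmetric] 2[symmetric] using M by (simp add: power_add mult_ac)
    next
      case False
      hence "2 * M - n < a"
        using ab n by auto
      thus ?thesis
        using False by (simp add: binomial_eq_0)
    qed
  qed
  also have "\<dots> = fact a * fact b * (if M \<le> a then of_nat (M choose (a - M)) else 0)"
    unfolding sum_distrib_left[symmetric] alternating_binomial_sum ..
  also have "\<dots> = res_weight M a"
  proof -
    have "3 * M - a = b"
      using ab by simp
    thus ?thesis
      by (simp add: res_weight_def)
  qed
  also have "\<dots> = res_weight M b"
    unfolding a_def by (rule res_weight_symmetric[OF b])
  finally show ?thesis .
qed

text \<open>The coefficient of degree \<open>N\<close> in \<open>bern_addition\<close> for
  \<open>z = 1 - x\<close>, divided by \<open>x * z\<close>. Keeping \<open>x\<close> free gives an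
  identity of polynomials, to which weights can be applied. The value 0 of \<open>g\<close> at 0
  reflects that adding 1/2 removes the constant coefficient.\<close>

lemma bern_poly_identity:
  assumes M: "even M" "M > 0"
  defines "N \<equiv> 3 * M + 1"
  defines "g \<equiv> \<lambda>n. if n = 0 then 0 else zeta_coeff n 0"
  defines "z \<equiv> [:1, -1 :: complex:]"
  defines "x \<equiv> [:0, 1 :: complex:]"
  shows "(\<Sum>i\<le>3 * M. smult (g i * g (3 * M - i)) (x ^ i * z ^ (3 * M - i) - x ^ i - z ^ i)) =
           smult (g N) ((\<Sum>i\<le>3 * M. x ^ i) + (\<Sum>i\<le>3 * M. z ^ i) + (\<Sum>i\<le>3 * M. x ^ i * (-z) ^ (3 * M - i)))"
proof -
  define P where "P = (\<lambda>x z :: complex. \<Sum>i\<le>3 * M. g i * g (3 * M - i) * (x ^ i * z ^ (3 * M - i) - x ^ i - z ^ i))"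
  define R where "R = (\<lambda>x z :: complex. (\<Sum>i\<le>3 * M. x ^ i) + (\<Sum>i\<le>3 * M. z ^ i) + (\<Sum>i\<le>3 * M. x ^ i * (-z) ^ (3 * M - i)))"
  have g_eq: "fps_nth (bern_scaled c + fps_const (1 / 2)) n = g n * c ^ n" for c n
    by (auto simp: g_def bern_scaled_nth zeta_coeff_0_0)
  have "odd N"
    using M by (simp add: N_def)
  have main: "x * z * P x z = x * z * (g N * R x z)" if xz: "x + z = 1" for x z :: complex
  proof (cases "x = 0 \<or> z = 0")
    case False
    define G where "G = (\<lambda>c. bern_scaled c + fps_const (1 / 2))"
    have conv: "fps_nth (G c * G d) (3 * M) = (\<Sum>i\<le>3 * M. g i * g (3 * M - i) * (c ^ i * d ^ (3 * M - i)))" for c d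
      unfolding fps_mult_nth G_def g_eq by (simp add: atMost_atLeast0 mult_ac)
    have conv1: "fps_nth (G 1 * G c) (3 * M) = (\<Sum>i\<le>3 * M. g i * g (3 * M - i) * c ^ i)" for c
      unfolding mult.commute[of "G 1"] conv by simp
    have "fps_nth (fps_const (x * z) * fps_X * (G x * G z - G 1 * G x - G 1 * G z + fps_const (1 / 4))) N =
        fps_nth (G 1 - fps_const (x\<^sup>2) * G x - fps_const (z\<^sup>2) * G z) N"
      using bern_addition[of x z] False xz unfolding G_def by simp
    also have "fps_nth (fps_const (x * z) * fps_X * (G x * G z - G 1 * G x - G 1 * G z + fps_const (1 / 4))) N =
        x * z * (fps_nth (G x * G z) (3 * M) - fps_nth (G 1 * G x) (3 * M) - fps_nth (G 1 * G z) (3 * M))"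
      using M by (simp add: N_def mult.assoc)
    also have "\<dots> = x * z * P x z"
      unfolding conv1 unfolding conv P_def by (simp add: sum_subtractf right_diff_distrib)
    also have "fps_nth (G 1 - fps_const (x\<^sup>2) * G x - fps_const (z\<^sup>2) * G z) N = g N * (1 - x\<^sup>2 * x ^ N - z\<^sup>2 * z ^ N)"
      unfolding fps_sub_nth fps_mult_left_const_nth by (simp only: G_def g_eq) (simp add: algebra_simps)
    \<comment> \<open>As \<open>x + z = 1\<close>, three geometric sums give the quotient by
      \<open>x * z\<close> explicitly; the third needs \<open>N\<close> odd.\<close>
    also have "1 - x\<^sup>2 * x ^ N - z\<^sup>2 * z ^ N = x * z * R x z"
    proof -
      have s1: "z * (\<Sum>i\<le>3 * M. x ^ i) = 1 - x ^ N"
        using xz one_diff_power_eq[of x N] by (simp add: N_def lessThan_Suc_atMost eq_diff_eq[symmetric] add.commute)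
      have s2: "x * (\<Sum>i\<le>3 * M. z ^ i) = 1 - z ^ N"
        using xz one_diff_power_eq[of z N] by (simp add: N_def lessThan_Suc_atMost eq_diff_eq[symmetric])
      have "x ^ Suc (3 * M) - (-z) ^ Suc (3 * M) = (x - (-z)) * (\<Sum>i<Suc (3 * M). x ^ i * (-z) ^ (3 * M - i))"
        by (rule diff_power_eq_sum)
      hence s3: "(\<Sum>i\<le>3 * M. x ^ i * (-z) ^ (3 * M - i)) = x ^ N + z ^ N"
        using xz \<open>odd N\<close> by (simp add: N_def lessThan_Suc_atMost)
      have "x * z * R x z = x * (z * (\<Sum>i\<le>3 * M. x ^ i)) + z * (x * (\<Sum>i\<le>3 * M. z ^ i)) +
          x * z * (\<Sum>i\<le>3 * M. x ^ i * (-z) ^ (3 * M - i))"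
        by (simp add: R_def algebra_simps)
      also have "\<dots> = x * (1 - x ^ N) + z * (1 - z ^ N) + x * z * (x ^ N + z ^ N)"
        unfolding s1 s2 s3 ..
      also have "\<dots> = (x + z) - (x * (1 - z)) * x ^ N - (z * (1 - x)) * z ^ N"
        by (simp add: algebra_simps)
      also have "\<dots> = 1 - x\<^sup>2 * x ^ N - z\<^sup>2 * z ^ N"
      proof -
        have "1 - z = x" "1 - x = z"
          using xz by (auto simp: algebra_simps)
        thus ?thesis
          by (simp only: xz power2_eq_square)
      qed
      finally show ?thesis ..
    qed
    finally show ?thesis
      by (simp add: mult_ac)
  qed auto
  let ?P = "\<Sum>i\<le>3 * M. smult (g i * g (3 * M - i)) (x ^ i * z ^ (3 * M - i) - x ^ i - z ^ i)"
  let ?R = "smult (g N) ((\<Sum>i\<le>3 * M. x ^ i) + (\<Sum>i\<le>3 * M. z ^ i) + (\<Sum>i\<le>3 * M. x ^ i * (-z) ^ (3 * M - i)))"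
  have "poly (x * z * ?P) = poly (x * z * ?R)"
  proof
    fix t :: complex
    have "poly ?P t = P t (1 - t)"
      by (simp add: poly_sum P_def x_def z_def)
    have "poly ?R t = g N * R t (1 - t)"
      by (simp add: poly_sum R_def x_def z_def)
    show "poly (x * z * ?P) t = poly (x * z * ?R) t"
    proof -
      have "poly x t = t" "poly z t = 1 - t"
        by (simp_all add: x_def z_def)
      thus ?thesis
        using main[of t "1 - t"] \<open>poly ?P t = _\<close> \<open>poly ?R t = _\<close> by (simp only: poly_mult) simp
    qed
  qed
  hence eq: "x * z * ?P = x * z * ?R"
    by (simp only: poly_eq_poly_eq_iff)
  have "x * z \<noteq> 0"
    by (simp add: x_def z_def)
  from mult_left_cancel[OF this, THEN iffD1, OF eq] show ?thesis .
qed

text \<open>The functional \<open>L\<close> takes the same value on \<open>x ^ i\<close>,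
  \<open>(1 - x) ^ i\<close> and \<open>x ^ i * (x - 1) ^ (3 * M - i)\<close>. Applied to
  \<open>bern_poly_identity\<close> it turns both sides, up to sign, into three equal sums, and the
  factor 3 cancels.\<close>

lemma zeta_coeff_convolution_even:
  assumes M: "even M" "M > 0"
  shows "(\<Sum>n\<le>M. zeta_coeff (M + n) 0 * zeta_coeff (2 * M - n) 0 * (fact (M + n) * fact (2 * M - n) * of_nat (M choose n))) =
           - (fact M * fact M * fact (3 * M + 1) / fact (2 * M + 1)) * zeta_coeff (3 * M + 1) 0"
proof -
  define g where "g = (\<lambda>n. if n = 0 then 0 else zeta_coeff n 0)"
  define z where "z = [:1, -1 :: complex:]"
  define x where "x = [:0, 1 :: complex:]"
  define L where "L = (\<lambda>p. \<Sum>i\<le>3 * M. coeff p i * res_weight M i)"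
  have L_add: "L (p + q) = L p + L q" and L_diff: "L (p - q) = L p - L q" and L_smult: "L (smult c p) = c * L p" for p q c
    by (simp_all add: L_def sum.distrib sum_subtractf algebra_simps sum_distrib_left)
  have L_sum: "L (sum f A) = (\<Sum>i\<in>A. L (f i))" for f :: "nat \<Rightarrow> complex poly" and A
    unfolding L_def coeff_sum sum_distrib_right by (rule sum.swap)
  have x_pow: "x ^ i = monom 1 i" for i
    by (simp add: x_def monom_altdef)
  have coeff_z: "coeff (z ^ b) i = of_nat (b choose i) * (-1) ^ i" for b i
  proof (cases "i \<le> b")
    case False
    have "degree (z ^ b) \<le> b"
      using degree_power_le[of z b] by (simp add: z_def)
    thus ?thesis
      using False by (simp add: coeff_eq_0 binomial_eq_0)
  qed (simp add: z_def coeff_linear_poly_power)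
  have Lx: "L (x ^ i) = res_weight M i" if "i \<le> 3 * M" for i
    using that by (simp add: L_def x_pow if_distrib[of "\<lambda>c. c * _"] cong: if_cong)
  have Lz: "L (z ^ i) = res_weight M i" if "i \<le> 3 * M" for i
    unfolding L_def coeff_z by (rule sum_res_weight_one_minus_power[OF M(1) that])
  have Lxz: "L (x ^ i * (-z) ^ (3 * M - i)) = res_weight M i" if i: "i \<le> 3 * M" for i
  proof -
    define b where "b = 3 * M - i"
    have ib: "3 * M = i + b"
      using i by (simp add: b_def)
    have "-z = [:-1, 1:]"
      by (simp add: z_def)
    have coeff_mz: "coeff ((-z) ^ b) j = of_nat (b choose j) * (-1) ^ (b - j)" if "j \<le> b" for j
      unfolding \<open>-z = _\<close> using that by (simp add: coeff_linear_poly_power)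
    have "L (x ^ i * (-z) ^ b) = (\<Sum>j\<in>(\<lambda>j. i + j) ` {..b}. coeff (x ^ i * (-z) ^ b) j * res_weight M j)"
      unfolding L_def
    proof (rule sum.mono_neutral_right)
      show "\<forall>j\<in>{..3 * M} - (\<lambda>j. i + j) ` {..b}. coeff (x ^ i * (-z) ^ b) j * res_weight M j = 0"
      proof
        fix j assume j: "j \<in> {..3 * M} - (\<lambda>j. i + j) ` {..b}"
        have "j < i"
        proof (rule ccontr)
          assume "\<not> j < i"
          hence "j = i + (j - i)" "j - i \<in> {..b}"
            using j ib by auto
          thus False
            using j by blast
        qed
        thus "coeff (x ^ i * (-z) ^ b) j * res_weight M j = 0"
          by (simp add: x_pow coeff_monom_mult)
      qed
    qed (use ib in auto)
    also have "\<dots> = (\<Sum>j\<le>b. of_nat (b choose j) * (-1) ^ (b - j) * res_weight M (i + j))"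
      by (subst sum.reindex) (auto simp: x_pow coeff_monom_mult coeff_mz intro!: sum.cong)
    also have "\<dots> = (\<Sum>j\<le>b. of_nat (b choose j) * (-1) ^ j * res_weight M j)"
    proof (rule sum.reindex_bij_witness[of _ "\<lambda>j. b - j" "\<lambda>j. b - j"])
      fix j assume "j \<in> {..b}"
      hence "i + j = 3 * M - (b - j)" "b choose (b - j) = b choose j" "b - j \<le> 3 * M"
        using ib binomial_symmetric[of j b] by auto
      moreover from this have "res_weight M (i + j) = res_weight M (b - j)"
        by (simp only: res_weight_symmetric)
      ultimately show "of_nat (b choose (b - j)) * (-1) ^ (b - j) * res_weight M (b - j) =
          of_nat (b choose j) * (-1) ^ (b - j) * res_weight M (i + j)"
        by (simp only:)
    qed auto
    also have "\<dots> = (\<Sum>j\<le>3 * M. of_nat (b choose j) * (-1) ^ j * res_weight M j)"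
      by (rule sum.mono_neutral_left) (use ib in \<open>auto simp: binomial_eq_0\<close>)
    also have "\<dots> = res_weight M b"
      by (rule sum_res_weight_one_minus_power) (use M ib in auto)
    also have "\<dots> = res_weight M i"
      unfolding b_def by (rule res_weight_symmetric[OF i])
    finally show ?thesis
      by (simp add: b_def)
  qed
  \<comment> \<open>Even \<open>i\<close> drop out because \<open>g i = 0\<close>. For odd
    \<open>i\<close> the exponent \<open>3 * M - i\<close> is odd as well, so each of the three
    products contributes \<open>- res_weight M i\<close>.\<close>
  have "(\<Sum>i\<le>3 * M. g i * g (3 * M - i) * (-3 * res_weight M i)) =
      L (\<Sum>i\<le>3 * M. smult (g i * g (3 * M - i)) (x ^ i * z ^ (3 * M - i) - x ^ i - z ^ i))"
    unfolding L_sum L_smult L_diff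
  proof (intro sum.cong refl)
    fix i assume i: "i \<in> {..3 * M}"
    show "g i * g (3 * M - i) * (-3 * res_weight M i) =
        g i * g (3 * M - i) * (L (x ^ i * z ^ (3 * M - i)) - L (x ^ i) - L (z ^ i))"
    proof (cases "odd i")
      case True
      hence "odd (3 * M - i)"
        using M i by auto
      hence "x ^ i * z ^ (3 * M - i) = smult (-1) (x ^ i * (-z) ^ (3 * M - i))"
        by simp
      hence "L (x ^ i * z ^ (3 * M - i)) = - res_weight M i"
        using Lxz[of i] i by (simp only: L_smult) simp
      thus ?thesis
        using i by (simp add: Lx Lz)
    next
      case False
      hence "g i = 0"
        by (simp add: g_def zeta_coeff_even_0)
      thus ?thesis by simp
    qed
  qed
  also have "\<dots> = g (3 * M + 1) * (3 * (\<Sum>i\<le>3 * M. res_weight M i))"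
    unfolding g_def x_def z_def bern_poly_identity[OF M]
    unfolding x_def[symmetric] z_def[symmetric] L_smult L_add L_sum
    by (simp add: Lx Lz Lxz)
  also have "(\<Sum>i\<le>3 * M. g i * g (3 * M - i) * (-3 * res_weight M i)) =
      -3 * (\<Sum>i\<le>3 * M. g i * g (3 * M - i) * res_weight M i)"
    by (simp add: sum_distrib_left mult_ac)
  finally have eq: "-3 * (\<Sum>i\<le>3 * M. g i * g (3 * M - i) * res_weight M i) = g (3 * M + 1) * (3 * (\<Sum>i\<le>3 * M. res_weight M i))" .
  have "S = - a * T" if "-3 * S = a * (3 * T)" for S T a :: complex
  proof -
    have "-3 * S = -3 * (- a * T)"
      using that by simp
    thus ?thesis
      by (simp only: mult_cancel_left) auto
  qed
  from this[OF eq] have "(\<Sum>i\<le>3 * M. g i * g (3 * M - i) * res_weight M i) = - g (3 * M + 1) * (\<Sum>i\<le>3 * M. res_weight M i)" .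
  also have "(\<Sum>i\<le>3 * M. g i * g (3 * M - i) * res_weight M i) =
      (\<Sum>n\<le>M. zeta_coeff (M + n) 0 * zeta_coeff (2 * M - n) 0 * (fact (M + n) * fact (2 * M - n) * of_nat (M choose n)))"
    unfolding sum_res_weight_conv
  proof (intro sum.cong refl)
    fix n assume n: "n \<in> {..M}"
    have "3 * M - (M + n) = 2 * M - n"
      by auto
    thus "g (M + n) * g (3 * M - (M + n)) * (fact (M + n) * fact (2 * M - n) * of_nat (M choose n)) =
        zeta_coeff (M + n) 0 * zeta_coeff (2 * M - n) 0 * (fact (M + n) * fact (2 * M - n) * of_nat (M choose n))"
      using n M by (simp add: g_def)
  qed
  finally show ?thesis
    unfolding sum_res_weight by (simp add: g_def mult_ac)
qed

text \<open>The left side is the residue of \<open>omega_poles\<close> at \<open>- M\<close>. For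
  odd \<open>M\<close> every term contains a vanishing \<open>zeta_coeff n 0\<close> with even
  positive \<open>n\<close>; for even \<open>M\<close> this is the convolution identity divided by
  \<open>fact M\<close>. At M = 0 the sum would be 1/3, the residue at the origin.\<close>

lemma zeta_coeff_residue_cancel:
  assumes M: "M > 0"
  shows "fact M * zeta_coeff (2 * M + 1) (- of_nat M) +
           (\<Sum>n\<le>M. zeta_coeff n (- of_nat M) * zeta_coeff (M - n) (- of_nat M)) = 0"
proof (cases "even M")
  case False
  have "zeta_coeff n (- of_nat M) * zeta_coeff (M - n) (- of_nat M) = 0" if "n \<le> M" for n
  proof (cases "even (M + n)")
    case True
    thus ?thesis
      using M by (simp add: zeta_coeff_neg_nat zeta_coeff_even_0)
  next
    case odd: False
    hence "even (M + (M - n))"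
      using False that by auto
    thus ?thesis
      using M unfolding zeta_coeff_neg_nat by (simp add: zeta_coeff_even_0)
  qed
  hence "(\<Sum>n\<le>M. zeta_coeff n (- of_nat M) * zeta_coeff (M - n) (- of_nat M)) = 0"
    by (intro sum.neutral) auto
  moreover have "zeta_coeff (2 * M + 1) (- of_nat M) = 0"
    unfolding zeta_coeff_neg_nat using False by (simp add: zeta_coeff_even_0)
  ultimately show ?thesis
    by simp
next
  case True
  have "fact M * (\<Sum>n\<le>M. zeta_coeff n (- of_nat M) * zeta_coeff (M - n) (- of_nat M)) =
      (\<Sum>n\<le>M. zeta_coeff (M + n) 0 * zeta_coeff (2 * M - n) 0 * (fact (M + n) * fact (2 * M - n) * of_nat (M choose n)))"
    unfolding sum_distrib_left
  proof (intro sum.cong refl)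
    fix n assume n: "n \<in> {..M}"
    hence "M + (M - n) = 2 * M - n"
      by auto
    moreover have "of_nat (M choose n) = (fact M / (fact n * fact (M - n)) :: complex)"
      using n by (simp add: binomial_fact)
    ultimately show "fact M * (zeta_coeff n (- of_nat M) * zeta_coeff (M - n) (- of_nat M)) =
      zeta_coeff (M + n) 0 * zeta_coeff (2 * M - n) 0 * (fact (M + n) * fact (2 * M - n) * of_nat (M choose n))"
      unfolding zeta_coeff_neg_nat using True by (simp add: field_simps)
  qed
  also have "\<dots> = - (fact M * fact M * fact (3 * M + 1) / fact (2 * M + 1)) * zeta_coeff (3 * M + 1) 0"
    by (rule zeta_coeff_convolution_even[OF True M])
  also have "\<dots> = - (fact M * (fact M * zeta_coeff (2 * M + 1) (- of_nat M)))"
  proof -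
    have "M + (2 * M + 1) = 3 * M + 1"
      by simp
    hence "zeta_coeff (2 * M + 1) (- of_nat M) = fact (3 * M + 1) / fact (2 * M + 1) * zeta_coeff (3 * M + 1) 0"
      using True by (simp only: zeta_coeff_neg_nat) simp
    thus ?thesis
      by (simp only:) (simp only: times_divide_eq_left times_divide_eq_right mult_minus_left mult.assoc)
  qed
  finally have "fact M * (fact M * zeta_coeff (2 * M + 1) (- of_nat M) +
           (\<Sum>n\<le>M. zeta_coeff n (- of_nat M) * zeta_coeff (M - n) (- of_nat M))) = 0"
    unfolding distrib_left by simp
  thus ?thesis
    by simp
qed

subsection \<open>The double series and its Mellin integral\<close>

lemma summable_on_nonneg_product:
  fixes f :: "'a \<Rightarrow> real" and g :: "'b \<Rightarrow> real"
  assumes "f summable_on UNIV" "g summable_on UNIV" "\<And>x. f x \<ge> 0" "\<And>y. g y \<ge> 0"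
  shows "(\<lambda>(x, y). f x * g y) summable_on UNIV"
proof -
  have "(\<lambda>(x, y). f x * g y) summable_on UNIV \<times> UNIV"
    by (rule summable_on_SigmaI[where g = "\<lambda>x. f x * infsum g UNIV"])
       (use assms in \<open>auto intro!: has_sum_cmult_right summable_on_cmult_left has_sum_infsum\<close>)
  thus ?thesis by simp
qed

lemma omega_term_eq:
  "omega_term s (j, k) = of_nat j powr (-s) * of_nat k powr (-s) * of_nat (j + k) powr (-s)"
proof -
  have "of_nat (j * k * (j + k)) powr (-s) = (of_nat (j * k) * of_nat (j + k)) powr (-s :: complex)"
    by (simp only: of_nat_mult)
  also have "\<dots> = of_nat (j * k) powr (-s) * of_nat (j + k) powr (-s)"
    by (rule powr_times_real) auto
  also have "of_nat (j * k) powr (-s) = (of_nat j * of_nat k) powr (-s :: complex)"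
    by (simp only: of_nat_mult)
  also have "\<dots> = of_nat j powr (-s) * of_nat k powr (-s)"
    by (rule powr_times_real) auto
  finally show ?thesis
    by (simp add: omega_term_def)
qed

text \<open>Since \<open>sqrt (j * k) \<le> j + k\<close>, the base is at least
  \<open>(j * k) powr (3 / 2)\<close>, which separates the variables; \<open>3 * r / 2 > 1\<close>
  is the condition \<open>r > 2 / 3\<close>. Using \<open>r\<close> instead of \<open>Re s\<close>
  makes the majorant locally uniform.\<close>

lemma norm_omega_term_le:
  assumes r: "0 < r" "r \<le> Re s"
  shows "norm (omega_term s (j, k)) \<le> real j powr (- 3 * r / 2) * real k powr (- 3 * r / 2)"
proof (cases "j = 0 \<or> k = 0")
  case True
  thus ?thesis
    by (auto simp: omega_term_def)
next
  case False
  define n where "n = real (j * k * (j + k))"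
  have jk: "real (j * k) \<ge> 1"
    using False by (simp del: of_nat_mult)
  have "(real (j * k) powr (1 / 2))\<^sup>2 = real (j * k)"
    using jk by (simp add: powr_half_sqrt)
  also have "\<dots> \<le> (real (j + k))\<^sup>2"
    by (simp add: power2_eq_square algebra_simps)
  finally have "real (j * k) powr (1 / 2) \<le> real (j + k)"
    by (rule power2_le_imp_le) auto
  hence "real (j * k) powr 1 * real (j * k) powr (1 / 2) \<le> real (j * k) * real (j + k)"
    using jk by (intro mult_mono) auto
  hence n: "real (j * k) powr (3 / 2) \<le> n"
    unfolding powr_add[symmetric] by (simp add: n_def)
  have "1 \<le> real (j * k) powr (3 / 2)"
    using jk by (intro ge_one_powr_ge_zero) auto
  hence "n \<ge> 1"
    using n by linarith
  have "norm (omega_term s (j, k)) = n powr (- Re s)"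
    using norm_powr_real_powr[of "of_real n" "-s"] \<open>n \<ge> 1\<close> by (simp add: omega_term_def n_def)
  also have "\<dots> \<le> n powr (- r)"
    using r \<open>n \<ge> 1\<close> by (intro powr_mono) auto
  also have "\<dots> \<le> (real (j * k) powr (3 / 2)) powr (- r)"
    using n r False by (intro powr_mono2') auto
  also have "\<dots> = real j powr (- 3 * r / 2) * real k powr (- 3 * r / 2)"
    by (simp add: powr_powr powr_mult)
  finally show ?thesis .
qed

lemma summable_on_omega_bound:
  assumes "r > 2 / 3"
  shows "(\<lambda>(j, k). real j powr (- 3 * r / 2) * real k powr (- 3 * r / 2)) summable_on UNIV"
proof -
  have "(\<lambda>n. real n powr (- 3 * r / 2)) summable_on UNIV"
    using assms by (subst summable_on_UNIV_nonneg_real_iff) (auto simp: summable_real_powr_iff)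
  thus ?thesis
    by (intro summable_on_nonneg_product) auto
qed

lemma abs_summable_omega_term:
  assumes s: "Re s > 2 / 3"
  shows "(\<lambda>p. norm (omega_term s p)) summable_on UNIV"
  by (rule Infinite_Sum.abs_summable_on_comparison_test'[OF summable_on_omega_bound[OF s]])
     (use norm_omega_term_le[of "Re s" s] s in auto)

lemma summable_omega_term:
  assumes s: "Re s > 2 / 3"
  shows "omega_term s summable_on A"
  using abs_summable_summable[OF abs_summable_omega_term[OF s]] by (rule summable_on_subset_banach) auto

text \<open>Pairs with a zero component may be added, as \<open>0 powr (-s) = 0\<close>.\<close>

lemma omega_series_eq: "omega_series s = (\<Sum>\<^sub>\<infinity>p. omega_term s p)"
  unfolding omega_series_def by (rule infsum_cong_neutral) (auto simp: omega_term_def not_le)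

lemma holomorphic_omega_series: "omega_series holomorphic_on {s. Re s > 2 / 3}"
  unfolding omega_series_eq[abs_def]
proof (rule holomorphic_infsum)
  show "open {s. Re s > 2 / 3}"
    by (rule open_halfspace_Re_gt)
  show "(\<lambda>s. omega_term s p) holomorphic_on {s. Re s > 2 / 3}" for p
    unfolding omega_term_def by (cases p) (auto intro!: holomorphic_intros)
  fix s assume "s \<in> {s. Re s > 2 / 3}"
  then obtain r where r: "2 / 3 < r" "r < Re s"
    using dense[of "2 / 3" "Re s"] by auto
  have "\<forall>\<^sub>F w in nhds s. w \<in> {s. Re s > r}"
    using r by (intro eventually_nhds_in_open open_halfspace_Re_gt) auto
  hence "\<forall>\<^sub>F w in nhds s. \<forall>p\<in>UNIV. norm (omega_term w p) \<le> (case p of (j, k) \<Rightarrow> real j powr (- 3 * r / 2) * real k powr (- 3 * r / 2))"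
    by eventually_elim (use r norm_omega_term_le[of r] in auto)
  with summable_on_omega_bound[OF r(1)]
  show "\<exists>M. M summable_on UNIV \<and> (\<forall>\<^sub>F w in nhds s. \<forall>p\<in>UNIV. norm (omega_term w p) \<le> M p)"
    by blast
qed

section \<open>The Mellin integral over t > 1\<close>

definition upper_integrand :: "real \<Rightarrow> complex \<Rightarrow> real \<Rightarrow> complex" where
  "upper_integrand m s t = indicator {1..} t *\<^sub>R (of_real t powr (s - 1) * of_real (exp (-(m * t))))"

text \<open>For \<open>m \<ge> 1\<close> this is \<open>m powr (-s)\<close> times the upper
  incomplete Gamma function of \<open>s\<close> at \<open>m\<close>.\<close>

definition upper_integral :: "real \<Rightarrow> complex \<Rightarrow> complex" where
  "upper_integral m s = integral\<^sup>L lborel (upper_integrand m s)"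

lemma borel_measurable_upper_integrand [measurable]: "upper_integrand m s \<in> borel_measurable borel"
  unfolding upper_integrand_def[abs_def]
  by (intro borel_measurable_continuous_on_indicator) (auto intro!: continuous_intros)

text \<open>For \<open>t \<ge> 1\<close> the exponential factor is at most
  \<open>exp (1 - m) * exp (- t)\<close>. With \<open>m = j + k\<close> this decay later outweighs
  all powers of \<open>j\<close> and \<open>k\<close>.\<close>

lemma norm_upper_integrand_mono:
  assumes "m \<ge> 1" "Re s \<le> x"
  shows "norm (upper_integrand m s t) \<le> exp (1 - m) * norm (upper_integrand 1 (of_real x) t)"
proof (cases "t \<ge> 1")
  case True
  have "m - 1 \<le> (m - 1) * t"
    using assms True by (simp add: mult_le_cancel_left1)
  hence "exp (-(m * t)) \<le> exp (1 - m - t)"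
    by (simp add: algebra_simps)
  hence "t powr (Re s - 1) * exp (-(m * t)) \<le> t powr (x - 1) * exp (1 - m - t)"
    using True assms by (intro mult_mono powr_mono) auto
  also have "\<dots> = exp (1 - m) * (t powr (x - 1) * exp (-t))"
    by (simp add: exp_diff exp_add exp_minus field_simps)
  finally show ?thesis
    using True by (simp add: upper_integrand_def norm_mult norm_powr_real_powr)
qed (simp add: upper_integrand_def)

lemma integrable_upper_integrand:
  assumes m: "m \<ge> 1"
  shows "integrable lborel (upper_integrand m s)"
proof -
  define x where "x = max (Re s) 1"
  define g where "g = (\<lambda>t. indicator {0<..} t *\<^sub>R (complex_of_real t powr (of_real x - 1) * of_real (exp (-(1 * t)))))"
  have "integrable lborel g"
    using has_bochner_integral_Gamma[of "of_real x" 1] unfolding g_def has_bochner_integral_iff by (auto simp: x_def)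
  hence int: "integrable lborel (\<lambda>t. exp (1 - m) * norm (g t))"
    by (intro integrable_mult_right integrable_norm)
  have le: "norm (upper_integrand m s t) \<le> norm (exp (1 - m) * norm (g t))" for t
  proof -
    have "norm (upper_integrand m s t) \<le> exp (1 - m) * norm (upper_integrand 1 (of_real x) t)"
      using m by (intro norm_upper_integrand_mono) (auto simp: x_def)
    also have "\<dots> \<le> exp (1 - m) * norm (g t)"
      by (intro mult_left_mono) (auto simp: upper_integrand_def g_def indicator_def)
    finally show ?thesis by simp
  qed
  show ?thesis
    by (rule Bochner_Integration.integrable_bound[OF int]) (simp, rule AE_I2, rule le)
qed

lemma norm_upper_integral_le:
  assumes "m \<ge> 1" "Re s \<le> x"
  shows "norm (upper_integral m s) \<le> exp (1 - m) * (\<integral>t. norm (upper_integrand 1 (of_real x) t) \<partial>lborel)"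
proof -
  have "norm (upper_integral m s) \<le> (\<integral>t. norm (upper_integrand m s t) \<partial>lborel)"
    unfolding upper_integral_def by (rule integral_norm_bound)
  also have "\<dots> \<le> (\<integral>t. exp (1 - m) * norm (upper_integrand 1 (of_real x) t) \<partial>lborel)"
    using assms by (intro integral_mono integrable_mult_right integrable_norm integrable_upper_integrand norm_upper_integrand_mono) auto
  finally show ?thesis by simp
qed

text \<open>Expanding \<open>t powr (s - 1) = exp ((s - 1) * ln t)\<close> under the integral gives a power series in \<open>s - 1\<close>.\<close>
lemma holomorphic_upper_integral:
  assumes m: "m \<ge> 1"
  shows "upper_integral m holomorphic_on A"
proof -
  define c where "c = (\<lambda>n t. indicator {1..} t *\<^sub>R complex_of_real (ln t ^ n / fact n * exp (-(m * t))))"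
  have c_meas: "c n \<in> borel_measurable lborel" for n
    unfolding c_def measurable_lborel2
    by (intro borel_measurable_continuous_on_indicator) (auto intro!: continuous_intros)
  have powr_eq: "complex_of_real t powr z = exp (z * of_real (ln t))" if "t \<ge> 1" for t z
    using that by (simp add: powr_def Ln_of_real)
  have sums: "(\<lambda>n. c n t * (s - 1) ^ n) sums upper_integrand m s t" for s t
  proof (cases "t \<ge> 1")
    case True
    have "(\<lambda>n. ((s - 1) * of_real (ln t)) ^ n /\<^sub>R fact n) sums exp ((s - 1) * of_real (ln t))"
      by (rule exp_converges)
    hence "(\<lambda>n. ((s - 1) * of_real (ln t)) ^ n /\<^sub>R fact n * of_real (exp (-(m * t)))) sums (exp ((s - 1) * of_real (ln t)) * of_real (exp (-(m * t))))"
      by (rule sums_mult2)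
    moreover have "((s - 1) * of_real (ln t)) ^ n /\<^sub>R fact n * of_real (exp (-(m * t))) = c n t * (s - 1) ^ n" for n
      using True by (simp add: c_def scaleR_conv_of_real power_mult_distrib divide_simps)
    ultimately show ?thesis
      using True by (simp add: upper_integrand_def powr_eq)
  qed (simp add: c_def upper_integrand_def)
  \<comment> \<open>The absolute values of the terms add up to the same integrand at the real
    exponent \<open>1 + norm (s - 1)\<close>, because \<open>ln t \<ge> 0\<close>. That integrand
    dominates all partial sums.\<close>
  have norm_sums: "(\<lambda>n. norm (c n t * (s - 1) ^ n)) sums norm (upper_integrand m (of_real (1 + norm (s - 1))) t)" for s t
  proof -
    have "(\<lambda>n. Re (c n t * (of_real (1 + norm (s - 1)) - 1) ^ n)) sums Re (upper_integrand m (of_real (1 + norm (s - 1))) t)"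
      by (intro sums_Re sums)
    moreover have "Re (c n t * (of_real (1 + norm (s - 1)) - 1) ^ n) = norm (c n t * (s - 1) ^ n)" for n
    proof (cases "t \<ge> 1")
      case True
      hence "c n t * (of_real (1 + norm (s - 1)) - 1) ^ n = of_real (ln t ^ n / fact n * exp (-(m * t)) * norm (s - 1) ^ n)"
        by (simp add: c_def)
      moreover have "norm (c n t * (s - 1) ^ n) = ln t ^ n / fact n * exp (-(m * t)) * norm (s - 1) ^ n"
        using True by (simp add: c_def norm_mult norm_power norm_divide)
      ultimately show ?thesis
        by (simp only: Re_complex_of_real)
    qed (simp add: c_def)
    moreover have "Re (upper_integrand m (of_real (1 + norm (s - 1))) t) = norm (upper_integrand m (of_real (1 + norm (s - 1))) t)"
    proof (cases "t \<ge> 1")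
      case True
      hence "upper_integrand m (of_real (1 + norm (s - 1))) t = of_real (t powr norm (s - 1) * exp (-(m * t)))"
        by (simp add: upper_integrand_def powr_of_real)
      thus ?thesis
        by (simp only: Re_complex_of_real norm_of_real) simp
    qed (simp add: upper_integrand_def)
    ultimately show ?thesis by simp
  qed
  have int: "integrable lborel (\<lambda>t. c n t * (s - 1) ^ n)" for n s
  proof (rule Bochner_Integration.integrable_bound)
    show "integrable lborel (upper_integrand m (of_real (1 + norm (s - 1))))"
      by (rule integrable_upper_integrand[OF m])
    have "norm (c n t * (s - 1) ^ n) \<le> norm (upper_integrand m (of_real (1 + norm (s - 1))) t)" for t
      using sum_le_suminf[OF sums_summable[OF norm_sums[of t s]], of "{n}"] sums_unique[OF norm_sums[of t s]] by simp
    thus "AE t in lborel. norm (c n t * (s - 1) ^ n) \<le> norm (upper_integrand m (of_real (1 + norm (s - 1))) t)"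
      by simp
  qed (intro borel_measurable_times c_meas borel_measurable_const)
  have ps: "(\<lambda>n. integral\<^sup>L lborel (c n) * (s - 1) ^ n) sums upper_integral m s" for s
  proof -
    have "summable (\<lambda>n. \<integral>t. norm (c n t * (s - 1) ^ n) \<partial>lborel)"
    proof (rule bounded_imp_summable)
      fix N
      have "(\<Sum>n\<le>N. \<integral>t. norm (c n t * (s - 1) ^ n) \<partial>lborel) = (\<integral>t. (\<Sum>n\<le>N. norm (c n t * (s - 1) ^ n)) \<partial>lborel)"
        by (intro Bochner_Integration.integral_sum[symmetric] integrable_norm int)
      also have "\<dots> \<le> (\<integral>t. norm (upper_integrand m (of_real (1 + norm (s - 1))) t) \<partial>lborel)"
      proof (intro integral_mono Bochner_Integration.integrable_sum integrable_norm int integrable_upper_integrand m)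
        fix t
        show "(\<Sum>n\<le>N. norm (c n t * (s - 1) ^ n)) \<le> norm (upper_integrand m (of_real (1 + norm (s - 1))) t)"
          using sum_le_suminf[OF sums_summable[OF norm_sums[of t s]], of "{..N}"] sums_unique[OF norm_sums[of t s]] by simp
      qed
      finally show "(\<Sum>n\<le>N. \<integral>t. norm (c n t * (s - 1) ^ n) \<partial>lborel) \<le> \<dots>" .
    qed auto
    moreover have "AE t in lborel. summable (\<lambda>n. norm (c n t * (s - 1) ^ n))"
      using sums_summable[OF norm_sums] by simp
    ultimately have "(\<lambda>n. \<integral>t. c n t * (s - 1) ^ n \<partial>lborel) sums (\<integral>t. (\<Sum>n. c n t * (s - 1) ^ n) \<partial>lborel)"
      by (intro sums_integral int)
    also have "(\<lambda>t. \<Sum>n. c n t * (s - 1) ^ n) = upper_integrand m s"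
      using sums by (simp add: fun_eq_iff sums_iff)
    finally show ?thesis
      by (simp add: upper_integral_def)
  qed
  have "upper_integral m field_differentiable at s" for s
  proof -
    have "upper_integral m holomorphic_on ball 1 (norm (s - 1) + 1)"
      by (rule power_series_holomorphic) (rule ps)
    moreover have "s \<in> ball 1 (norm (s - 1) + 1)"
      by (simp add: dist_norm norm_minus_commute)
    ultimately show ?thesis
      by (meson holomorphic_on_imp_differentiable_at open_ball)
  qed
  thus ?thesis
    by (simp add: holomorphic_on_def field_differentiable_at_within)
qed

definition omega_upper_term :: "complex \<Rightarrow> nat \<times> nat \<Rightarrow> complex" where
  "omega_upper_term s = (\<lambda>(j, k). of_nat j powr (-s) * of_nat k powr (-s) * upper_integral (real (j + k)) s)"

definition omega_upper :: "complex \<Rightarrow> complex" where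
  "omega_upper s = (\<Sum>\<^sub>\<infinity>p. omega_upper_term s p)"

lemma omega_upper_term_bound:
  "\<exists>M. M summable_on UNIV \<and> (\<forall>\<^sub>F w in nhds s. \<forall>p\<in>UNIV. norm (omega_upper_term w p) \<le> M p)"
proof -
  define x where "x = Re s + 1"
  \<comment> \<open>In the neighbourhood chosen below \<open>Re w > Re s - 1\<close>, so
    \<open>P\<close> bounds \<open>- Re w\<close> throughout.\<close>
  obtain P :: nat where P: "1 - Re s \<le> real P"
    using real_arch_simple by blast
  define K where "K = exp 1 * (\<integral>t. norm (upper_integrand 1 (of_real x) t) \<partial>lborel)"
  have K: "K \<ge> 0"
    by (simp add: K_def)
  define g where "g = (\<lambda>n. real n ^ P * exp (- real n))"
  have "summable (\<lambda>n. real (Suc n) ^ P * exp (-1) ^ n)"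
    by (rule summable_Suc_power_mult_power) simp
  hence "summable g"
  proof (rule summable_comparison_test'[where N = 0])
    fix n
    have "real n ^ P \<le> real (Suc n) ^ P"
      by (intro power_mono) auto
    thus "norm (g n) \<le> real (Suc n) ^ P * exp (-1) ^ n"
      by (simp add: g_def abs_mult flip: exp_of_nat_mult)
  qed
  hence g: "g summable_on UNIV"
    by (subst summable_on_UNIV_nonneg_real_iff) (auto simp: g_def)
  have "(\<lambda>(j, k). g j * g k) summable_on UNIV"
    by (intro summable_on_nonneg_product g) (auto simp: g_def)
  hence M: "(\<lambda>p. K * (case p of (j, k) \<Rightarrow> g j * g k)) summable_on UNIV"
    by (rule summable_on_cmult_right)
  have "\<forall>\<^sub>F w in nhds s. w \<in> {w. Re w > Re s - 1} \<inter> {w. Re w < x}"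
    by (intro eventually_nhds_in_open open_Int open_halfspace_Re_gt open_halfspace_Re_lt) (auto simp: x_def)
  hence "\<forall>\<^sub>F w in nhds s. \<forall>p\<in>UNIV. norm (omega_upper_term w p) \<le> K * (case p of (j, k) \<Rightarrow> g j * g k)"
  proof eventually_elim
    case (elim w)
    have "norm (omega_upper_term w (j, k)) \<le> K * (g j * g k)" for j k
    proof (cases "j = 0")
      case True
      thus ?thesis
        using K by (simp add: omega_upper_term_def g_def)
    next
      case False
      have "norm (upper_integral (real (j + k)) w) \<le> exp (1 - real (j + k)) * (\<integral>t. norm (upper_integrand 1 (of_real x) t) \<partial>lborel)"
        using False elim by (intro norm_upper_integral_le) auto
      also have "\<dots> = K * (exp (- real j) * exp (- real k))"
        by (simp add: K_def exp_diff exp_add exp_minus field_simps)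
      finally have "norm (omega_upper_term w (j, k)) \<le> real j ^ P * real k ^ P * (K * (exp (- real j) * exp (- real k)))"
        using elim P unfolding omega_upper_term_def prod.case norm_mult
        by (intro mult_mono norm_nat_powr_le) auto
      thus ?thesis
        by (simp add: g_def mult_ac)
    qed
    thus ?case by auto
  qed
  with M show ?thesis
    by blast
qed

lemma summable_omega_upper_term: "omega_upper_term s summable_on UNIV"
proof -
  obtain M where M: "M summable_on UNIV" "\<forall>\<^sub>F w in nhds s. \<forall>p\<in>UNIV. norm (omega_upper_term w p) \<le> M p"
    using omega_upper_term_bound by blast
  have "(\<lambda>p. norm (omega_upper_term s p)) summable_on UNIV"
    by (rule Infinite_Sum.abs_summable_on_comparison_test'[OF M(1)]) (use eventually_nhds_x_imp_x[OF M(2)] in auto)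
  thus ?thesis
    by (rule abs_summable_summable)
qed

lemma holomorphic_omega_upper: "omega_upper holomorphic_on UNIV"
  unfolding omega_upper_def[abs_def]
proof (rule holomorphic_infsum)
  show "(\<lambda>s. omega_upper_term s p) holomorphic_on UNIV" for p
  proof (cases p)
    case (Pair j k)
    show ?thesis
    proof (cases "j = 0")
      case False
      thus ?thesis
        unfolding omega_upper_term_def Pair prod.case
        by (intro holomorphic_intros holomorphic_upper_integral) auto
    qed (simp add: omega_upper_term_def Pair)
  qed
  show "\<exists>M. M summable_on UNIV \<and> (\<forall>\<^sub>F w in nhds s. \<forall>p\<in>UNIV. norm (omega_upper_term w p) \<le> M p)" for s
    by (rule omega_upper_term_bound)
qed auto

section \<open>The Mellin integral over 0 < t < 1\<close>

definition lower_integrand :: "real \<Rightarrow> complex \<Rightarrow> real \<Rightarrow> complex" where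
  "lower_integrand m s t = indicator {0<..<1} t *\<^sub>R (of_real t powr (s - 1) * of_real (exp (-(m * t))))"

lemma Gamma_split:
  assumes s: "Re s > 0" and m: "m \<ge> 1"
  shows "integrable lborel (lower_integrand m s)"
    and "Gamma s * of_real m powr (-s) = integral\<^sup>L lborel (lower_integrand m s) + upper_integral m s"
proof -
  let ?g = "\<lambda>t. indicator {0<..} t *\<^sub>R (complex_of_real t powr (s - 1) * of_real (exp (-(m * t))))"
  have g: "has_bochner_integral lborel ?g (Gamma s * of_real m powr (-s))"
    using has_bochner_integral_Gamma[of s m] assms by simp
  have u: "integrable lborel (upper_integrand m s)"
    by (rule integrable_upper_integrand[OF m])
  have eq: "lower_integrand m s = (\<lambda>t. ?g t - upper_integrand m s t)"
    by (auto simp: fun_eq_iff lower_integrand_def upper_integrand_def indicator_def)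
  show "integrable lborel (lower_integrand m s)"
    unfolding eq using g u by (intro Bochner_Integration.integrable_diff) (auto simp: has_bochner_integral_iff)
  have "integral\<^sup>L lborel (lower_integrand m s) = Gamma s * of_real m powr (-s) - upper_integral m s"
    unfolding eq upper_integral_def using g u by (subst Bochner_Integration.integral_diff) (auto simp: has_bochner_integral_iff)
  thus "Gamma s * of_real m powr (-s) = integral\<^sup>L lborel (lower_integrand m s) + upper_integral m s"
    by simp
qed

definition omega_lower_term :: "complex \<Rightarrow> nat \<times> nat \<Rightarrow> complex" where
  "omega_lower_term s = (\<lambda>(j, k). of_nat j powr (-s) * of_nat k powr (-s) * integral\<^sup>L lborel (lower_integrand (real (j + k)) s))"

lemma Gamma_omega_term:
  assumes s: "Re s > 0"
  shows "Gamma s * omega_term s p = omega_upper_term s p + omega_lower_term s p"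
proof (cases p)
  case (Pair j k)
  show ?thesis
  proof (cases "j = 0")
    case True
    thus ?thesis
      by (simp add: Pair omega_term_def omega_upper_term_def omega_lower_term_def)
  next
    case False
    have "Gamma s * omega_term s (j, k) = of_nat j powr (-s) * of_nat k powr (-s) * (Gamma s * of_real (real (j + k)) powr (-s))"
      by (simp add: omega_term_eq)
    also have "Gamma s * of_real (real (j + k)) powr (-s) =
        integral\<^sup>L lborel (lower_integrand (real (j + k)) s) + upper_integral (real (j + k)) s"
      by (rule Gamma_split) (use s False in auto)
    finally show ?thesis
      by (simp add: Pair omega_upper_term_def omega_lower_term_def algebra_simps)
  qed
qed

lemma summable_omega_lower_term:
  assumes s: "Re s > 2 / 3"
  shows "omega_lower_term s summable_on UNIV"
proof -
  have "(\<lambda>p. Gamma s * omega_term s p + (- omega_upper_term s p)) summable_on UNIV"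
    by (intro summable_on_add summable_on_uminus[THEN iffD2] summable_on_cmult_right summable_omega_term summable_omega_upper_term s)
  also have "(\<lambda>p. Gamma s * omega_term s p + (- omega_upper_term s p)) = omega_lower_term s"
    using Gamma_omega_term[of s] s by (simp add: fun_eq_iff)
  finally show ?thesis .
qed

lemma Gamma_omega_series_split:
  assumes s: "Re s > 2 / 3"
  shows "Gamma s * omega_series s = omega_upper s + (\<Sum>\<^sub>\<infinity>p. omega_lower_term s p)"
proof -
  have "Gamma s * omega_series s = (\<Sum>\<^sub>\<infinity>p. Gamma s * omega_term s p)"
    unfolding omega_series_eq by (rule infsum_cmult_right'[symmetric])
  also have "\<dots> = (\<Sum>\<^sub>\<infinity>p. omega_upper_term s p + omega_lower_term s p)"
    using Gamma_omega_term[of s] s by simp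
  also have "\<dots> = omega_upper s + (\<Sum>\<^sub>\<infinity>p. omega_lower_term s p)"
    unfolding omega_upper_def by (intro infsum_add summable_omega_upper_term summable_omega_lower_term s)
  finally show ?thesis .
qed

lemma polylog_square_has_sum:
  assumes z: "norm z < 1"
  shows "((\<lambda>(j, k). (of_nat j powr (-s) * z ^ j) * (of_nat k powr (-s) * z ^ k)) has_sum (polylog s z)\<^sup>2) UNIV"
    and "(\<lambda>(j, k). norm ((of_nat j powr (-s) * z ^ j) * (of_nat k powr (-s) * z ^ k))) summable_on UNIV"
proof -
  define x where "x = (\<lambda>n. of_nat n powr (-s) * z ^ n)"
  have x: "(x has_sum polylog s z) UNIV"
    unfolding x_def by (intro norm_summable_imp_has_sum summable_norm_polylog sums_polylog z)
  have "(\<lambda>n. norm (x n)) summable_on UNIV"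
    using summable_norm_polylog[OF z, of s] by (simp add: x_def summable_on_UNIV_nonneg_real_iff)
  hence abs: "(\<lambda>(j, k). norm (x j) * norm (x k)) summable_on UNIV"
    by (intro summable_on_nonneg_product) auto
  thus "(\<lambda>(j, k). norm ((of_nat j powr (-s) * z ^ j) * (of_nat k powr (-s) * z ^ k))) summable_on UNIV"
    unfolding x_def norm_mult by simp
  have summable: "(\<lambda>(j, k). x j * x k) summable_on UNIV \<times> UNIV"
    by (rule abs_summable_summable[OF back_subst[of "\<lambda>f. f summable_on UNIV \<times> UNIV"]])
       (use abs in \<open>auto simp: fun_eq_iff norm_mult\<close>)
  have "(\<Sum>\<^sub>\<infinity>(j, k)\<in>UNIV \<times> UNIV. x j * x k) = (\<Sum>\<^sub>\<infinity>j. \<Sum>\<^sub>\<infinity>k. x j * x k)"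
    by (rule infsum_Sigma'_banach[OF summable, symmetric])
  also have "\<dots> = (\<Sum>\<^sub>\<infinity>j. x j * polylog s z)"
    using infsumI[OF x] by (simp add: infsum_cmult_right')
  also have "\<dots> = (polylog s z)\<^sup>2"
    using infsumI[OF x] by (simp add: infsum_cmult_left' power2_eq_square)
  finally show "((\<lambda>(j, k). (of_nat j powr (-s) * z ^ j) * (of_nat k powr (-s) * z ^ k)) has_sum (polylog s z)\<^sup>2) UNIV"
    using has_sum_infsum[OF summable] by (simp add: x_def)
qed

lemma has_sum_prod_decode:
  "(f has_sum S) UNIV \<longleftrightarrow> ((\<lambda>i. f (prod_decode i)) has_sum S) UNIV"
  using has_sum_reindex_bij_betw[OF bij_prod_decode, of f S] by simp

text \<open>For real \<open>s\<close> every summand is nonnegative, so the integrals of the norms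
  are the norms of the integrals, and summability of the latter justifies the exchange. Pairs are
  enumerated by \<open>prod_decode\<close> because the convergence theorem concerns
  sequences.\<close>

lemma omega_lower_infsum:
  fixes s :: real
  assumes s: "s > 2 / 3"
  shows "has_bochner_integral lborel 
           (\<lambda>t. indicator {0<..<1} t *\<^sub>R (of_real t powr (of_real s - 1) * (polylog (of_real s) (exp (- of_real t)))\<^sup>2))
           (\<Sum>\<^sub>\<infinity>p. omega_lower_term (of_real s) p)"
proof -
  define f where "f = (\<lambda>p t. case p of (j, k) \<Rightarrow>
    of_nat j powr (- of_real s) * of_nat k powr (- of_real s) * lower_integrand (real (j + k)) (of_real s) t)"
  let ?f = "\<lambda>i. f (prod_decode i)"
  have int: "integrable lborel (f p)" for p
  proof (cases p)
    case (Pair j k)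
    show ?thesis
    proof (cases "j = 0")
      case False
      thus ?thesis
        unfolding Pair f_def prod.case using s by (intro integrable_mult_right Gamma_split(1)) auto
    qed (simp add: Pair f_def)
  qed
  have integral: "integral\<^sup>L lborel (f p) = omega_lower_term (of_real s) p" for p
    by (cases p) (simp add: f_def omega_lower_term_def)
  have f_norm: "f p t = of_real (norm (f p t))" for p t
  proof -
    have "\<exists>x\<ge>0. f p t = of_real x"
    proof (cases p)
      case (Pair j k)
      have "f p t = of_real (real j powr (-s) * real k powr (-s) * (indicator {0<..<1} t * (t powr (s - 1) * exp (-((real j + real k) * t)))))"
        by (simp add: Pair f_def lower_integrand_def of_nat_powr_of_real powr_of_real_minus_one indicator_def)
      thus ?thesis
        by (intro exI[of _ "real j powr (-s) * real k powr (-s) * (indicator {0<..<1} t * (t powr (s - 1) * exp (-((real j + real k) * t))))"]) auto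
    qed
    thus ?thesis by auto
  qed
  have norm_integral: "(\<integral>t. norm (f p t) \<partial>lborel) = norm (omega_lower_term (of_real s) p)" for p
  proof -
    have "omega_lower_term (of_real s) p = of_real (\<integral>t. norm (f p t) \<partial>lborel)"
      unfolding integral[symmetric] integral_complex_of_real[symmetric] by (simp flip: f_norm)
    thus ?thesis
      by (simp only: norm_of_real) (simp add: integral_nonneg_AE)
  qed
  have lower: "(omega_lower_term (of_real s) has_sum (\<Sum>\<^sub>\<infinity>p. omega_lower_term (of_real s) p)) UNIV"
    using summable_omega_lower_term[of "of_real s"] s by (intro has_sum_infsum) auto
  hence lower': "((\<lambda>i. omega_lower_term (of_real s) (prod_decode i)) has_sum (\<Sum>\<^sub>\<infinity>p. omega_lower_term (of_real s) p)) UNIV"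
    by (subst (asm) has_sum_prod_decode)
  hence "(\<lambda>i. omega_lower_term (of_real s) (prod_decode i)) summable_on UNIV"
    by (rule has_sum_imp_summable)
  hence "(\<lambda>i. norm (omega_lower_term (of_real s) (prod_decode i))) summable_on UNIV"
    by (subst (asm) summable_on_iff_abs_summable_on_complex)
  hence summable: "summable (\<lambda>i. \<integral>t. norm (?f i t) \<partial>lborel)"
    unfolding norm_integral by (simp add: summable_on_UNIV_nonneg_real_iff)
  let ?h = "\<lambda>t. indicator {0<..<1} t *\<^sub>R (complex_of_real t powr (of_real s - 1) * (polylog (of_real s) (exp (- of_real t)))\<^sup>2)"
  have pointwise: "(\<lambda>i. ?f i t) sums ?h t \<and> summable (\<lambda>i. norm (?f i t))" for t
  proof (cases "t \<in> {0<..<1}")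
    case True
    define z where "z = exp (- complex_of_real t)"
    have z: "norm z < 1"
      using True by (simp add: z_def)
    have zpow: "z ^ n = exp (- of_real (real n * t))" for n
      by (simp add: z_def flip: exp_of_nat_mult)
    have f_eq: "f p t = of_real t powr (of_real s - 1) * (case p of (j, k) \<Rightarrow> (of_nat j powr (- of_real s) * z ^ j) * (of_nat k powr (- of_real s) * z ^ k))" for p
    proof (cases p)
      case (Pair j k)
      have "complex_of_real (exp (-(real (j + k) * t))) = z ^ j * z ^ k"
        unfolding zpow by (simp add: algebra_simps exp_of_real flip: exp_add of_real_minus of_real_mult)
      thus ?thesis
        using True by (simp add: Pair f_def lower_integrand_def)
    qed
    have "((\<lambda>p. f p t) has_sum (of_real t powr (of_real s - 1) * (polylog (of_real s) z)\<^sup>2)) UNIV"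
      unfolding f_eq by (intro has_sum_cmult_right polylog_square_has_sum z)
    hence *: "((\<lambda>i. ?f i t) has_sum ?h t) UNIV"
      using True by (subst (asm) has_sum_prod_decode) (simp add: z_def)
    hence "(\<lambda>i. norm (?f i t)) summable_on UNIV"
      using has_sum_imp_summable[OF *] by (subst (asm) summable_on_iff_abs_summable_on_complex)
    hence "summable (\<lambda>i. norm (?f i t))"
      by (simp add: summable_on_UNIV_nonneg_real_iff)
    with has_sum_imp_sums[OF *] show ?thesis
      by simp
  next
    case False
    hence "f p t = 0" for p
      by (auto simp: f_def lower_integrand_def split: prod.splits)
    thus ?thesis
      using False by simp
  qed
  have 1: "integrable lborel (\<lambda>t. \<Sum>i. ?f i t)"
    by (intro integrable_suminf int summable) (use pointwise in auto)
  have 2: "(\<lambda>i. integral\<^sup>L lborel (?f i)) sums (\<integral>t. (\<Sum>i. ?f i t) \<partial>lborel)"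
    by (intro sums_integral int summable) (use pointwise in auto)
  have "(\<lambda>t. \<Sum>i. ?f i t) = ?h"
    using pointwise by (simp add: fun_eq_iff sums_iff)
  moreover from 2 has_sum_imp_sums[OF lower'] have "(\<integral>t. (\<Sum>i. ?f i t) \<partial>lborel) = (\<Sum>\<^sub>\<infinity>p. omega_lower_term (of_real s) p)"
    unfolding integral by (rule sums_unique2)
  ultimately show ?thesis
    using 1 by (simp add: has_bochner_integral_iff)
qed

lemma has_bochner_integral_powr_unit:
  fixes p :: real
  assumes p: "p > -1"
  shows "has_bochner_integral lborel (\<lambda>t. indicator {0<..<1} t * t powr p) (1 / (p + 1))"
proof -
  let ?f = "\<lambda>t::real. indicator {0<..<1} t * t powr p"
  have meas: "?f \<in> borel_measurable lborel"
    by simp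
  have "((\<lambda>t. t powr p) has_integral (1 / (p + 1))) {0..1}"
    using has_integral_powr_from_0[OF p, of 1] by simp
  hence hi: "((\<lambda>t. t powr p) has_integral (1 / (p + 1))) {0<..<1}"
    by (simp add: has_integral_Icc_iff_Ioo)
  have ai: "(\<lambda>t. t powr p) absolutely_integrable_on {0<..<1}"
    using hi by (intro nonnegative_absolutely_integrable_1) (auto simp: has_integral_iff)
  hence "integrable lebesgue ?f"
    by (simp add: set_integrable_def)
  moreover have "set_lebesgue_integral lebesgue {0<..<1} (\<lambda>t. t powr p) = 1 / (p + 1)"
    using set_lebesgue_integral_eq_integral(2)[OF ai] hi by (simp add: has_integral_iff)
  hence "integral\<^sup>L lebesgue ?f = 1 / (p + 1)"
    by (simp add: set_lebesgue_integral_def)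
  ultimately show ?thesis
    using meas by (simp add: has_bochner_integral_iff integrable_completion integral_completion)
qed

text \<open>The source of the poles: \<open>t powr (p + n)\<close> integrates to
  \<open>1 / (p + 1 + n)\<close>. Absolute convergence of the series at t = 1 permits termwise
  integration.\<close>

lemma has_bochner_integral_power_series_unit:
  fixes d :: "nat \<Rightarrow> complex" and p :: real
  assumes p: "p > -1" and d: "summable (\<lambda>n. norm (d n))"
  shows "has_bochner_integral lborel
           (\<lambda>t. indicator {0<..<1} t *\<^sub>R (of_real (t powr p) * (\<Sum>n. d n * of_real t ^ n)))
           (\<Sum>n. d n / of_real (p + 1 + real n))"
proof -
  define f where "f = (\<lambda>n t. d n * complex_of_real (indicator {0<..<1} t * t powr (p + real n)))"
  have f: "has_bochner_integral lborel (f n) (d n / of_real (p + 1 + real n))" for n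
  proof -
    have "has_bochner_integral lborel (\<lambda>t. indicator {0<..<1} t * t powr (p + real n)) (1 / (p + real n + 1))"
      using p by (intro has_bochner_integral_powr_unit) auto
    hence "has_bochner_integral lborel (f n) (d n * of_real (1 / (p + real n + 1)))"
      unfolding f_def by (intro has_bochner_integral_mult_right has_bochner_integral_of_real)
    thus ?thesis
      by (simp add: add_ac)
  qed
  have norm_f: "(\<integral>t. norm (f n t) \<partial>lborel) = norm (d n) / (p + 1 + real n)" for n
  proof -
    have "has_bochner_integral lborel (\<lambda>t. norm (d n) * (indicator {0<..<1} t * t powr (p + real n))) (norm (d n) * (1 / (p + real n + 1)))"
      using p by (intro has_bochner_integral_mult_right has_bochner_integral_powr_unit) auto
    also have "(\<lambda>t. norm (d n) * (indicator {0<..<1} t * t powr (p + real n))) = (\<lambda>t. norm (f n t))"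
      by (auto simp: f_def norm_mult indicator_def)
    finally show ?thesis
      by (simp add: has_bochner_integral_iff add_ac)
  qed
  have summable: "summable (\<lambda>n. \<integral>t. norm (f n t) \<partial>lborel)"
  proof (rule summable_comparison_test'[where N = 0])
    show "summable (\<lambda>n. norm (d n) / (p + 1))"
      by (intro summable_divide d)
    show "norm (\<integral>t. norm (f n t) \<partial>lborel) \<le> norm (d n) / (p + 1)" for n
      unfolding norm_f using p by (auto intro!: divide_left_mono mult_pos_pos)
  qed
  let ?h = "\<lambda>t. indicator {0<..<1} t *\<^sub>R (of_real (t powr p) * (\<Sum>n. d n * of_real t ^ n))"
  have pointwise: "(\<lambda>n. f n t) sums ?h t \<and> summable (\<lambda>n. norm (f n t))" for t
  proof (cases "t \<in> {0<..<1}")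
    case True
    have f_eq: "f n t = of_real (t powr p) * (d n * of_real t ^ n)" for n
      using True by (simp add: f_def powr_add powr_realpow)
    have le: "norm (d n * of_real t ^ n) \<le> norm (d n)" for n
      using True by (auto simp: norm_mult norm_power intro!: mult_left_le power_le_one)
    have sm: "summable (\<lambda>n. norm (d n * of_real t ^ n))"
      by (rule summable_comparison_test'[where N = 0, OF d]) (use le in auto)
    have "(\<lambda>n. f n t) sums (of_real (t powr p) * (\<Sum>n. d n * of_real t ^ n))"
      unfolding f_eq by (intro sums_mult summable_sums summable_norm_cancel[OF sm])
    moreover have "summable (\<lambda>n. norm (f n t))"
      unfolding f_eq norm_mult[of "of_real (t powr p)"] by (intro summable_mult sm)
    ultimately show ?thesis
      using True by simp
  next
    case False
    hence "f n t = 0" for n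
      by (auto simp: f_def)
    thus ?thesis
      using False by simp
  qed
  have int: "integrable lborel (f n)" for n
    using f by (simp add: has_bochner_integral_iff)
  have 1: "integrable lborel (\<lambda>t. \<Sum>n. f n t)"
    by (intro integrable_suminf int summable) (use pointwise in auto)
  have 2: "(\<lambda>n. integral\<^sup>L lborel (f n)) sums (\<integral>t. (\<Sum>n. f n t) \<partial>lborel)"
    by (intro sums_integral int summable) (use pointwise in auto)
  have "(\<lambda>t. \<Sum>n. f n t) = ?h"
    using pointwise by (simp add: fun_eq_iff sums_iff)
  moreover have "(\<integral>t. (\<Sum>n. f n t) \<partial>lborel) = (\<Sum>n. d n / of_real (p + 1 + real n))"
    using 2 f by (simp add: sums_iff has_bochner_integral_iff)
  ultimately show ?thesis
    using 1 by (simp add: has_bochner_integral_iff)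
qed

definition zeta_conv :: "nat \<Rightarrow> complex \<Rightarrow> complex" where
  "zeta_conv n s = (\<Sum>i\<le>n. zeta_coeff i s * zeta_coeff (n - i) s)"

lemma summable_norm_zeta_coeff': "Re s < 1 \<Longrightarrow> summable (\<lambda>n. norm (zeta_coeff n s))"
  using summable_norm_zeta_coeff[of s 1] by simp

lemma zeta_conv_bound:
  assumes s: "Re s < 1"
  shows "\<exists>M. summable M \<and> (\<forall>\<^sub>F w in nhds s. \<forall>n. norm (zeta_conv n w) \<le> M n)"
proof -
  obtain C where C: "\<forall>\<^sub>F w in nhds s. \<forall>n. norm (zeta_coeff n w) \<le> C * (1 / 2) ^ n"
    using zeta_coeff_bound[OF s] by blast
  let ?M = "\<lambda>n. C\<^sup>2 * (real (Suc n) ^ 1 * (1 / 2) ^ n)"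
  have "summable ?M"
    by (intro summable_mult summable_Suc_power_mult_power) auto
  moreover from C have "\<forall>\<^sub>F w in nhds s. \<forall>n. norm (zeta_conv n w) \<le> ?M n"
  proof eventually_elim
    case (elim w)
    show ?case
    proof
      fix n
      have "norm (zeta_conv n w) \<le> (\<Sum>i\<le>n. C\<^sup>2 * (1 / 2) ^ n)"
        unfolding zeta_conv_def
      proof (rule sum_norm_le)
        fix i assume i: "i \<in> {..n}"
        have "norm (zeta_coeff i w * zeta_coeff (n - i) w) \<le> (C * (1 / 2) ^ i) * (C * (1 / 2) ^ (n - i))"
          unfolding norm_mult using elim by (intro mult_mono) (auto intro: order_trans[OF norm_ge_zero])
        also have "\<dots> = C\<^sup>2 * ((1 / 2) ^ i * (1 / 2) ^ (n - i))"
          by (simp only: power2_eq_square ac_simps)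
        also have "(1 / 2) ^ i * (1 / 2) ^ (n - i) = (1 / 2 :: real) ^ n"
          using i by (simp flip: power_add)
        finally show "norm (zeta_coeff i w * zeta_coeff (n - i) w) \<le> C\<^sup>2 * (1 / 2) ^ n" .
      qed
      thus "norm (zeta_conv n w) \<le> ?M n"
        by (simp add: algebra_simps)
    qed
  qed
  ultimately show ?thesis by blast
qed

lemma summable_norm_zeta_conv:
  assumes "Re s < 1"
  shows "summable (\<lambda>n. norm (zeta_conv n s))"
proof -
  obtain M where M: "summable M" "\<forall>\<^sub>F w in nhds s. \<forall>n. norm (zeta_conv n w) \<le> M n"
    using zeta_conv_bound[OF assms] by blast
  show ?thesis
    by (rule summable_comparison_test'[where N = 0, OF M(1)]) (use eventually_nhds_x_imp_x[OF M(2)] in auto)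
qed

lemma zeta_series_square:
  assumes s: "Re s < 1" and t: "norm t < 2"
  shows "(zeta_series s t)\<^sup>2 = (\<Sum>n. zeta_conv n s * t ^ n)"
proof -
  have "(zeta_series s t)\<^sup>2 = (\<Sum>n. \<Sum>i\<le>n. (zeta_coeff i s * t ^ i) * (zeta_coeff (n - i) s * t ^ (n - i)))"
    unfolding power2_eq_square zeta_series_def by (intro Cauchy_product summable_norm_zeta_coeff s t)
  also have "(\<lambda>n. \<Sum>i\<le>n. (zeta_coeff i s * t ^ i) * (zeta_coeff (n - i) s * t ^ (n - i))) = (\<lambda>n. zeta_conv n s * t ^ n)"
  proof
    fix n
    have "(zeta_coeff i s * t ^ i) * (zeta_coeff (n - i) s * t ^ (n - i)) = zeta_coeff i s * zeta_coeff (n - i) s * t ^ n" if "i \<le> n" for i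
    proof -
      have "t ^ i * t ^ (n - i) = t ^ n"
        using that by (simp flip: power_add)
      thus ?thesis
        by (simp add: mult.left_commute mult.assoc)
    qed
    thus "(\<Sum>i\<le>n. (zeta_coeff i s * t ^ i) * (zeta_coeff (n - i) s * t ^ (n - i))) = zeta_conv n s * t ^ n"
      unfolding zeta_conv_def sum_distrib_right by (intro sum.cong) auto
  qed
  finally show ?thesis .
qed

text \<open>The last three terms are the integrals over the unit interval of
  \<open>t powr (s - 1)\<close> times the three parts of
  \<open>(Gamma (1 - s) * t powr (s - 1) + zeta_series s t)\<^sup>2\<close>. The exponents
  \<open>3 * s - 3\<close>, \<open>2 * s - 2 + n\<close> and \<open>s - 1 + n\<close> produce the
  denominators.\<close>

definition omega_poles :: "complex \<Rightarrow> complex" where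
  "omega_poles s = omega_upper s + Gamma (1 - s) ^ 2 / (3 * s - 2) +
     2 * Gamma (1 - s) * (\<Sum>n. zeta_coeff n s / (2 * s - 1 + of_nat n)) +
     (\<Sum>n. zeta_conv n s / (s + of_nat n))"

lemma Gamma_omega_series_real:
  fixes s :: real
  assumes s: "2 / 3 < s" "s < 1"
  shows "Gamma (of_real s) * omega_series (of_real s) = omega_poles (of_real s)"
proof -
  define G where "G = Gamma (1 - complex_of_real s)"
  define c where "c = complex_of_real s"
  have Re: "Re c < 1"
    using s by (simp add: c_def)
  let ?i = "\<lambda>t. indicator {0<..<1} t :: real"
  have i1: "has_bochner_integral lborel (\<lambda>t. G\<^sup>2 * complex_of_real (?i t * t powr (3 * s - 3))) (G\<^sup>2 * of_real (1 / (3 * s - 3 + 1)))"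
    using s by (intro has_bochner_integral_mult_right has_bochner_integral_of_real has_bochner_integral_powr_unit) auto
  have i2: "has_bochner_integral lborel (\<lambda>t. 2 * G * (?i t *\<^sub>R (of_real (t powr (2 * s - 2)) * (\<Sum>n. zeta_coeff n c * of_real t ^ n))))
      (2 * G * (\<Sum>n. zeta_coeff n c / of_real (2 * s - 2 + 1 + real n)))"
    using s Re by (intro has_bochner_integral_mult_right has_bochner_integral_power_series_unit summable_norm_zeta_coeff') auto
  have i3: "has_bochner_integral lborel (\<lambda>t. ?i t *\<^sub>R (of_real (t powr (s - 1)) * (\<Sum>n. zeta_conv n c * of_real t ^ n)))
      (\<Sum>n. zeta_conv n c / of_real (s - 1 + 1 + real n))"
    using s Re by (intro has_bochner_integral_power_series_unit summable_norm_zeta_conv) auto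
  note int = has_bochner_integral_add[OF has_bochner_integral_add[OF i1 i2] i3]
  have "(\<lambda>t. G\<^sup>2 * complex_of_real (?i t * t powr (3 * s - 3)) +
      2 * G * (?i t *\<^sub>R (of_real (t powr (2 * s - 2)) * (\<Sum>n. zeta_coeff n c * of_real t ^ n))) +
      ?i t *\<^sub>R (of_real (t powr (s - 1)) * (\<Sum>n. zeta_conv n c * of_real t ^ n))) =
    (\<lambda>t. ?i t *\<^sub>R (of_real t powr (of_real s - 1) * (polylog (of_real s) (exp (- of_real t)))\<^sup>2))"
    (is "?l = ?r")
  proof
    fix t
    show "?l t = ?r t"
    proof (cases "t \<in> {0<..<1}")
      case True
      define u where "u = complex_of_real (t powr (s - 1))"
      have p: "polylog (of_real s) (exp (- of_real t)) = G * u + zeta_series c (of_real t)"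
        using polylog_expansion_real[of s t] s True
        by (simp add: G_def u_def c_def powr_of_real_minus_one)
      have u2: "complex_of_real (t powr (2 * s - 2)) = u * u" and u3: "complex_of_real (t powr (3 * s - 3)) = u * u * u"
        by (simp_all add: u_def flip: of_real_mult powr_add)
      have z: "(\<Sum>n. zeta_coeff n c * of_real t ^ n) = zeta_series c (of_real t)"
        by (simp add: zeta_series_def)
      have z2: "(\<Sum>n. zeta_conv n c * of_real t ^ n) = (zeta_series c (of_real t))\<^sup>2"
        using True Re by (intro zeta_series_square[symmetric]) auto
      have ut: "complex_of_real t powr (of_real s - 1) = u"
        using True by (simp add: u_def powr_of_real_minus_one)
      have "?l t = G\<^sup>2 * (u * u * u) + 2 * G * (u * u * zeta_series c (of_real t)) + u * (zeta_series c (of_real t))\<^sup>2"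
        unfolding z z2 u2 u_def[symmetric] using True u3 by simp
      moreover have "?r t = u * (G * u + zeta_series c (of_real t))\<^sup>2"
        unfolding p ut using True by simp
      ultimately show ?thesis
        by (simp add: power2_eq_square algebra_simps)
    qed auto
  qed
  with int have "has_bochner_integral lborel ?r (G\<^sup>2 * of_real (1 / (3 * s - 3 + 1)) + 
      2 * G * (\<Sum>n. zeta_coeff n c / of_real (2 * s - 2 + 1 + real n)) + (\<Sum>n. zeta_conv n c / of_real (s - 1 + 1 + real n)))"
    by (simp only:)
  from has_bochner_integral_eq[OF this omega_lower_infsum[OF s(1)]]
  have "(\<Sum>\<^sub>\<infinity>p. omega_lower_term c p) = G\<^sup>2 / (3 * c - 2) + 2 * G * (\<Sum>n. zeta_coeff n c / (2 * c - 1 + of_nat n)) +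
      (\<Sum>n. zeta_conv n c / (c + of_nat n))"
    by (simp add: c_def)
  thus ?thesis
    using Gamma_omega_series_split[of c] s by (simp add: c_def G_def omega_poles_def)
qed

subsection \<open>Poles\<close>

text \<open>At most a simple pole, with residue \<open>r\<close>; the case \<open>r = 0\<close> is a
  removable singularity. Only a punctured neighbourhood matters, so contributions of several
  summands can be added even where they cancel.\<close>

definition simple_part :: "(complex \<Rightarrow> complex) \<Rightarrow> complex \<Rightarrow> complex \<Rightarrow> bool" where
  "simple_part f z r \<longleftrightarrow>
     (\<exists>g. g analytic_on {z} \<and> g z = r \<and> (\<forall>\<^sub>F s in at z. f s = g s / (s - z)))"

lemma simple_part_analytic:
  assumes "f analytic_on {z}"
  shows "simple_part f z 0"
  unfolding simple_part_def
proof (intro exI[of _ "\<lambda>s. f s * (s - z)"] conjI)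
  show "\<forall>\<^sub>F s in at z. f s = f s * (s - z) / (s - z)"
    by (auto simp: eventually_at_filter)
qed (use assms in \<open>auto intro!: analytic_intros\<close>)

lemma simple_part_add:
  assumes "simple_part f z r" "simple_part g z r'"
  shows "simple_part (\<lambda>s. f s + g s) z (r + r')"
proof -
  obtain f' g' where fg: "f' analytic_on {z}" "f' z = r" "\<forall>\<^sub>F s in at z. f s = f' s / (s - z)"
     "g' analytic_on {z}" "g' z = r'" "\<forall>\<^sub>F s in at z. g s = g' s / (s - z)"
    using assms unfolding simple_part_def by blast
  from fg(3,6) have "\<forall>\<^sub>F s in at z. f s + g s = (f' s + g' s) / (s - z)"
    by eventually_elim (simp add: add_divide_distrib)
  thus ?thesis
    using fg unfolding simple_part_def by (intro exI[of _ "\<lambda>s. f' s + g' s"]) (auto intro!: analytic_intros)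
qed

lemma simple_part_mult:
  assumes "h analytic_on {z}" "simple_part f z r"
  shows "simple_part (\<lambda>s. h s * f s) z (h z * r)"
proof -
  obtain f' where f': "f' analytic_on {z}" "f' z = r" "\<forall>\<^sub>F s in at z. f s = f' s / (s - z)"
    using assms unfolding simple_part_def by blast
  from f'(3) have "\<forall>\<^sub>F s in at z. h s * f s = (h s * f' s) / (s - z)"
    by eventually_elim simp
  thus ?thesis
    using f' assms unfolding simple_part_def by (intro exI[of _ "\<lambda>s. h s * f' s"]) (auto intro!: analytic_intros)
qed

lemma simple_part_cong:
  assumes "\<forall>\<^sub>F s in at z. f s = g s" "simple_part g z r"
  shows "simple_part f z r"
proof -
  obtain g' where g': "g' analytic_on {z}" "g' z = r" "\<forall>\<^sub>F s in at z. g s = g' s / (s - z)"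
    using assms unfolding simple_part_def by blast
  from assms(1) g'(3) have "\<forall>\<^sub>F s in at z. f s = g' s / (s - z)"
    by eventually_elim simp
  thus ?thesis
    using g' unfolding simple_part_def by blast
qed

lemma simple_part_meromorphic:
  assumes "simple_part f z r"
  shows "f meromorphic_on {z}"
proof -
  obtain g where g: "g analytic_on {z}" "g z = r" "\<forall>\<^sub>F s in at z. f s = g s / (s - z)"
    using assms unfolding simple_part_def by blast
  have "(\<lambda>s. g s / (s - z)) meromorphic_on {z}"
    using g(1) by (intro meromorphic_intros analytic_on_imp_meromorphic_on) (auto intro!: analytic_intros)
  thus ?thesis
    using g(3) meromorphic_on_cong[of "{z}" f "\<lambda>s. g s / (s - z)" "{z}"] by simp
qed

lemma simple_part_remove_sings:
  assumes "simple_part f z r"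
  shows "simple_part (remove_sings f) z r"
proof (rule simple_part_cong[OF _ assms])
  have "isolated_singularity_at f z"
    using simple_part_meromorphic[OF assms] by (simp add: meromorphic_at_iff)
  thus "\<forall>\<^sub>F s in at z. remove_sings f s = f s"
    by (rule eventually_remove_sings_eq_at)
qed

lemma simple_part_residue:
  assumes "simple_part f z r"
  shows "residue f z = r"
proof -
  obtain g where g: "g analytic_on {z}" "g z = r" "\<forall>\<^sub>F s in at z. f s = g s / (s - z)"
    using assms unfolding simple_part_def by blast
  obtain S where "open S" "z \<in> S" "g holomorphic_on S"
    using g(1) by (auto simp: analytic_at)
  thus ?thesis
    using residue_cong[OF g(3) refl] residue_simple[of S z g] g(2) by simp
qed

lemma simple_part_has_simple_pole:
  assumes "simple_part f z r" "r \<noteq> 0"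
  shows "has_simple_pole f z"
proof -
  obtain g where g: "g analytic_on {z}" "g z = r" "\<forall>\<^sub>F s in at z. f s = g s / (s - z)"
    using assms unfolding simple_part_def by blast
  obtain S where S: "open S" "z \<in> S" "g holomorphic_on S"
    using g(1) by (auto simp: analytic_at)
  obtain T where T: "open T" "z \<in> T" "\<And>s. s \<in> T \<Longrightarrow> s \<noteq> z \<Longrightarrow> f s = g s / (s - z)"
    using g(3) by (auto simp: eventually_at_topological)
  have "zorder f z = -1"
  proof (rule zorder_eqI)
    show "open (S \<inter> T)" "z \<in> S \<inter> T" "g holomorphic_on S \<inter> T" "g z \<noteq> 0"
      using S T g(2) assms(2) by (auto intro: holomorphic_on_subset)
  qed (use T in \<open>auto simp: power_int_minus field_simps\<close>)
  moreover have "is_pole (\<lambda>s. g s / (s - z)) z"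
    using g(1,2) assms(2)
    by (intro is_pole_divide analytic_at_imp_isCont filterlim_atI) (auto intro!: tendsto_eq_intros simp: eventually_at_filter)
  hence "is_pole f z"
    using is_pole_cong[OF g(3) refl] by simp
  moreover have "isolated_singularity_at f z"
    using simple_part_meromorphic[OF assms(1)] by (simp add: meromorphic_at_iff)
  ultimately show ?thesis
    by (simp add: has_simple_pole_def)
qed

text \<open>The numerator vanishes at \<open>z\<close>, so the quotient tends to its derivative
  there.\<close>

lemma simple_part_0_analytic:
  assumes "simple_part f z 0"
  shows "remove_sings f analytic_on {z}"
proof -
  obtain g where g: "g analytic_on {z}" "g z = 0" "\<forall>\<^sub>F s in at z. f s = g s / (s - z)"
    using assms unfolding simple_part_def by blast
  have "g field_differentiable at z"
    using g(1) analytic_on_imp_differentiable_at by blast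
  then obtain D where "(g has_field_derivative D) (at z)"
    by (auto simp: field_differentiable_def)
  hence "((\<lambda>s. g s / (s - z)) \<longlongrightarrow> D) (at z)"
    using g(2) by (simp add: has_field_derivative_iff)
  hence "(f \<longlongrightarrow> D) (at z)"
    using tendsto_cong[OF g(3)] by simp
  moreover have "isolated_singularity_at f z"
    using simple_part_meromorphic[OF assms(1)] by (simp add: meromorphic_at_iff)
  ultimately show ?thesis
    by (intro remove_sings_analytic_at)
qed

section \<open>Series of simple fractions\<close>

context
  fixes U :: "complex set" and d :: "nat \<Rightarrow> complex \<Rightarrow> complex" and a b z0 :: complex
  assumes U: "open U" "z0 \<in> U"
    and hol: "\<And>n. d n holomorphic_on U"
    and dom: "\<And>z. z \<in> U \<Longrightarrow> \<exists>M. summable M \<and> (\<forall>\<^sub>F w in nhds z. \<forall>n. norm (d n w) \<le> M n)"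
begin

text \<open>The naturals form a closed discrete set, so near \<open>z0\<close> the denominators with
  index in \<open>I\<close> stay uniformly away from 0 and a majorant of the numerators suffices.
  The set \<open>I\<close> makes it possible to leave out a term with vanishing denominator.\<close>

lemma pole_sum_analytic:
  assumes I: "\<And>n. n \<in> I \<Longrightarrow> a * z0 + b + of_nat n \<noteq> 0"
  defines "f \<equiv> \<lambda>n s. if n \<in> I then d n s / (a * s + b + of_nat n) else 0"
  shows "(\<lambda>s. \<Sum>n. f n s) analytic_on {z0}"
    and "\<forall>\<^sub>F s in nhds z0. summable (\<lambda>n. f n s)"
proof -
  define c where "c = a * z0 + b"
  have "-c \<notin> of_nat ` I"
  proof
    assume "-c \<in> of_nat ` I"
    then obtain n where "n \<in> I" "-c = of_nat n"
      by blast
    moreover from this have "c + of_nat n = 0"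
      by (metis add.right_inverse)
    ultimately show False
      using I by (simp add: c_def)
  qed
  then obtain e where e: "e > 0" "\<And>n. n \<in> I \<Longrightarrow> e \<le> dist (-c) (of_nat n)"
    using separate_point_closed[of "of_nat ` I" "-c"] closed_of_nat_image[of I] by blast
  have e': "e \<le> norm (c + of_nat n)" if "n \<in> I" for n
  proof -
    have "dist (-c) (of_nat n) = norm (- (c + of_nat n))"
      by (simp add: dist_norm)
    thus ?thesis
      using e(2)[OF that] by (simp only: norm_minus_cancel)
  qed
  define S where "S = {s \<in> U. norm (a * s - a * z0) < e / 2}"
  have S_eq: "S = U \<inter> {s. norm (a * s - a * z0) < e / 2}"
    by (auto simp: S_def)
  have S: "open S" "z0 \<in> S"
    unfolding S_eq using U e(1) by (auto intro!: open_Int open_Collect_less continuous_intros)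
  have denom: "norm (a * s + b + of_nat n) \<ge> e / 2" if "s \<in> S" "n \<in> I" for s n
  proof -
    have "norm (c + of_nat n) \<le> norm (a * s + b + of_nat n) + norm (a * s - a * z0)"
      using norm_triangle_ineq4[of "a * s + b + of_nat n" "a * s - a * z0"] by (simp add: c_def algebra_simps)
    thus ?thesis
      using that e'[OF that(2)] by (auto simp: S_def)
  qed
  have bound: "\<exists>M. summable M \<and> (\<forall>\<^sub>F w in nhds z. \<forall>n. norm (f n w) \<le> M n)" if z: "z \<in> S" for z
  proof -
    obtain M where M: "summable M" "\<forall>\<^sub>F w in nhds z. \<forall>n. norm (d n w) \<le> M n"
      using dom[of z] z by (auto simp: S_def)
    have "\<forall>\<^sub>F w in nhds z. w \<in> S"
      using S z by (intro eventually_nhds_in_open)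
    with M(2) have "\<forall>\<^sub>F w in nhds z. \<forall>n. norm (f n w) \<le> M n / (e / 2)"
    proof eventually_elim
      case (elim w)
      show ?case
      proof
        fix n
        have "M n \<ge> 0"
          using elim(1) norm_ge_zero order_trans by blast
        show "norm (f n w) \<le> M n / (e / 2)"
        proof (cases "n \<in> I")
          case True
          have "norm (d n w) / norm (a * w + b + of_nat n) \<le> M n / (e / 2)"
            using elim e(1) denom[of w n] True \<open>M n \<ge> 0\<close> by (intro frac_le) auto
          thus ?thesis
            using True by (simp only: f_def norm_divide if_True)
        next
          case False
          thus ?thesis
            using e(1) \<open>M n \<ge> 0\<close> by (simp add: f_def)
        qed
      qed
    qed
    moreover have "summable (\<lambda>n. M n / (e / 2))"
      by (intro summable_divide M)
    ultimately show ?thesis by blast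
  qed
  have "(\<lambda>s. \<Sum>n. f n s) holomorphic_on S"
  proof (rule holomorphic_suminf[OF S(1) _ bound])
    fix n
    have "a * s + b + of_nat n \<noteq> 0" if "s \<in> S" "n \<in> I" for s
      using denom[OF that] e(1) by auto
    thus "f n holomorphic_on S"
      unfolding f_def using holomorphic_on_subset[OF hol[of n], of S]
      by (cases "n \<in> I") (auto simp: S_def intro!: holomorphic_intros)
  qed
  thus "(\<lambda>s. \<Sum>n. f n s) analytic_on {z0}"
    using S by (auto simp: analytic_at)
  have "\<forall>\<^sub>F s in nhds z0. s \<in> S"
    using S by (intro eventually_nhds_in_open)
  thus "\<forall>\<^sub>F s in nhds z0. summable (\<lambda>n. f n s)"
  proof eventually_elim
    case (elim s)
    obtain M where M: "summable M" "\<forall>\<^sub>F w in nhds s. \<forall>n. norm (f n w) \<le> M n"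
      using bound[OF elim] by blast
    show ?case
      by (rule summable_comparison_test'[where N = 0, OF M(1)]) (use eventually_nhds_x_imp_x[OF M(2)] in auto)
  qed
qed

lemma pole_sum_no_root:
  assumes "\<And>n. a * z0 + b + of_nat n \<noteq> 0"
  shows "simple_part (\<lambda>s. \<Sum>n. d n s / (a * s + b + of_nat n)) z0 0"
  using pole_sum_analytic(1)[of UNIV] assms by (intro simple_part_analytic) simp

text \<open>At most one denominator vanishes at \<open>z0\<close>. Its term is
  \<open>d N s / (a * (s - z0))\<close>, and the rest of the series is analytic.\<close>

lemma pole_sum_root:
  assumes a: "a \<noteq> 0" and N: "a * z0 + b + of_nat N = 0"
  shows "simple_part (\<lambda>s. \<Sum>n. d n s / (a * s + b + of_nat n)) z0 (d N z0 / a)"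
proof -
  have I: "a * z0 + b + of_nat n \<noteq> 0" if "n \<in> -{N}" for n
  proof
    assume "a * z0 + b + of_nat n = 0"
    hence "of_nat n = (of_nat N :: complex)"
      using N by (metis add_left_cancel)
    thus False
      using that by simp
  qed
  define f where "f = (\<lambda>n s. if n \<in> -{N} then d n s / (a * s + b + of_nat n) else 0)"
  have "simple_part (\<lambda>s. \<Sum>n. f n s) z0 0"
    unfolding f_def by (intro simple_part_analytic pole_sum_analytic(1) I)
  moreover have "simple_part (\<lambda>s. d N s / a / (s - z0)) z0 (d N z0 / a)"
    unfolding simple_part_def
  proof (intro exI[of _ "\<lambda>s. d N s / a"] conjI)
    have "d N analytic_on {z0}"
      using hol U by (auto simp: analytic_at)
    thus "(\<lambda>s. d N s / a) analytic_on {z0}"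
      using a by (intro analytic_intros) auto
  qed auto
  ultimately have "simple_part (\<lambda>s. (\<Sum>n. f n s) + d N s / a / (s - z0)) z0 (0 + d N z0 / a)"
    by (rule simple_part_add)
  moreover have "\<forall>\<^sub>F s in at z0. (\<Sum>n. d n s / (a * s + b + of_nat n)) = (\<Sum>n. f n s) + d N s / a / (s - z0)"
  proof -
    have "\<forall>\<^sub>F s in nhds z0. summable (\<lambda>n. f n s)"
      unfolding f_def by (rule pole_sum_analytic(2)[OF I])
    hence "\<forall>\<^sub>F s in nhds z0. (\<Sum>n. d n s / (a * s + b + of_nat n)) = (\<Sum>n. f n s) + d N s / a / (s - z0)"
    proof eventually_elim
      case (elim s)
      have "(\<lambda>n. f n s + (if n = N then d N s / (a * s + b + of_nat N) else 0)) sums ((\<Sum>n. f n s) + d N s / (a * s + b + of_nat N))"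
        using sums_single[of N "\<lambda>_. d N s / (a * s + b + of_nat N)"]
        by (intro sums_add summable_sums elim) (auto simp: eq_commute)
      also have "(\<lambda>n. f n s + (if n = N then d N s / (a * s + b + of_nat N) else 0)) = (\<lambda>n. d n s / (a * s + b + of_nat n))"
        by (auto simp: f_def)
      also have "a * s + b + of_nat N = a * (s - z0)"
        using N by (simp add: algebra_simps)
      finally show ?case
        by (simp add: sums_iff)
    qed
    thus ?thesis
      by (auto simp: eventually_at_filter elim: eventually_mono)
  qed
  ultimately show ?thesis
    by (auto intro: simple_part_cong)
qed

end

section \<open>Residues of the continued Mellin integral\<close>

lemma analytic_Gamma_reflect:
  assumes "Re z < 1"
  shows "(\<lambda>s. Gamma (1 - s)) analytic_on {z}"
  using assms by (intro analytic_intros) (auto elim!: nonpos_Ints_cases simp: complex_eq_iff)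

lemma zeta_coeff_dominated:
  assumes "Re s < 1"
  shows "\<exists>M. summable M \<and> (\<forall>\<^sub>F w in nhds s. \<forall>n. norm (zeta_coeff n w) \<le> M n)"
proof -
  obtain C where "\<forall>\<^sub>F w in nhds s. \<forall>n. norm (zeta_coeff n w) \<le> C * (1 / 2) ^ n"
    using zeta_coeff_bound[OF assms] by blast
  moreover have "summable (\<lambda>n. C * (1 / 2 :: real) ^ n)"
    by (rule summable_mult, rule summable_geometric) simp
  ultimately show ?thesis by blast
qed

lemma holomorphic_zeta_conv: "zeta_conv n holomorphic_on {s. Re s < 1}"
  unfolding zeta_conv_def by (intro holomorphic_intros holomorphic_zeta_coeff)

text \<open>The denominators are spelled \<open>2 * s + (-1)\<close> and \<open>1 * s + 0\<close> to
  match the pattern \<open>a * s + b + of_nat n\<close> of the general results.\<close>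

lemma omega_poles_simple_part:
  assumes z: "Re z < 1"
    and r1: "simple_part (\<lambda>s. Gamma (1 - s) ^ 2 / (3 * s - 2)) z r1"
    and r2: "simple_part (\<lambda>s. \<Sum>n. zeta_coeff n s / (2 * s + (-1) + of_nat n)) z r2"
    and r3: "simple_part (\<lambda>s. \<Sum>n. zeta_conv n s / (1 * s + 0 + of_nat n)) z r3"
  shows "simple_part omega_poles z (r1 + 2 * Gamma (1 - z) * r2 + r3)"
proof -
  have "omega_upper analytic_on {z}"
    using holomorphic_omega_upper by (auto simp: analytic_at)
  hence "simple_part omega_upper z 0"
    by (rule simple_part_analytic)
  moreover have "simple_part (\<lambda>s. 2 * Gamma (1 - s) * (\<Sum>n. zeta_coeff n s / (2 * s + (-1) + of_nat n))) z (2 * Gamma (1 - z) * r2)"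
    using z by (intro simple_part_mult r2 analytic_on_mult analytic_on_const analytic_Gamma_reflect)
  ultimately have "simple_part (\<lambda>s. omega_upper s + Gamma (1 - s) ^ 2 / (3 * s - 2) +
      2 * Gamma (1 - s) * (\<Sum>n. zeta_coeff n s / (2 * s + (-1) + of_nat n)) + (\<Sum>n. zeta_conv n s / (1 * s + 0 + of_nat n))) z
      (0 + r1 + 2 * Gamma (1 - z) * r2 + r3)"
    by (intro simple_part_add r1 r3)
  thus ?thesis
    by (simp add: omega_poles_def[abs_def])
qed

lemma Gamma_square_simple_part:
  assumes z: "Re z < 1"
  shows "simple_part (\<lambda>s. Gamma (1 - s) ^ 2 / (3 * s - 2)) z (if z = 2 / 3 then Gamma (1 / 3) ^ 2 / 3 else 0)"
proof (cases "z = 2 / 3")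
  case True
  have "(\<lambda>s. Gamma (1 - s) ^ 2 / 3) analytic_on {z}"
    using z by (intro analytic_intros analytic_Gamma_reflect) auto
  moreover have "Gamma (1 - s) ^ 2 / (3 * s - 2) = Gamma (1 - s) ^ 2 / 3 / (s - z)" for s
    unfolding True by (simp add: field_simps)
  moreover have "Gamma (1 - z) ^ 2 / 3 = Gamma (1 / 3) ^ 2 / 3"
    unfolding True by simp
  ultimately have "simple_part (\<lambda>s. Gamma (1 - s) ^ 2 / (3 * s - 2)) z (Gamma (1 / 3) ^ 2 / 3)"
    unfolding simple_part_def by (intro exI[of _ "\<lambda>s. Gamma (1 - s) ^ 2 / 3"]) (simp only: always_eventually simp_thms)
  thus ?thesis
    by (subst if_P[OF True])
next
  case False
  hence "3 * z - 2 \<noteq> 0"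
    by (simp add: field_simps)
  hence "(\<lambda>s. Gamma (1 - s) ^ 2 / (3 * s - 2)) analytic_on {z}"
    using z by (intro analytic_intros analytic_Gamma_reflect) auto
  thus ?thesis
    using False by (simp add: simple_part_analytic)
qed

lemma zeta_coeff_sum_root:
  assumes z: "Re z < 1" and n: "2 * z - 1 + of_nat n = 0"
  shows "simple_part (\<lambda>s. \<Sum>n. zeta_coeff n s / (2 * s + (-1) + of_nat n)) z (zeta_coeff n z / 2)"
  by (rule pole_sum_root[of "{s. Re s < 1}"])
     (use assms in \<open>auto intro: open_halfspace_Re_lt holomorphic_zeta_coeff zeta_coeff_dominated\<close>)

lemma zeta_coeff_sum_no_root:
  assumes z: "Re z < 1" and n: "\<And>n::nat. 2 * z - 1 + of_nat n \<noteq> 0"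
  shows "simple_part (\<lambda>s. \<Sum>n. zeta_coeff n s / (2 * s + (-1) + of_nat n)) z 0"
  by (rule pole_sum_no_root[of "{s. Re s < 1}"])
     (use assms in \<open>auto intro: open_halfspace_Re_lt holomorphic_zeta_coeff zeta_coeff_dominated\<close>)

lemma zeta_conv_sum_root:
  assumes "z = - of_nat n"
  shows "simple_part (\<lambda>s. \<Sum>n. zeta_conv n s / (1 * s + 0 + of_nat n)) z (zeta_conv n z / 1)"
  by (rule pole_sum_root[of "{s. Re s < 1}"])
     (use assms in \<open>auto intro: open_halfspace_Re_lt holomorphic_zeta_conv zeta_conv_bound\<close>)

lemma zeta_conv_sum_no_root:
  assumes z: "Re z < 1" and n: "\<And>n::nat. z \<noteq> - of_nat n"
  shows "simple_part (\<lambda>s. \<Sum>n. zeta_conv n s / (1 * s + 0 + of_nat n)) z 0"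
  by (rule pole_sum_no_root[of "{s. Re s < 1}"])
     (use assms in \<open>auto intro: open_halfspace_Re_lt holomorphic_zeta_conv zeta_conv_bound simp: add_eq_0_iff2\<close>)

lemma half_minus_nat_ne_nat: "1 / 2 - of_nat k \<noteq> (- of_nat n :: complex)"
proof
  assume "1 / 2 - of_nat k = (- of_nat n :: complex)"
  hence "(of_nat (1 + 2 * n) :: complex) = of_nat (2 * k)"
    by (simp add: field_simps)
  hence "1 + 2 * n = 2 * k"
    by (simp only: of_nat_eq_iff)
  thus False
    by presburger
qed

lemma omega_poles_two_thirds: "simple_part omega_poles (2 / 3) (1 / 3 * Gamma (1 / 3) ^ 2)"
proof -
  have "2 * (2 / 3) - 1 + of_nat n \<noteq> (0 :: complex)" for n
  proof
    assume "2 * (2 / 3) - 1 + of_nat n = (0 :: complex)"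
    hence "Re (2 * (2 / 3) - 1 + of_nat n) = 0"
      by (simp only: zero_complex.sel)
    thus False by simp
  qed
  moreover have "2 / 3 \<noteq> (- of_nat n :: complex)" for n
  proof
    assume "2 / 3 = (- of_nat n :: complex)"
    hence "Re (2 / 3) = Re (- of_nat n)"
      by (simp only:)
    thus False by simp
  qed
  ultimately show ?thesis
    using omega_poles_simple_part[OF _ Gamma_square_simple_part zeta_coeff_sum_no_root zeta_conv_sum_no_root, of "2 / 3"] by simp
qed

text \<open>Only the middle series has a pole here, at the index \<open>2 * k\<close>. The factor 2
  of the mixed term cancels the slope 2 of the denominator.\<close>

lemma omega_poles_half_minus_nat:
  "simple_part omega_poles (1 / 2 - of_nat k) (Gamma (1 / 2 + of_nat k) * zeta_coeff (2 * k) (1 / 2 - of_nat k))"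
proof -
  define z :: complex where "z = 1 / 2 - of_nat k"
  have z: "Re z < 1" "z \<noteq> 2 / 3"
    by (auto simp: z_def complex_eq_iff field_simps)
  have "2 * z - 1 + of_nat (2 * k) = 0"
    by (simp add: z_def)
  moreover have "1 - z = 1 / 2 + of_nat k"
    by (simp add: z_def)
  ultimately show ?thesis
    using omega_poles_simple_part[OF z(1) Gamma_square_simple_part[OF z(1)] zeta_coeff_sum_root[OF z(1)] zeta_conv_sum_no_root[OF z(1)], of "2 * k"]
      half_minus_nat_ne_nat[of k] z(2) by (simp add: z_def)
qed

text \<open>Two families meet: the index \<open>2 * M + 1\<close> of the middle series and the index
  \<open>M\<close> of the last one. The factor \<open>fact M\<close> is
  \<open>Gamma (1 + M)\<close>.\<close>

lemma omega_poles_neg_nat: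
  "simple_part omega_poles (- of_nat M) (fact M * zeta_coeff (2 * M + 1) (- of_nat M) + zeta_conv M (- of_nat M))"
proof -
  define z :: complex where "z = - of_nat M"
  have z: "Re z < 1" "z \<noteq> 2 / 3"
    by (auto simp: z_def complex_eq_iff)
  have "2 * z - 1 + of_nat (2 * M + 1) = 0"
    by (simp add: z_def)
  moreover have "Gamma (1 - z) = fact M"
    by (simp add: z_def Gamma_fact)
  ultimately show ?thesis
    using omega_poles_simple_part[OF z(1) Gamma_square_simple_part[OF z(1)] zeta_coeff_sum_root[OF z(1)] zeta_conv_sum_root[OF z_def], of "2 * M + 1"] z(2)
    by (simp add: z_def)
qed

lemma omega_poles_zero: "simple_part omega_poles 0 (1 / 3)"
proof -
  \<comment> \<open>The two contributions are 1/12 and the square of -1/2.\<close>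
  have eq: "fact 0 * zeta_coeff (2 * 0 + 1) (- of_nat 0) + zeta_conv 0 (- of_nat 0) = 1 / 3"
    by (simp add: zeta_conv_def zeta_coeff_0_0 zeta_coeff_1_0[unfolded One_nat_def])
  show ?thesis
    using omega_poles_neg_nat[of 0] unfolding eq by simp
qed

lemma omega_poles_regular:
  assumes z: "Re z < 1" and nz: "z \<notin> {2 / 3, 0} \<union> range (\<lambda>k::nat. 1 / 2 - of_nat k)"
  shows "simple_part omega_poles z 0"
proof (cases "\<exists>M::nat. z = - of_nat M")
  case True
  then obtain M :: nat where M: "z = - of_nat M"
    by blast
  have "M > 0"
    using nz M by (cases M) auto
  thus ?thesis
    using omega_poles_neg_nat[of M] zeta_coeff_residue_cancel[of M] by (simp add: M zeta_conv_def)
next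
  case False
  \<comment> \<open>Even indices have their roots at \<open>1/2 - k\<close>, excluded by hypothesis;
    odd ones at \<open>- k\<close>, excluded in the present case.\<close>
  have "2 * z - 1 + of_nat n \<noteq> 0" for n
  proof
    assume *: "2 * z - 1 + of_nat n = 0"
    show False
    proof (cases "even n")
      case True
      then obtain k where "n = 2 * k"
        by (auto elim: evenE)
      hence eq: "2 * z = 2 * (1 / 2 - of_nat k)"
        using * by (simp add: algebra_simps)
      have "z = 2 * z / 2"
        by simp
      also have "\<dots> = 1 / 2 - of_nat k"
        unfolding eq by simp
      finally have "z = 1 / 2 - of_nat k" .
      thus False
        using nz by blast
    next
      case odd: False
      then obtain k where "n = 2 * k + 1"
        by (auto elim: oddE)
      hence "2 * z = 2 * (- of_nat k)"
        using * by (simp add: algebra_simps add_eq_0_iff)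
      hence "z = - of_nat k"
        by simp
      thus False
        using False by blast
    qed
  qed
  thus ?thesis
    using omega_poles_simple_part[OF z Gamma_square_simple_part[OF z] zeta_coeff_sum_no_root[OF z] zeta_conv_sum_no_root[OF z]] False nz by auto
qed

lemma Gamma_omega_series_eq:
  assumes s: "2 / 3 < Re s" "Re s < 1"
  shows "Gamma s * omega_series s = omega_poles s"
proof -
  let ?S = "{s. 2 / 3 < Re s} \<inter> {s. Re s < 1}"
  let ?f = "\<lambda>s. Gamma s * omega_series s - omega_poles s"
  have ana: "omega_poles analytic_on {s}" if "s \<in> ?S" for s
  proof -
    have n: "2 * s + (-1) + of_nat n \<noteq> 0" "1 * s + 0 + of_nat n \<noteq> 0" for n
      using that by (auto simp: complex_eq_iff)
    have "(\<lambda>s. \<Sum>n. zeta_coeff n s / (2 * s + (-1) + of_nat n)) analytic_on {s}"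
      using pole_sum_analytic(1)[of "{s. Re s < 1}" s zeta_coeff UNIV 2 "-1"] that n(1)
      by (simp add: open_halfspace_Re_lt holomorphic_zeta_coeff zeta_coeff_dominated)
    moreover have "(\<lambda>s. \<Sum>n. zeta_conv n s / (1 * s + 0 + of_nat n)) analytic_on {s}"
      using pole_sum_analytic(1)[of "{s. Re s < 1}" s zeta_conv UNIV 1 0] that n(2)
      by (simp add: open_halfspace_Re_lt holomorphic_zeta_conv zeta_conv_bound)
    moreover have "omega_upper analytic_on {s}"
      using holomorphic_omega_upper by (auto simp: analytic_at)
    moreover have "(\<lambda>s. Gamma (1 - s)) analytic_on {s}"
      using that by (intro analytic_Gamma_reflect) auto
    moreover have "3 * s - 2 \<noteq> 0" "1 - s \<notin> \<int>\<^sub>\<le>\<^sub>0"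
      using that by (auto simp: complex_eq_iff elim!: nonpos_Ints_cases)
    ultimately show ?thesis
      unfolding omega_poles_def[abs_def] by (intro analytic_intros) auto
  qed
  have "?f s = 0"
  proof (rule analytic_continuation[of ?f ?S "complex_of_real ` {2 / 3<..<1}" "of_real (5 / 6)"])
    have "omega_poles holomorphic_on ?S"
      using ana analytic_on_analytic_at analytic_imp_holomorphic by blast
    moreover have "Gamma holomorphic_on ?S"
      by (intro holomorphic_Gamma) (auto elim!: nonpos_Ints_cases)
    moreover have "omega_series holomorphic_on ?S"
      by (rule holomorphic_on_subset[OF holomorphic_omega_series]) auto
    ultimately show "?f holomorphic_on ?S"
      by (intro holomorphic_on_diff holomorphic_on_mult)
    show "open ?S"
      by (intro open_Int open_halfspace_Re_gt open_halfspace_Re_lt)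
    show "connected ?S"
      by (intro convex_connected convex_Int convex_halfspace_Re_gt convex_halfspace_Re_lt)
    show "complex_of_real (5 / 6) islimpt complex_of_real ` {2 / 3<..<1}"
      by (rule islimpt_complex_of_real_Ioo) auto
    fix z assume "z \<in> complex_of_real ` {2 / 3<..<1}"
    then obtain x where x: "z = of_real x" "2 / 3 < x" "x < 1"
      by auto
    thus "?f z = 0"
      using Gamma_omega_series_real[of x] by simp
  qed (use s in auto)
  thus ?thesis
    by simp
qed

section \<open>The continuation of omega and its product with Gamma\<close>

definition omega_extension :: "complex \<Rightarrow> complex" where
  "omega_extension s = (if Re s > 2 / 3 then omega_series s else rGamma s * omega_poles s)"

lemma Gamma_ne_0_right: "Re s > 0 \<Longrightarrow> Gamma s \<noteq> (0 :: complex)"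
  by (auto simp: Gamma_eq_zero_iff elim!: nonpos_Ints_cases)

text \<open>The two formulas agree on the strip where they overlap, so the gluing by cases is
  consistent. Multiplying by the entire \<open>rGamma\<close> instead of dividing by
  \<open>Gamma\<close> introduces no new singularities.\<close>

lemma omega_extension_left:
  assumes "Re s < 1"
  shows "omega_extension s = rGamma s * omega_poles s"
proof (cases "Re s > 2 / 3")
  case True
  have "rGamma s * omega_poles s = rGamma s * Gamma s * omega_series s"
    using Gamma_omega_series_eq[OF True assms] by simp
  also have "rGamma s * Gamma s = 1"
    using Gamma_ne_0_right[of s] True by (simp add: rGamma_inverse_Gamma)
  finally show ?thesis
    using True by (simp add: omega_extension_def)
qed (simp add: omega_extension_def)

lemma ex_omega_poles_simple_part:
  assumes "Re z < 1"
  shows "\<exists>r. simple_part omega_poles z r"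
  using omega_poles_regular[OF assms] omega_poles_two_thirds omega_poles_zero omega_poles_half_minus_nat
  by blast

lemma eventually_Re_less:
  assumes "Re z < c"
  shows "\<forall>\<^sub>F s in at z. Re s < c"
proof -
  have "\<forall>\<^sub>F s in at z. s \<in> {s. Re s < c}"
    using assms by (intro eventually_at_in_open' open_halfspace_Re_lt) auto
  thus ?thesis by simp
qed

lemma omega_extension_analytic:
  assumes "Re z > 2 / 3"
  shows "omega_extension analytic_on {z}"
proof -
  have "omega_series analytic_on {z}"
    using holomorphic_omega_series open_halfspace_Re_gt[of "2 / 3"] assms by (auto simp: analytic_at)
  moreover have "\<forall>\<^sub>F s in nhds z. s \<in> {s. Re s > 2 / 3}"
    using assms by (intro eventually_nhds_in_open open_halfspace_Re_gt) auto
  hence "\<forall>\<^sub>F s in nhds z. omega_extension s = omega_series s"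
    by eventually_elim (auto simp: omega_extension_def)
  ultimately show ?thesis
    using analytic_at_cong[of omega_extension omega_series z z] by simp
qed

lemma omega_extension_meromorphic: "omega_extension meromorphic_on UNIV"
proof -
  have "omega_extension meromorphic_on {z}" for z
  proof (cases "Re z > 2 / 3")
    case True
    thus ?thesis
      by (intro analytic_on_imp_meromorphic_on omega_extension_analytic)
  next
    case False
    hence z: "Re z < 1"
      by simp
    obtain r where "simple_part omega_poles z r"
      using ex_omega_poles_simple_part[OF z] by blast
    hence "(\<lambda>s. rGamma s * omega_poles s) meromorphic_on {z}"
      by (intro meromorphic_intros simple_part_meromorphic analytic_on_imp_meromorphic_on analytic_rGamma)
    moreover have "\<forall>\<^sub>F s in at z. omega_extension s = rGamma s * omega_poles s"
      using eventually_Re_less[OF z] by eventually_elim (rule omega_extension_left)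
    ultimately show ?thesis
      using meromorphic_on_cong[of "{z}" omega_extension "\<lambda>s. rGamma s * omega_poles s" "{z}"] by simp
  qed
  thus ?thesis
    using meromorphic_on_meromorphic_at by blast
qed

lemma omega_continuation: "is_meromorphic_continuation {s. Re s > 2 / 3} omega_series (remove_sings omega_extension)"
  unfolding is_meromorphic_continuation_def
proof (intro conjI ballI)
  show "remove_sings omega_extension nicely_meromorphic_on UNIV"
    by (rule remove_sings_nicely_meromorphic[OF omega_extension_meromorphic])
  fix s assume "s \<in> {s. Re s > 2 / 3}"
  thus "remove_sings omega_extension s = omega_series s"
    using remove_sings_at_analytic[OF omega_extension_analytic[of s]] by (simp add: omega_extension_def)
qed

lemma omega_eq: "omega = remove_sings omega_extension"
  unfolding omega_def meromorphic_continuation_def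
proof (rule the_equality, rule omega_continuation)
  have "(1 :: complex) \<in> {s. Re s > 2 / 3}"
    by simp
  thus "F = remove_sings omega_extension" if "is_meromorphic_continuation {s. Re s > 2 / 3} omega_series F" for F
    using is_meromorphic_continuation_unique[OF open_halfspace_Re_gt _ that omega_continuation] by blast
qed

text \<open>The nonpositive integers other than \<open>z\<close> form a closed set that misses
  \<open>z\<close>.\<close>

lemma eventually_rGamma_ne_0: "\<forall>\<^sub>F s in at z. rGamma s \<noteq> (0 :: complex)"
proof -
  have "closed (\<int>\<^sub>\<le>\<^sub>0 - {z} :: complex set)"
    by (rule closed_subset_Ints) (auto simp: nonpos_Ints_subset_Ints[THEN subsetD])
  hence "\<forall>\<^sub>F s in at z. s \<in> - (\<int>\<^sub>\<le>\<^sub>0 - {z})"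
    by (intro eventually_at_in_open' open_Compl) auto
  moreover have "\<forall>\<^sub>F s in at z. s \<noteq> z"
    by (auto simp: eventually_at_filter)
  ultimately show ?thesis
    by eventually_elim (auto simp: rGamma_eq_zero_iff)
qed

text \<open>A punctured neighbourhood is the right domain, because \<open>Gamma\<close> has the
  value 0 at its poles; \<open>remove_sings\<close> in \<open>Gamma_omega\<close> absorbs the
  difference.\<close>

lemma Gamma_omega_eventually:
  assumes z: "Re z < 1"
  shows "\<forall>\<^sub>F s in at z. Gamma s * omega s = omega_poles s"
proof -
  have "isolated_singularity_at omega_extension z"
    using omega_extension_meromorphic by (auto simp: meromorphic_on_altdef)
  hence "\<forall>\<^sub>F s in at z. omega s = omega_extension s"
    unfolding omega_eq by (rule eventually_remove_sings_eq_at)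
  with eventually_Re_less[OF z] eventually_rGamma_ne_0[of z] show ?thesis
  proof eventually_elim
    case (elim s)
    have "Gamma s * rGamma s = 1"
      using elim(2) by (simp add: Gamma_def)
    thus ?case
      using elim omega_extension_left[of s] by (simp add: mult.assoc[symmetric])
  qed
qed

lemma Gamma_omega_simple_part:
  assumes "Re z < 1" "simple_part omega_poles z r"
  shows "simple_part Gamma_omega z r"
  unfolding Gamma_omega_def
  by (intro simple_part_remove_sings simple_part_cong[OF Gamma_omega_eventually]) (use assms in auto)

lemma Gamma_omega_analytic_right:
  assumes "Re z > 2 / 3"
  shows "Gamma_omega analytic_on {z}"
proof -
  have "omega analytic_on {z}"
    unfolding omega_eq by (intro remove_sings_analytic_on omega_extension_analytic assms)
  moreover have "Gamma analytic_on {z}"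
    using assms by (intro analytic_Gamma) (auto elim!: nonpos_Ints_cases)
  ultimately show ?thesis
    unfolding Gamma_omega_def by (intro remove_sings_analytic_on analytic_on_mult)
qed

lemma Gamma_omega_analytic_left:
  assumes z: "Re z < 1" "z \<notin> {2 / 3, 0} \<union> range (\<lambda>k::nat. 1 / 2 - of_nat k)"
  shows "Gamma_omega analytic_on {z}"
  unfolding Gamma_omega_def
  by (intro simple_part_0_analytic simple_part_cong[OF Gamma_omega_eventually[OF z(1)]] omega_poles_regular z)

lemma Gamma_half_plus_nat:
  "Gamma (1 / 2 + of_nat k) = fact (2 * k) / (4 ^ k * fact k) * (of_real (sqrt pi) :: complex)"
proof (induction k)
  case (Suc k)
  have "Gamma (1 / 2 + of_nat (Suc k)) = Gamma ((1 / 2 + of_nat k) + 1 :: complex)"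
    by (simp add: add_ac)
  also have "\<dots> = (1 / 2 + of_nat k) * Gamma (1 / 2 + of_nat k :: complex)"
    by (rule Gamma_plus1) (auto elim!: nonpos_Ints_cases simp: complex_eq_iff)
  also have "\<dots> = (1 / 2 + of_nat k) * (fact (2 * k) / (4 ^ k * fact k)) * of_real (sqrt pi)"
    unfolding Suc.IH by simp
  also have "(1 / 2 + of_nat k) * (fact (2 * k) / (4 ^ k * fact k)) = (fact (2 * Suc k) / (4 ^ Suc k * fact (Suc k)) :: complex)"
  proof -
    have "fact (2 * Suc k) = (2 * of_nat (Suc k)) * (2 * (1 / 2 + of_nat k)) * (fact (2 * k) :: complex)"
      by (simp add: algebra_simps)
    moreover have "fact (Suc k) = of_nat (Suc k) * (fact k :: complex)"
      by simp
    ultimately show ?thesis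
      by (simp only:) (simp add: field_simps del: of_nat_Suc)
  qed
  finally show ?case .
qed (simp add: Gamma_one_half_complex)

text \<open>The factor \<open>fact (2 * k)\<close> in \<open>Gamma (1 / 2 + k)\<close> cancels the
  one in \<open>zeta_coeff (2 * k)\<close>, and \<open>1/2 - k - 2 * k = (1 - 6 * k) / 2\<close>
  lies off the line \<open>Re s = 1\<close>.\<close>

lemma residue_half_minus_nat:
  "Gamma (1 / 2 + of_nat k) * zeta_coeff (2 * k) (1 / 2 - of_nat k) =
     1 / (4 ^ k * fact k) * of_real (sqrt pi) * zeta ((1 - 6 * of_nat k) / 2)"
proof -
  have 1: "1 / 2 - of_nat k - of_nat (2 * k) = (1 - 6 * of_nat k) / (2 :: complex)"
    by (simp add: field_simps)
  have "Re ((1 - 6 * of_nat k) / 2) \<noteq> 1"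
    by simp
  hence 2: "zeta ((1 - 6 * of_nat k) / 2) = zeta_eta ((1 - 6 * of_nat k) / 2)"
    by (rule zeta_eq_zeta_eta)
  show ?thesis
    unfolding zeta_coeff_def 1 2 Gamma_half_plus_nat by simp
qed

lemma residue_half_minus_nat_ne_0:
  "Gamma (1 / 2 + of_nat k) * zeta_coeff (2 * k) (1 / 2 - of_nat k) \<noteq> 0"
proof -
  have 1: "1 / 2 - of_nat k - of_nat (2 * k) = (1 / 2 - 3 * of_nat k :: complex)"
    by simp
  show ?thesis
    unfolding zeta_coeff_def 1 using zeta_eta_half_minus_ne_0[of k] Gamma_ne_0_right[of "1 / 2 + of_nat k"] by simp
qed

theorem theorem4p1:
  shows "(\<forall>s. Re s > 2/3 \<longrightarrow> omega_term s summable_on ({1..} \<times> {1..})) \<and>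
    is_meromorphic_continuation {s. Re s > 2/3} omega_series omega \<and>
    Gamma_omega meromorphic_on UNIV \<and>
    has_simple_pole Gamma_omega (2/3) \<and>
    residue Gamma_omega (2/3) = 1/3 * Gamma (1/3) ^ 2 \<and>
    has_simple_pole Gamma_omega 0 \<and>
    residue Gamma_omega 0 = 1/3 \<and>
    (\<forall>k::nat.
       has_simple_pole Gamma_omega (1/2 - of_nat k) \<and>
       residue Gamma_omega (1/2 - of_nat k) =
         1 / (4 ^ k * fact k) * of_real (sqrt pi) * zeta ((1 - 6 * of_nat k) / 2)) \<and>
    Gamma_omega analytic_on (- ({2/3, 0} \<union> range (\<lambda>k::nat. 1/2 - of_nat k)))"
proof (intro conjI allI impI)
  show "omega_term s summable_on ({1..} \<times> {1..})" if "Re s > 2/3" for s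
    by (rule summable_omega_term[OF that])
  show "is_meromorphic_continuation {s. Re s > 2/3} omega_series omega"
    unfolding omega_eq by (rule omega_continuation)
  have p1: "simple_part Gamma_omega (2/3) (1/3 * Gamma (1/3) ^ 2)"
    by (rule Gamma_omega_simple_part[OF _ omega_poles_two_thirds]) simp
  have p2: "simple_part Gamma_omega 0 (1/3)"
    by (rule Gamma_omega_simple_part[OF _ omega_poles_zero]) simp
  have p3: "simple_part Gamma_omega (1/2 - of_nat k) (Gamma (1 / 2 + of_nat k) * zeta_coeff (2 * k) (1 / 2 - of_nat k))" for k
    by (rule Gamma_omega_simple_part[OF _ omega_poles_half_minus_nat]) simp
  show "has_simple_pole Gamma_omega (2/3)"
    by (rule simple_part_has_simple_pole[OF p1]) (use Gamma_ne_0_right[of "1/3"] in simp)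
  show "residue Gamma_omega (2/3) = 1/3 * Gamma (1/3) ^ 2"
    by (rule simple_part_residue[OF p1])
  show "has_simple_pole Gamma_omega 0"
    by (rule simple_part_has_simple_pole[OF p2]) simp
  show "residue Gamma_omega 0 = 1/3"
    by (rule simple_part_residue[OF p2])
  show "has_simple_pole Gamma_omega (1/2 - of_nat k)" for k
    by (rule simple_part_has_simple_pole[OF p3 residue_half_minus_nat_ne_0])
  show "residue Gamma_omega (1/2 - of_nat k) =
         1 / (4 ^ k * fact k) * of_real (sqrt pi) * zeta ((1 - 6 * of_nat k) / 2)" for k
    using simple_part_residue[OF p3] residue_half_minus_nat by simp
  show analytic: "Gamma_omega analytic_on (- ({2/3, 0} \<union> range (\<lambda>k::nat. 1/2 - of_nat k)))"
  proof -
    \<comment> \<open>The half-planes \<open>Re z > 2 / 3\<close> and \<open>Re z < 1\<close> cover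
      the plane.\<close>
    have "Gamma_omega analytic_on {z}" if "z \<notin> {2/3, 0} \<union> range (\<lambda>k::nat. 1/2 - of_nat k)" for z
      using Gamma_omega_analytic_right[of z] Gamma_omega_analytic_left[of z, OF _ that] by linarith
    thus ?thesis
      using analytic_on_analytic_at by blast
  qed
  show "Gamma_omega meromorphic_on UNIV"
  proof -
    have "Gamma_omega meromorphic_on {z}" for z
      using simple_part_meromorphic[OF p1] simple_part_meromorphic[OF p2] simple_part_meromorphic[OF p3]
        analytic_on_imp_meromorphic_on[OF analytic_on_subset[OF analytic, of "{z}"]] by blast
    thus ?thesis
      using meromorphic_on_meromorphic_at by blast
  qed
qed

end
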